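(* Let $G$ be a finitely generated group. For every normal subgroup $H$ of $G$ of finite index, ${\mathsf{CWP}}(G)$ is $\mathsf{AC}^0$-reducible to ${\mathsf{CWP}}(H)$ and ${\mathsf{CWP}}(G/H)$.
   Context: For a group $K$ generated by a finite set $\Sigma$, an SLP over the alphabet $\Sigma\cup\Sigma^{-1}$ is a triple $(V,S,\mathsf{rhs})$: $V$ a finite set of variables, $S\in V$ the start variable, and each $\mathsf{rhs}(A)$ is either a letter or a word $BC$ with $B,C\in V$, acyclically (there is a linear order on $V$ with $B<A$ whenever $B$ occurs in $\mathsf{rhs}(A)$); it derives a unique word from $S$. ${\mathsf{CWP}}(K)$ asks, given such an SLP, whether the derived word equals $1$ in $K$. (A finite-index subgroup $H$ of a finitely generated group is finitely generated, and $G/H$ is finite.) A language $A$ is $\mathsf{AC}^0$-reducible to languages $B_1,\dots,B_k$ if $A$ is decided by a DLOGTIME-uniform family of polynomial-size, constant-depth Boolean circuits using NOT gates, unbounded fan-in AND and OR gates, and oracle gates for the $B_i$, where a $B_i$-gate with ordered inputs $x_1,\dots,x_n$ outputs $1$ iff $x_1x_2\cdots x_n\in B_i$. *)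

theory Defs
  imports "HOL-Algebra.Algebra"
begin

section \<open>Straight-line programs\<close>

datatype ('v, 'l) rhs = Letter 'l | Pair 'v 'v

fun rhs_vars :: "('v, 'l) rhs \<Rightarrow> 'v set" where
  "rhs_vars (Letter a) = {}"
| "rhs_vars (Pair B C) = {B, C}"

definition is_slp :: "'l set \<Rightarrow> 'v set \<Rightarrow> 'v \<Rightarrow> ('v \<Rightarrow> ('v, 'l) rhs) \<Rightarrow> bool" where
  "is_slp L V S rhs \<longleftrightarrow>
     finite V \<and> S \<in> V \<and>
     (\<forall>A\<in>V. rhs_vars (rhs A) \<subseteq> V \<and> (\<forall>a. rhs A = Letter a \<longrightarrow> a \<in> L)) \<and>
     (\<exists>r. linear_order_on V r \<and>
          (\<forall>A\<in>V. \<forall>B\<in>rhs_vars (rhs A). (B, A) \<in> r \<and> B \<noteq> A))"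

inductive derives :: "('v \<Rightarrow> ('v, 'l) rhs) \<Rightarrow> 'v \<Rightarrow> 'l list \<Rightarrow> bool" for rhs where
  "rhs A = Letter a \<Longrightarrow> derives rhs A [a]"
| "rhs A = Pair B C \<Longrightarrow> derives rhs B u \<Longrightarrow> derives rhs C v \<Longrightarrow> derives rhs A (u @ v)"

section \<open>The compressed word problem\<close>

text \<open>A finite generating set is given by an enumeration \<open>gs\<close>, which fixes the binary code
  of the letters.  It is nonempty, as it serves as an alphabet: over the empty alphabet there
  are no straight-line programs.\<close>

definition generating_list :: "('a, 'b) monoid_scheme \<Rightarrow> 'a list \<Rightarrow> bool" where
  "generating_list K gs \<longleftrightarrow>
     gs \<noteq> [] \<and> distinct gs \<and> set gs \<subseteq> carrier K \<and> generate K (set gs) = carrier K"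

text \<open>The letter \<open>(i, e)\<close> stands for \<open>gs ! i\<close> if \<open>e\<close> is false, and for its inverse if
  \<open>e\<close> is true.\<close>

type_synonym letter = "nat \<times> bool"

definition letters :: "'a list \<Rightarrow> letter set" where
  "letters gs = {..<length gs} \<times> UNIV"

fun letter_val :: "('a, 'b) monoid_scheme \<Rightarrow> 'a list \<Rightarrow> letter \<Rightarrow> 'a" where
  "letter_val K gs (i, e) = (if e then inv\<^bsub>K\<^esub> (gs ! i) else gs ! i)"

definition word_val :: "('a, 'b) monoid_scheme \<Rightarrow> 'a list \<Rightarrow> letter list \<Rightarrow> 'a" where
  "word_val K gs w = foldr (\<lambda>a z. letter_val K gs a \<otimes>\<^bsub>K\<^esub> z) w \<one>\<^bsub>K\<^esub>"

text \<open>Binary representation, least significant bit first and without leading zeros.\<close>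

fun nat_bits :: "nat \<Rightarrow> bool list" where
  "nat_bits n = (if n = 0 then [] else odd n # nat_bits (n div 2))"

declare nat_bits.simps [simp del]

text \<open>Variables are arbitrary bit strings.  A straight-line program is written as a text
  \<open>S;\<dots>\<close> over the four symbols 0, 1, \<open>#\<close>, \<open>;\<close>, where the start variable \<open>S\<close> is followed by
  the rules in any order, each of the form \<open>A#B#C;\<close> or \<open>A#a;\<close> with \<open>a\<close> the code of a letter.
  Each symbol takes two bits: \<open>b\<close> becomes \<open>[True, b]\<close>, \<open>#\<close> becomes \<open>[False, False]\<close> and
  \<open>;\<close> becomes \<open>[False, True]\<close>.\<close>

definition enc_bits :: "bool list \<Rightarrow> bool list" where
  "enc_bits w = concat (map (\<lambda>b. [True, b]) w)"

definition enc_hash :: "bool list" where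
  "enc_hash = [False, False]"

definition enc_semi :: "bool list" where
  "enc_semi = [False, True]"

fun enc_rhs :: "(bool list, letter) rhs \<Rightarrow> bool list" where
  "enc_rhs (Letter (i, e)) = enc_bits (e # nat_bits i)"
| "enc_rhs (Pair B C) = enc_bits B @ enc_hash @ enc_bits C"

definition enc_slp ::
  "bool list list \<Rightarrow> bool list \<Rightarrow> (bool list \<Rightarrow> (bool list, letter) rhs) \<Rightarrow> bool list" where
  "enc_slp As S rhs = enc_bits S @ enc_semi @
     concat (map (\<lambda>A. enc_bits A @ enc_hash @ enc_rhs (rhs A) @ enc_semi) As)"

definition CWP :: "('a, 'b) monoid_scheme \<Rightarrow> 'a list \<Rightarrow> bool list set" where
  "CWP K gs = {enc_slp As S rhs | As S rhs.
     distinct As \<and> is_slp (letters gs) (set As) S rhs \<and>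
     (\<exists>w. derives rhs S w \<and> word_val K gs w = \<one>\<^bsub>K\<^esub>)}"

section \<open>Multi-tape Turing machines\<close>

datatype move = MoveL | Stay | MoveR

text \<open>States and tape symbols are initial segments of the natural numbers.  Symbol 0 is the
  blank; symbols 1 and 2 represent the bits 0 and 1.  Tapes are infinite in both directions.\<close>

record tm =
  tm_tapes :: nat
  tm_states :: nat
  tm_symbols :: nat
  tm_init :: nat
  tm_acc :: nat
  tm_rej :: nat
  tm_trans :: "nat \<Rightarrow> nat list \<Rightarrow> nat \<times> (nat \<times> move) list"

definition wf_tm :: "tm \<Rightarrow> bool" where
  "wf_tm M \<longleftrightarrow>
     tm_init M < tm_states M \<and> tm_acc M < tm_states M \<and> tm_rej M < tm_states M \<and>
     tm_acc M \<noteq> tm_rej M \<and> 3 \<le> tm_symbols M \<and>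
     (\<forall>q<tm_states M. \<forall>ss. length ss = tm_tapes M \<and> set ss \<subseteq> {..<tm_symbols M} \<longrightarrow>
        (case tm_trans M q ss of (q', as) \<Rightarrow>
           q' < tm_states M \<and> length as = tm_tapes M \<and> fst ` set as \<subseteq> {..<tm_symbols M}))"

type_synonym tape = "(int \<Rightarrow> nat) \<times> int"
type_synonym config = "nat \<times> tape list"

fun tape_read :: "tape \<Rightarrow> nat" where
  "tape_read (t, p) = t p"

fun tape_act :: "nat \<times> move \<Rightarrow> tape \<Rightarrow> tape" where
  "tape_act (s, m) (t, p) =
     (t(p := s), case m of MoveL \<Rightarrow> p - 1 | Stay \<Rightarrow> p | MoveR \<Rightarrow> p + 1)"

fun tm_step :: "tm \<Rightarrow> config \<Rightarrow> config" where
  "tm_step M (q, ts) =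
     (if q = tm_acc M \<or> q = tm_rej M then (q, ts)
      else (case tm_trans M q (map tape_read ts) of (q', as) \<Rightarrow> (q', map2 tape_act as ts)))"

definition tape_of :: "bool list \<Rightarrow> tape" where
  "tape_of w =
     ((\<lambda>p. if 0 \<le> p \<and> p < int (length w) then (if w ! nat p then 2 else 1) else 0), 0)"

text \<open>The \<open>i\<close>-th component of the input is on the \<open>i\<close>-th tape; the remaining tapes are blank.\<close>

definition tm_start :: "tm \<Rightarrow> bool list list \<Rightarrow> config" where
  "tm_start M ws =
     (tm_init M, map tape_of (ws @ replicate (tm_tapes M - length ws) []))"

definition tm_decides_within :: "tm \<Rightarrow> bool list list \<Rightarrow> nat \<Rightarrow> bool \<Rightarrow> bool" where
  "tm_decides_within M ws t b \<longleftrightarrow>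
     fst ((tm_step M ^^ t) (tm_start M ws)) = (if b then tm_acc M else tm_rej M)"

text \<open>A query consists of the binary representation of a number \<open>n\<close> and of \<open>r\<close> further bit
  strings; the running time is linear in the length of the query.  For strings of length
  \<open>O(log n)\<close>, such as the gate names below, this is time \<open>O(log n)\<close>.\<close>

definition dlogtime_decidable :: "nat \<Rightarrow> (nat \<times> bool list list) set \<Rightarrow> bool" where
  "dlogtime_decidable r R \<longleftrightarrow>
     (\<exists>M c. wf_tm M \<and> r + 1 \<le> tm_tapes M \<and>
        (\<forall>n ws. length ws = r \<longrightarrow>
           tm_decides_within M (nat_bits n # ws)
             (c * (1 + length (nat_bits n) + sum_list (map length ws))) ((n, ws) \<in> R)))"

section \<open>Circuits with oracle gates\<close>

datatype gate_type = InputG nat | NotG | AndG | OrG | OracleG nat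

type_synonym gate = "bool list"

record circuit =
  gates :: "gate set"
  outgate :: gate
  gtype :: "gate \<Rightarrow> gate_type"
  ins :: "gate \<Rightarrow> gate list"

text \<open>\<open>n\<close> is the number of input bits and \<open>k\<close> the number of oracles.\<close>

definition wf_circuit :: "nat \<Rightarrow> nat \<Rightarrow> circuit \<Rightarrow> bool" where
  "wf_circuit n k C \<longleftrightarrow>
     finite (gates C) \<and> outgate C \<in> gates C \<and>
     (\<forall>g\<in>gates C. set (ins C g) \<subseteq> gates C \<and>
        (case gtype C g of
           InputG j \<Rightarrow> j < n \<and> ins C g = []
         | NotG \<Rightarrow> length (ins C g) = 1
         | OracleG i \<Rightarrow> i < k
         | _ \<Rightarrow> True))"

definition circuit_size :: "circuit \<Rightarrow> nat" where
  "circuit_size C = card (gates C) + (\<Sum>g\<in>gates C. length (ins C g))"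

definition wire_rel :: "circuit \<Rightarrow> (gate \<times> gate) set" where
  "wire_rel C = {(h, g). g \<in> gates C \<and> h \<in> set (ins C g)}"

text \<open>No path has more than \<open>d\<close> wires; in particular the circuit is acyclic.\<close>

definition depth_at_most :: "circuit \<Rightarrow> nat \<Rightarrow> bool" where
  "depth_at_most C d \<longleftrightarrow> wire_rel C ^^ Suc d = {}"

fun gate_fun :: "bool list set list \<Rightarrow> bool list \<Rightarrow> gate_type \<Rightarrow> bool list \<Rightarrow> bool" where
  "gate_fun Bs x (InputG j) bs = x ! j"
| "gate_fun Bs x NotG bs = (\<not> hd bs)"
| "gate_fun Bs x AndG bs = (\<forall>b\<in>set bs. b)"
| "gate_fun Bs x OrG bs = (\<exists>b\<in>set bs. b)"
| "gate_fun Bs x (OracleG i) bs = (bs \<in> Bs ! i)"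

text \<open>In an acyclic circuit the values \<open>v\<close> of the gates are uniquely determined.\<close>

definition accepts :: "bool list set list \<Rightarrow> circuit \<Rightarrow> bool list \<Rightarrow> bool" where
  "accepts Bs C x \<longleftrightarrow>
     (\<exists>v. (\<forall>g\<in>gates C. v g = gate_fun Bs x (gtype C g) (map v (ins C g))) \<and> v (outgate C))"

text \<open>Gates are named by bit strings of length \<open>O(log n)\<close>, and the output gate, the types of
  gates and the \<open>i\<close>-th input of a gate can be determined in time \<open>O(log n)\<close>.  Positions of
  input bits and of gate inputs are given in binary.\<close>

definition dlogtime_uniform :: "(nat \<Rightarrow> circuit) \<Rightarrow> bool" where
  "dlogtime_uniform C \<longleftrightarrow>
     (\<exists>c. \<forall>n. \<forall>g\<in>gates (C n). length g \<le> c * (1 + length (nat_bits n))) \<and>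
     dlogtime_decidable 1 {(n, [outgate (C n)]) | n. True} \<and>
     (\<forall>t\<in>{NotG, AndG, OrG} \<union> range OracleG.
        dlogtime_decidable 1 {(n, [g]) | n g. g \<in> gates (C n) \<and> gtype (C n) g = t}) \<and>
     dlogtime_decidable 2
       {(n, [g, nat_bits j]) | n g j. g \<in> gates (C n) \<and> gtype (C n) g = InputG j} \<and>
     dlogtime_decidable 3
       {(n, [g, nat_bits i, ins (C n) g ! i]) | n g i.
          g \<in> gates (C n) \<and> i < length (ins (C n) g)}"

definition AC0_reducible :: "bool list set \<Rightarrow> bool list set list \<Rightarrow> bool" where
  "AC0_reducible A Bs \<longleftrightarrow>
     (\<exists>C c d. dlogtime_uniform C \<and>
        (\<forall>n. wf_circuit n (length Bs) (C n) \<and> circuit_size (C n) \<le> (n + 2) ^ c \<and>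
             depth_at_most (C n) d \<and>
             (\<forall>x. length x = n \<longrightarrow> (accepts Bs (C n) x \<longleftrightarrow> x \<in> A))))"

end

(* Let g_0 = 1, ..., g_(m-1) represent the cosets of H.  The coset of the value of each variable p of a
   straight-line program over G is found with one query to CWP(G/H) per coset: the program is mapped to
   G/H and gets a new start variable for p times the inverse of the coset.  Knowing the cosets, a program
   over H has for each p and j a variable (p, j) with value g_j val(p) g_k^(-1), where k is the coset of
   g_j val(p): the rule p -> q r becomes (p, j) -> (q, j) (r, k) with k the coset of g_j val(q).  The
   input is accepted iff its value lies in H and the corresponding variable of this program evaluates
   to 1.  Acyclicity cannot be tested in AC^0; the queries to CWP(G/H) reject cyclic programs.

   The circuits come from first-order formulas with oracle quantifiers over numbers below 2^K, where
   2^K is polynomial in n.  A gate is a subformula together with an assignment, written as a string of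
   K columns with one binary digit of every variable each.  Linear inequalities between the variables
   are decided by a synchronous automaton whose state is the carry, and likewise for the connection
   relation of the circuit; this yields uniformity.  As an oracle gate has a fixed number of inputs,
   queries are written with variable names in unary and with padding rules. *)

theory Submission imports Defs begin

section \<open>Read-only Turing machines\<close>

text \<open>What a formula over linear inequalities can describe shapes the queries: proper names
  have one common length, linear in \<open>n\<close>, each rule of a position is a pair (a letter is
  multiplied by a constant 1), and the blocks have length \<open>2 ^ K\<close>. A query has one
  block per position, so an oracle gate has \<open>2 ^ K * n\<close> inputs, more than
  \<open>K\<close> digits can number. The index of an input may therefore need twice as many digits
  as a gate name has columns. The automaton makes two passes over the names and meets the low half
  of the index in the first pass and the high half in the second.

  Fixed group elements enter a query through a table of rules that evaluate to them; the generating
  lists of the three groups need not be related.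

  \<open>K\<close> exceeds the bit length of \<open>n\<close> by a constant that is chosen after the
  formula, as its subformulas need codes of \<open>K\<close> bits and its queries must fit into
  blocks of length \<open>2 ^ K\<close>. Definability therefore means correctness for all
  sufficiently large \<open>K\<close>.\<close>

fun shift :: "move \<Rightarrow> int \<Rightarrow> int" where
  "shift MoveL p = p - 1"
| "shift Stay p = p"
| "shift MoveR p = p + 1"

text \<open>A machine that never writes has its state and head positions as the whole configuration.
  States may have any type, \<open>Hlt\<close> contains the halting ones, and the scanned symbols
  are computed from the input words.\<close>

fun astep :: "('s \<Rightarrow> nat list \<Rightarrow> 's \<times> move list) \<Rightarrow> 's set \<Rightarrow> bool list list \<Rightarrow>
    's \<times> int list \<Rightarrow> 's \<times> int list" where
  "astep D Hlt ws (s, ps) =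
     (if s \<in> Hlt then (s, ps)
      else (case D s (map2 (\<lambda>w. fst (tape_of w)) ws ps) of (s', ms) \<Rightarrow> (s', map2 shift ms ps)))"

lemma tape_act_same: "tape_act (t p, m) (t, p) = (t, shift m p)"
  by (cases m) auto

lemma tape_of_less3: "fst (tape_of w) p < 3"
  by (simp add: tape_of_def)

lemma tape_of_zip:
  "length ws = k \<Longrightarrow> map2 (\<lambda>w p. (fst (tape_of w), p)) ws (replicate k 0) = map tape_of ws"
  by (rule nth_equalityI) (auto simp: prod_eq_iff tape_of_def)

text \<open>The states are numbered by a bijection, and the machine writes back each symbol it
  reads, so the tapes keep their initial contents. For the same reason three tape symbols
  suffice.\<close>

lemma tm_of_astep:
  assumes fin: "finite S" and S: "s0 \<in> S" "a \<in> S" "r \<in> S" "a \<noteq> r"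
    and clos: "\<And>s ss. s \<in> S \<Longrightarrow> length ss = k \<Longrightarrow> set ss \<subseteq> {..<3} \<Longrightarrow>
      fst (D s ss) \<in> S \<and> length (snd (D s ss)) = k"
  shows "\<exists>M. wf_tm M \<and> tm_tapes M = k \<and> (\<forall>ws t b. length ws \<le> k \<longrightarrow>
     tm_decides_within M ws t b =
     (fst ((astep D {a, r} (ws @ replicate (k - length ws) []) ^^ t) (s0, replicate k 0))
       = (if b then a else r)))"
proof -
  obtain e where e: "bij_betw e S {0..<card S}"
    using ex_bij_betw_finite_nat[OF fin] by blast
  have einj: "inj_on e S" and elt: "\<And>s. s \<in> S \<Longrightarrow> e s < card S"
    using e by (auto simp: bij_betw_def)
  have einv: "\<And>q. q < card S \<Longrightarrow> inv_into S e q \<in> S"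
    using e by (metis atLeast0LessThan bij_betw_def inv_into_into lessThan_iff)
  define T where "T = (\<lambda>q ss. case D (inv_into S e q) ss of (s', ms) \<Rightarrow> (e s', zip ss ms))"
  define M where "M = \<lparr>tm_tapes = k, tm_states = card S, tm_symbols = 3, tm_init = e s0,
    tm_acc = e a, tm_rej = e r, tm_trans = T\<rparr>"
  have wf: "wf_tm M"
    unfolding wf_tm_def
  proof (intro conjI allI impI)
    show "tm_acc M \<noteq> tm_rej M"
      using S einj by (auto simp: M_def inj_on_def)
  next
    fix q ss
    assume q: "q < tm_states M" and ss: "length ss = tm_tapes M \<and> set ss \<subseteq> {..<tm_symbols M}"
    then have "inv_into S e q \<in> S" by (simp add: M_def einv)
    from clos[OF this, of ss] ss
    show "case tm_trans M q ss of (q', as) \<Rightarrow>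
           q' < tm_states M \<and> length as = tm_tapes M \<and> fst ` set as \<subseteq> {..<tm_symbols M}"
      by (auto simp: M_def T_def elt split: prod.splits dest: set_zip_leftD)
  qed (use S elt in \<open>auto simp: M_def\<close>)
  define conf :: "bool list list \<Rightarrow> 'a \<times> int list \<Rightarrow> config" where "conf = (\<lambda>ws (s, ps). (e s, map2 (\<lambda>w p. (fst (tape_of w), p)) ws ps))"
  have sim: "tm_step M (conf ws (s, ps)) = conf ws (astep D {a, r} ws (s, ps)) \<and>
      fst (astep D {a, r} ws (s, ps)) \<in> S \<and> length (snd (astep D {a, r} ws (s, ps))) = k"
    if "s \<in> S" "length ps = k" "length ws = k" for s ps ws
  proof -
    let ?ss = "map2 (\<lambda>w. fst (tape_of w)) ws ps"
    obtain s' ms where d: "D s ?ss = (s', ms)" by fastforce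
    have ss: "length ?ss = k" "set ?ss \<subseteq> {..<3}"
      using that by (auto simp: tape_of_less3)
    from clos[OF \<open>s \<in> S\<close> ss] d have s': "s' \<in> S" "length ms = k" by auto
    have rd: "map tape_read (map2 (\<lambda>w p. (fst (tape_of w), p)) ws ps) = ?ss"
      by (simp add: case_prod_unfold)
    have tr: "T (e s) ?ss = (e s', zip ?ss ms)"
      using d that einj by (simp add: T_def)
    have act: "map2 tape_act (zip ?ss ms) (map2 (\<lambda>w p. (fst (tape_of w), p)) ws ps)
      = map2 (\<lambda>w p. (fst (tape_of w), p)) ws (map2 shift ms ps)"
      by (rule nth_equalityI) (use that s' in \<open>auto simp del: tape_act.simps simp: tape_act_same\<close>)
    have "e s = e a \<longleftrightarrow> s = a" "e s = e r \<longleftrightarrow> s = r"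
      using that S einj by (auto simp: inj_on_def)
    then show ?thesis
      using that s' d tr rd act
      by (auto simp: conf_def M_def simp del: map_map split: prod.splits)
  qed
  have run: "(tm_step M ^^ t) (conf ws (s0, replicate k 0)) =
      conf ws ((astep D {a, r} ws ^^ t) (s0, replicate k 0)) \<and>
      fst ((astep D {a, r} ws ^^ t) (s0, replicate k 0)) \<in> S \<and>
      length (snd ((astep D {a, r} ws ^^ t) (s0, replicate k 0))) = k"
    if "length ws = k" for ws t
  proof (induction t)
    case 0
    then show ?case using S by simp
  next
    case (Suc t)
    obtain s ps where sp: "(astep D {a, r} ws ^^ t) (s0, replicate k 0) = (s, ps)" by fastforce
    then show ?case using Suc sim[of s ps ws] that by simp
  qed
  have "tm_decides_within M ws t b =
     (fst ((astep D {a, r} (ws @ replicate (k - length ws) []) ^^ t) (s0, replicate k 0))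
       = (if b then a else r))" if "length ws \<le> k" for ws t b
  proof -
    let ?w = "ws @ replicate (k - length ws) []"
    have w: "length ?w = k" using that by simp
    have "map2 (\<lambda>w p. (fst (tape_of w), p)) ?w (replicate k 0) = map tape_of ?w"
      by (rule tape_of_zip) (rule w)
    then have "tm_start M ws = conf ?w (s0, replicate k 0)"
      unfolding tm_start_def conf_def by (simp add: M_def)
    then have "fst ((tm_step M ^^ t) (tm_start M ws)) =
        e (fst ((astep D {a, r} ?w ^^ t) (s0, replicate k 0)))"
      using run[OF w, of t] by (simp add: conf_def split: prod.splits)
    moreover have "fst ((astep D {a, r} ?w ^^ t) (s0, replicate k 0)) \<in> S"
      using run[OF w, of t] by simp
    ultimately show ?thesis
      using S einj unfolding tm_decides_within_def by (auto simp: M_def inj_on_def)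
  qed
  moreover have "tm_tapes M = k" by (simp add: M_def)
  ultimately show ?thesis using wf by blast
qed

section \<open>Synchronous automata\<close>

definition sy :: "bool list \<Rightarrow> nat \<Rightarrow> nat" where
  "sy w j = (if j < length w then if w ! j then 2 else 1 else 0)"

lemma tape_of_sy [simp]: "fst (tape_of w) (int j) = sy w j"
  by (simp add: tape_of_def sy_def)

lemma tape_of_neg [simp]: "fst (tape_of w) (- 1) = 0"
  by (simp add: tape_of_def)

lemma sy_eq_0 [simp]: "sy w j = 0 \<longleftrightarrow> length w \<le> j"
  by (simp add: sy_def)

lemma sy_min [simp]: "sy w (min j (length w)) = sy w j"
  by (simp add: sy_def)

type_synonym column = "bool \<times> nat \<times> nat \<times> (nat \<times> nat) list"

text \<open>The words \<open>n\<close> and \<open>i\<close> are read at one symbol per column, the words \<open>g\<close> and \<open>h\<close> at \<open>W\<close>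
  symbols per column.  There are two passes over \<open>n\<close>, \<open>g\<close>, \<open>h\<close>, told apart by the first
  component of a column; the second one continues to read \<open>i\<close> where the first one stopped.\<close>

definition column :: "nat \<Rightarrow> bool \<Rightarrow> bool list \<Rightarrow> bool list \<Rightarrow> bool list \<Rightarrow> bool list \<Rightarrow> nat \<Rightarrow> nat \<Rightarrow> column"
  where "column W f n g i h off j =
    (f, sy n j, sy i (off + j), map (\<lambda>t. (sy g (j * W + t), sy h (j * W + t))) [0..<W])"

text \<open>The length of \<open>i\<close> does not count here: \<open>i\<close> may reach into the
  second pass, and \<open>regular\<close> looks separately at what remains of it.\<close>

definition width :: "nat \<Rightarrow> bool list \<Rightarrow> bool list \<Rightarrow> bool list \<Rightarrow> nat" where
  "width W n g h = (LEAST J. length n \<le> J \<and> length g \<le> J * W \<and> length h \<le> J * W)"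

definition pass :: "nat \<Rightarrow> bool \<Rightarrow> bool list \<Rightarrow> bool list \<Rightarrow> bool list \<Rightarrow> bool list \<Rightarrow> column list" where
  "pass W f n g i h = map (column W f n g i h (if f then width W n g h else 0)) [0..<width W n g h]"

definition stream :: "nat \<Rightarrow> bool list \<Rightarrow> bool list \<Rightarrow> bool list \<Rightarrow> bool list \<Rightarrow> column list" where
  "stream W n g i h = pass W False n g i h @ pass W True n g i h"

text \<open>Besides the final state, \<open>fin\<close> sees the symbol of \<open>i\<close> behind
  the columns of both passes, which shows whether \<open>i\<close> has ended by then. States are
  numbers because a type of states cannot be quantified inside the definition.\<close>

definition regular :: "nat \<Rightarrow> (bool list \<Rightarrow> bool list \<Rightarrow> bool list \<Rightarrow> bool list \<Rightarrow> bool) \<Rightarrow> bool" where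
  "regular W P \<longleftrightarrow> (\<exists>(Q::nat set) d q0 fin. finite Q \<and> q0 \<in> Q \<and> (\<forall>q\<in>Q. \<forall>a. d q a \<in> Q) \<and>
     (\<forall>n g i h. P n g i h = fin (foldl d q0 (stream W n g i h)) (sy i (2 * width W n g h))))"

lemma width_exists: "W > 0 \<Longrightarrow> length n \<le> length n + length g + length h \<and>
    length g \<le> (length n + length g + length h) * W \<and> length h \<le> (length n + length g + length h) * W"
  by (cases W) (auto simp: algebra_simps)

lemma width_props:
  assumes "W > 0"
  shows "length n \<le> width W n g h" "length g \<le> width W n g h * W" "length h \<le> width W n g h * W"
  using LeastI[of "\<lambda>J. length n \<le> J \<and> length g \<le> J * W \<and> length h \<le> J * W", OF width_exists[OF assms, of n g h]]
  by (auto simp: width_def)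

lemma width_le: "W > 0 \<Longrightarrow> width W n g h \<le> length n + length g + length h"
  unfolding width_def by (rule Least_le) (rule width_exists)

lemma width_min: "j < width W n g h \<Longrightarrow> \<not> (length n \<le> j \<and> length g \<le> j * W \<and> length h \<le> j * W)"
  unfolding width_def by (rule not_less_Least)

section \<open>Simulation of synchronous automata by read-only machines\<close>

datatype 's mode = Fwd bool "(nat \<times> nat) list" 's | Back 's | Halt bool

text \<open>The heads on \<open>n\<close>, \<open>g\<close> and \<open>h\<close> wait at the first
  blank behind their word, whereas the head on \<open>i\<close> advances by one cell per column and
  is not moved back between the passes. The end of a pass is tested only at a column boundary, where
  \<open>buf\<close> is empty.\<close>

fun mstep :: "nat \<Rightarrow> ('s \<Rightarrow> column \<Rightarrow> 's) \<Rightarrow> ('s \<Rightarrow> nat \<Rightarrow> bool) \<Rightarrow> 's mode \<Rightarrow> nat list \<Rightarrow> 's mode \<times> move list"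
  where
  "mstep W d fin (Fwd f buf q) ss =
    (let a = ss ! 0; b = ss ! 1; c = ss ! 2; e = ss ! 3;
         mv = (\<lambda>s. if s = 0 then Stay else MoveR) in
     if buf = [] \<and> a = 0 \<and> b = 0 \<and> e = 0
     then if f then (Halt (fin q c), [Stay, Stay, Stay, Stay])
          else (Back q, [MoveL, MoveL, Stay, MoveL])
     else if Suc (length buf) = W
     then (Fwd f [] (d q (f, a, c, buf @ [(b, e)])), [mv a, mv b, MoveR, mv e])
     else (Fwd f (buf @ [(b, e)]) q, [Stay, mv b, Stay, mv e]))"
| "mstep W d fin (Back q) ss =
    (let a = ss ! 0; b = ss ! 1; e = ss ! 3; mv = (\<lambda>s. if s = 0 then Stay else MoveL) in
     if a = 0 \<and> b = 0 \<and> e = 0 then (Fwd True [] q, [MoveR, MoveR, Stay, MoveR])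
     else (Back q, [mv a, mv b, Stay, mv e]))"
| "mstep W d fin (Halt x) ss = (Halt x, [Stay, Stay, Stay, Stay])"

context
  fixes W :: nat and d :: "'s \<Rightarrow> column \<Rightarrow> 's" and fin :: "'s \<Rightarrow> nat \<Rightarrow> bool"
    and n g i h :: "bool list"
  assumes W: "W > 0"
begin

abbreviation "step \<equiv> astep (mstep W d fin) {Halt True, Halt False} [n, g, i, h]"

abbreviation heads :: "nat \<Rightarrow> nat \<Rightarrow> nat \<Rightarrow> int list" where
  "heads j s c \<equiv> [int (min j (length n)), int (min s (length g)), int c, int (min s (length h))]"

text \<open>A step reads one pair of symbols of \<open>g\<close> and \<open>h\<close>; the
  \<open>W\<close>-th step of a column also moves on in \<open>n\<close> and \<open>i\<close> and
  performs the transition \<open>d\<close>. Minimality of \<open>width\<close> excludes that the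
  pass stops early.\<close>

lemma tick:
  assumes j: "j < width W n g h" and t: "t < W"
  shows "step (Fwd f (map (\<lambda>t. (sy g (j * W + t), sy h (j * W + t))) [0..<t]) q, heads j (j * W + t) (off + j))
    = (if Suc t = W
       then (Fwd f [] (d q (column W f n g i h off j)), heads (Suc j) (Suc j * W) (off + Suc j))
       else (Fwd f (map (\<lambda>t. (sy g (j * W + t), sy h (j * W + t))) [0..<Suc t]) q,
             heads j (j * W + Suc t) (off + j)))"
proof -
  have nd: "\<not> (t = 0 \<and> length n \<le> j \<and> length g \<le> j * W + t \<and> length h \<le> j * W + t)"
    using width_min[OF j] by auto
  have Wt: "Suc t = W \<Longrightarrow> [0..<W] = [0..<t] @ [t]" "Suc t = W \<Longrightarrow> Suc j * W = Suc (j * W + t)"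
    by auto
  have mv: "shift (if length w \<le> s then Stay else MoveR) (int (min s (length w))) = int (min (Suc s) (length w))"
    for w :: "bool list" and s
    by (auto simp: min_def)
  show ?thesis
  proof (cases "Suc t = W")
    case True
    then show ?thesis using nd
      by (auto simp: Let_def column_def Wt(1) mv Wt(2) simp del: upt_Suc mult_Suc of_nat_min of_nat_add)
  next
    case False
    then show ?thesis using nd
      by (auto simp: Let_def mv simp del: of_nat_min of_nat_add)
  qed
qed

lemma ticks:
  assumes j: "j < width W n g h" and t: "t < W"
  shows "(step ^^ t) (Fwd f [] q, heads j (j * W) (off + j))
    = (Fwd f (map (\<lambda>t. (sy g (j * W + t), sy h (j * W + t))) [0..<t]) q, heads j (j * W + t) (off + j))"
  using t
proof (induction t)
  case (Suc t)
  then show ?case using tick[OF j, of t f q off] by simp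
qed simp

lemma one_column:
  assumes j: "j < width W n g h"
  shows "(step ^^ W) (Fwd f [] q, heads j (j * W) (off + j))
    = (Fwd f [] (d q (column W f n g i h off j)), heads (Suc j) (Suc j * W) (off + Suc j))"
proof -
  obtain t where t: "W = Suc t" using W by (cases W) auto
  show ?thesis
    using ticks[OF j, of t f q off] tick[OF j, of t f q off] t by simp
qed

lemma columns:
  assumes "j \<le> width W n g h"
  shows "(step ^^ (j * W)) (Fwd f [] q, heads 0 0 off)
    = (Fwd f [] (foldl d q (map (column W f n g i h off) [0..<j])), heads j (j * W) (off + j))"
  using assms
proof (induction j)
  case (Suc j)
  have "step ^^ (Suc j * W) = step ^^ (W + j * W)" by simp
  then show ?case using Suc one_column[of j f _ off]
    by (simp add: funpow_add del: funpow.simps)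
qed simp

text \<open>Each of the three heads waits at the blank cell -1, so the longest way bounds the time.
  A head on an empty word is there from the start.\<close>

lemma rewind:
  assumes "a \<ge> - 1" "b \<ge> - 1" "c \<ge> - 1" "a < int (length n)" "b < int (length g)" "c < int (length h)"
  shows "\<exists>t. t \<le> nat (max a (max b c) + 1) \<and>
    (step ^^ t) (Back q, [a, b, p, c]) = (Back q, [- 1, - 1, p, - 1])"
  using assms
proof (induction "nat (max a (max b c) + 1)" arbitrary: a b c rule: less_induct)
  case less
  show ?case
  proof (cases "a = - 1 \<and> b = - 1 \<and> c = - 1")
    case True
    then show ?thesis by (intro exI[of _ 0]) simp
  next
    case False
    let ?dec = "\<lambda>a::int. if a = - 1 then - 1 else a - 1"
    have nz: "fst (tape_of w) a = 0 \<longleftrightarrow> a = - 1" if "a \<ge> - 1" "a < int (length w)" for a w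
      using that by (auto simp: tape_of_def)
    have st: "step (Back q, [a, b, p, c]) = (Back q, [?dec a, ?dec b, p, ?dec c])"
      using False nz less.prems by (auto simp: Let_def)
    have lt: "nat (max (?dec a) (max (?dec b) (?dec c)) + 1) < nat (max a (max b c) + 1)"
      using False less.prems by (auto simp: max_def)
    have "\<exists>t. t \<le> nat (max (?dec a) (max (?dec b) (?dec c)) + 1) \<and>
      (step ^^ t) (Back q, [?dec a, ?dec b, p, ?dec c]) = (Back q, [- 1, - 1, p, - 1])"
      by (rule less.hyps[OF lt]) (use less.prems in auto)
    then obtain t where t: "t \<le> nat (max (?dec a) (max (?dec b) (?dec c)) + 1)"
      "(step ^^ t) (Back q, [?dec a, ?dec b, p, ?dec c]) = (Back q, [- 1, - 1, p, - 1])" by blast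
    have "(step ^^ Suc t) (Back q, [a, b, p, c]) = (Back q, [- 1, - 1, p, - 1])"
      using t(2) st by (simp add: funpow_swap1 del: astep.simps)
    moreover have "Suc t \<le> nat (max a (max b c) + 1)" using t(1) lt by linarith
    ultimately show ?thesis by blast
  qed
qed

lemma run_halts:
  fixes q0 :: 's
  defines "J \<equiv> width W n g h"
  shows "\<exists>t \<le> 2 * J * W + length n + length g + length h + 4.
    fst ((step ^^ t) (Fwd False [] q0, [0, 0, 0, 0])) =
      Halt (fin (foldl d q0 (stream W n g i h)) (sy i (2 * J)))"
proof -
  define q1 where "q1 = foldl d q0 (pass W False n g i h)"
  define q2 where "q2 = foldl d q1 (pass W True n g i h)"
  note wp = width_props[OF W, where n = n and g = g and h = h, folded J_def]
  have s1: "(step ^^ (J * W)) (Fwd False [] q0, [0, 0, 0, 0]) =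
     (Fwd False [] q1, [int (length n), int (length g), int J, int (length h)])"
    using columns[of J False q0 0] wp
    by (simp add: q1_def pass_def J_def[symmetric] min_absorb2 del: astep.simps)
  have s2: "step (Fwd False [] q1, [int (length n), int (length g), int J, int (length h)])
    = (Back q1, [int (length n) - 1, int (length g) - 1, int J, int (length h) - 1])"
    by (simp add: Let_def)
  obtain t where t: "t \<le> nat (max (int (length n) - 1) (max (int (length g) - 1) (int (length h) - 1)) + 1)"
    "(step ^^ t) (Back q1, [int (length n) - 1, int (length g) - 1, int J, int (length h) - 1])
     = (Back q1, [- 1, - 1, int J, - 1])"
    using rewind[of "int (length n) - 1" "int (length g) - 1" "int (length h) - 1" q1 "int J"] by auto
  have s4: "step (Back q1, [- 1, - 1, int J, - 1]) = (Fwd True [] q1, [0, 0, int J, 0])"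
    by (simp add: Let_def)
  have s5: "(step ^^ (J * W)) (Fwd True [] q1, [0, 0, int J, 0]) =
     (Fwd True [] q2, [int (length n), int (length g), int (2 * J), int (length h)])"
  proof -
    have e1: "heads 0 0 J = [0, 0, int J, 0]" by simp
    have e2: "heads J (J * W) (J + J) = [int (length n), int (length g), int (2 * J), int (length h)]"
      using wp by (simp add: min_absorb2)
    have e3: "foldl d q1 (map (column W True n g i h J) [0..<J]) = q2"
      by (simp add: q2_def pass_def J_def)
    have "J \<le> width W n g h" by (simp add: J_def)
    from columns[OF this, of True q1 J] show ?thesis unfolding e1 e2 e3 .
  qed
  have s6: "fst (step (Fwd True [] q2, [int (length n), int (length g), int (2 * J), int (length h)]))
    = Halt (fin q2 (sy i (2 * J)))"
    by (simp add: Let_def del: of_nat_mult of_nat_add)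
  \<comment> \<open>Two passes of \<open>J * W\<close> steps each, \<open>t\<close> steps of
    rewinding, and one step each for turning at the right end, turning at the left end and
    halting.\<close>
  have "(step ^^ (Suc (J * W + Suc (t + Suc (J * W))))) (Fwd False [] q0, [0, 0, 0, 0]) =
     step ((step ^^ (J * W)) (step ((step ^^ t) (step ((step ^^ (J * W)) (Fwd False [] q0, [0, 0, 0, 0]))))))"
    by (simp only: funpow_add funpow.simps comp_apply)
  also have "fst \<dots> = Halt (fin q2 (sy i (2 * J)))"
    using s1 s2 t(2) s4 s5 s6 by simp
  finally have "fst ((step ^^ (Suc (J * W + Suc (t + Suc (J * W))))) (Fwd False [] q0, [0, 0, 0, 0]))
     = Halt (fin q2 (sy i (2 * J)))" .
  moreover have "q2 = foldl d q0 (stream W n g i h)"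
    by (simp add: q2_def q1_def stream_def)
  moreover have "Suc (J * W + Suc (t + Suc (J * W))) \<le> 2 * J * W + length n + length g + length h + 4"
    using t(1) by linarith
  ultimately show ?thesis by blast
qed

end

lemma astep_halted:
  "s \<in> Hlt \<Longrightarrow> (astep D Hlt ws ^^ t) (s, ps) = (s, ps)"
  by (induction t) auto

lemma astep_halted_le:
  assumes "fst ((astep D Hlt ws ^^ t) x) \<in> Hlt" "t \<le> t'"
  shows "fst ((astep D Hlt ws ^^ t') x) = fst ((astep D Hlt ws ^^ t) x)"
proof -
  obtain s ps where sp: "(astep D Hlt ws ^^ t) x = (s, ps)" by fastforce
  have "t' = (t' - t) + t" using assms by simp
  then have "(astep D Hlt ws ^^ t') x = (astep D Hlt ws ^^ (t' - t)) ((astep D Hlt ws ^^ t) x)"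
    by (metis comp_apply funpow_add)
  then show ?thesis using sp assms astep_halted[of s Hlt "t' - t" D ws ps] by simp
qed

text \<open>Four tapes serve every \<open>r\<close>: absent arguments are blank tapes, that is,
  empty words. There are at most as many columns as bits in \<open>n\<close>, \<open>g\<close> and
  \<open>h\<close>, which makes the time linear. Since halting states persist, an upper bound on the
  time is as good as the exact time.\<close>

theorem regular_dlogtime:
  assumes W: "W > 0" and reg: "regular W P" and r: "r = 1 \<or> r = 2 \<or> r = 3"
    and R: "\<And>n ws. length ws = r \<Longrightarrow> (n, ws) \<in> R \<longleftrightarrow>
      P (nat_bits n) (ws ! 0) (if r \<ge> 2 then ws ! 1 else []) (if r \<ge> 3 then ws ! 2 else [])"
  shows "dlogtime_decidable r R"
proof -
  obtain Q :: "nat set" and d q0 fin where Q: "finite Q" "q0 \<in> Q" "\<And>q a. q \<in> Q \<Longrightarrow> d q a \<in> Q"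
    and P: "\<And>n g i h. P n g i h = fin (foldl d q0 (stream W n g i h)) (sy i (2 * width W n g h))"
    using reg unfolding regular_def by blast
  \<comment> \<open>Buffers are short words over pairs of tape symbols, which keeps the set of
    control states finite.\<close>
  define B where "B = {buf :: (nat \<times> nat) list. set buf \<subseteq> {..<3} \<times> {..<3} \<and> length buf \<le> W}"
  define S where "S = (\<lambda>(f, buf, q). Fwd f buf q) ` ((UNIV :: bool set) \<times> {buf \<in> B. length buf < W} \<times> Q)
     \<union> Back ` Q \<union> {Halt True, Halt False}"
  have "finite B" unfolding B_def by (rule finite_lists_length_le) auto
  then have finS: "finite S" using Q by (auto simp: S_def)
  have S0: "Fwd False [] q0 \<in> S" using Q W by (auto simp: S_def B_def image_iff)
  have FwdS: "Fwd f buf q \<in> S \<longleftrightarrow> set buf \<subseteq> {..<3} \<times> {..<3} \<and> length buf < W \<and> q \<in> Q" for f buf q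
    by (auto simp: S_def B_def image_iff)
  have BackS: "Back q \<in> S \<longleftrightarrow> q \<in> Q" for q
    by (auto simp: S_def)
  have HaltS: "Halt x \<in> S" for x
    by (cases x) (auto simp: S_def)
  have clos: "fst (mstep W d fin s ss) \<in> S \<and> length (snd (mstep W d fin s ss)) = 4"
    if "s \<in> S" "length ss = 4" "set ss \<subseteq> {..<3}" for s ss
  proof -
    have "1 < length ss" "3 < length ss" using that by auto
    then have "ss ! 1 < 3" "ss ! 3 < 3" using that(3) nth_mem by (metis lessThan_iff subsetD)+
    then show ?thesis
      using that Q W by (cases s) (auto simp: Let_def FwdS BackS HaltS)
  qed
  obtain M where M: "wf_tm M" "tm_tapes M = 4"
    "\<And>ws t b. length ws \<le> 4 \<Longrightarrow> tm_decides_within M ws t b =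
     (fst ((astep (mstep W d fin) {Halt True, Halt False} (ws @ replicate (4 - length ws) []) ^^ t)
         (Fwd False [] q0, replicate 4 0)) = (if b then Halt True else Halt False))"
    using tm_of_astep[OF finS S0 HaltS[of True] HaltS[of False], of 4 "mstep W d fin"] clos by auto
  have "tm_decides_within M (nat_bits n # ws)
      ((2 * W + 5) * (1 + length (nat_bits n) + sum_list (map length ws))) ((n, ws) \<in> R)"
    if ws: "length ws = r" for n ws
  proof -
    let ?n = "nat_bits n"
    define g where "g = ws ! 0"
    define i where "i = (if r \<ge> 2 then ws ! 1 else [])"
    define h where "h = (if r \<ge> 3 then ws ! 2 else [])"
    have eq: "(?n # ws) @ replicate (4 - length (?n # ws)) [] = [?n, g, i, h]"
      and sl: "length g + length h \<le> sum_list (map length ws)"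
      using r ws by (auto simp: g_def i_def h_def numeral_3_eq_3 numeral_2_eq_2 length_Suc_conv)
    obtain t where t: "t \<le> 2 * width W ?n g h * W + length ?n + length g + length h + 4"
      "fst ((astep (mstep W d fin) {Halt True, Halt False} [?n, g, i, h] ^^ t) (Fwd False [] q0, [0, 0, 0, 0])) =
      Halt (P ?n g i h)"
      using run_halts[OF W, where d = d and fin = fin and n = ?n and g = g and i = i and h = h and ?q0.0 = q0]
      unfolding P by auto
    have "2 * width W ?n g h * W \<le> 2 * W * (length ?n + (length g + length h))"
      using mult_le_mono2[OF width_le[OF W, of ?n g h], of "2 * W"] by (simp add: algebra_simps)
    also have "\<dots> \<le> 2 * W * (1 + length ?n + sum_list (map length ws))"
      by (rule mult_le_mono2) (use sl in linarith)
    finally have le: "t \<le> (2 * W + 5) * (1 + length ?n + sum_list (map length ws))"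
      using t(1) sl by (simp add: add_mult_distrib)
    have "{Halt True, Halt False} = range (Halt :: bool \<Rightarrow> nat mode)"
      by (auto simp: UNIV_bool)
    then have "fst ((astep (mstep W d fin) {Halt True, Halt False} [?n, g, i, h] ^^
        ((2 * W + 5) * (1 + length ?n + sum_list (map length ws)))) (Fwd False [] q0, [0, 0, 0, 0])) =
      Halt (P ?n g i h)"
      using astep_halted_le[OF _ le] t(2) by (metis rangeI)
    moreover have "(n, ws) \<in> R \<longleftrightarrow> P ?n g i h"
      using R[OF ws] by (simp add: g_def i_def h_def)
    moreover have "length (?n # ws) \<le> 4" using ws r by auto
    moreover have "replicate 4 (0::int) = [0, 0, 0, 0]" by (simp add: numeral_eq_Suc)
    ultimately show ?thesis
      using M(3)[of "?n # ws"] eq by simp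
  qed
  then show ?thesis
    unfolding dlogtime_decidable_def using M(1,2) r
    by (intro exI[of _ M] exI[of _ "2 * W + 5"]) auto
qed

corollary regular_dlogtime_1:
  assumes "W > 0" "regular W P" "\<And>n g. Q n g \<longleftrightarrow> P (nat_bits n) g [] []"
  shows "dlogtime_decidable 1 {(n, [g]) | n g. Q n g}"
  by (rule regular_dlogtime[OF assms(1,2)]) (auto simp: assms(3) length_Suc_conv)

corollary regular_dlogtime_2:
  assumes "W > 0" "regular W P" "\<And>n g i. Q n g i \<longleftrightarrow> P (nat_bits n) g i []"
  shows "dlogtime_decidable 2 {(n, [g, i]) | n g i. Q n g i}"
  by (rule regular_dlogtime[OF assms(1,2)]) (auto simp: assms(3) length_Suc_conv numeral_2_eq_2)

corollary regular_dlogtime_3: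
  assumes "W > 0" "regular W P" "\<And>n g i h. Q n g i h \<longleftrightarrow> P (nat_bits n) g i h"
  shows "dlogtime_decidable 3 {(n, [g, i, h]) | n g i h. Q n g i h}"
  by (rule regular_dlogtime[OF assms(1,2)]) (auto simp: assms(3) length_Suc_conv numeral_3_eq_3)

section \<open>Closure properties of regular predicates\<close>

lemma sy_eq_2 [simp]: "sy w j = 2 \<longleftrightarrow> j < length w \<and> w ! j"
  by (simp add: sy_def)

lemma sy_pos [simp]: "0 < sy w j \<longleftrightarrow> j < length w"
  by (simp add: sy_def)

text \<open>Allows states of any type, such as pairs or integers; a bijection numbers them.\<close>

lemma regularI:
  fixes Q :: "'s set"
  assumes Q: "finite Q" "q0 \<in> Q" "\<And>q a. q \<in> Q \<Longrightarrow> d q a \<in> Q"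
    and P: "\<And>n g i h. P n g i h \<longleftrightarrow> fin (foldl d q0 (stream W n g i h)) (sy i (2 * width W n g h))"
  shows "regular W P"
proof -
  obtain e where e: "bij_betw e Q {0..<card Q}"
    using ex_bij_betw_finite_nat[OF Q(1)] by blast
  have inv: "\<And>q. q \<in> Q \<Longrightarrow> inv_into Q e (e q) = q"
    using e by (meson bij_betw_inv_into_left)
  define d' where "d' = (\<lambda>m a. e (d (inv_into Q e m) a))"
  have "foldl d' (e q) as = e (foldl d q as) \<and> foldl d q as \<in> Q" if "q \<in> Q" for q as
    using that by (induction as arbitrary: q) (auto simp: d'_def inv Q(3))
  then have "P n g i h = fin (inv_into Q e (foldl d' (e q0) (stream W n g i h))) (sy i (2 * width W n g h))"
    for n g i h
    using P Q(2) inv by simp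
  moreover have "finite (e ` Q)" "e q0 \<in> e ` Q" "\<forall>q\<in>e ` Q. \<forall>a. d' q a \<in> e ` Q"
    using Q by (auto simp: d'_def inv)
  ultimately show ?thesis
    unfolding regular_def
    by (intro exI[of _ "e ` Q"] exI[of _ d'] exI[of _ "e q0"] exI[of _ "\<lambda>q. fin (inv_into Q e q)"]) auto
qed

lemma regular_const: "regular W (\<lambda>n g i h. b)"
  by (rule regularI[of "{()}" "()" "\<lambda>_ _. ()" _ "\<lambda>_ _. b"]) auto

lemma regular_not:
  assumes "regular W P" shows "regular W (\<lambda>n g i h. \<not> P n g i h)"
proof -
  obtain Q :: "nat set" and d q0 fin where "finite Q" "q0 \<in> Q" "\<forall>q\<in>Q. \<forall>a. d q a \<in> Q"
    "\<forall>n g i h. P n g i h = fin (foldl d q0 (stream W n g i h)) (sy i (2 * width W n g h))"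
    using assms unfolding regular_def by blast
  then show ?thesis
    by (intro regularI[of Q q0 d _ "\<lambda>q e. \<not> fin q e"]) auto
qed

lemma foldl_pair: "foldl (\<lambda>(p, q) a. (d p a, d' q a)) (p, q) as = (foldl d p as, foldl d' q as)"
  by (induction as arbitrary: p q) auto

lemma regular_conj:
  assumes "regular W P" "regular W P'" shows "regular W (\<lambda>n g i h. P n g i h \<and> P' n g i h)"
proof -
  obtain Q :: "nat set" and d q0 fin where 1: "finite Q" "q0 \<in> Q" "\<And>q a. q\<in>Q \<Longrightarrow> d q a \<in> Q"
    "\<And>n g i h. P n g i h = fin (foldl d q0 (stream W n g i h)) (sy i (2 * width W n g h))"
    using assms(1) unfolding regular_def by blast
  obtain Q' :: "nat set" and d' q0' fin' where 2: "finite Q'" "q0' \<in> Q'" "\<And>q a. q\<in>Q' \<Longrightarrow> d' q a \<in> Q'"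
    "\<And>n g i h. P' n g i h = fin' (foldl d' q0' (stream W n g i h)) (sy i (2 * width W n g h))"
    using assms(2) unfolding regular_def by blast
  show ?thesis
    by (rule regularI[of "Q \<times> Q'" "(q0, q0')" "\<lambda>(p, q) a. (d p a, d' q a)" _
          "\<lambda>(p, q) e. fin p e \<and> fin' q e"])
      (auto simp: 1 2 foldl_pair)
qed

lemma regular_disj:
  assumes "regular W P" "regular W P'" shows "regular W (\<lambda>n g i h. P n g i h \<or> P' n g i h)"
  using regular_not[OF regular_conj[OF regular_not[OF assms(1)] regular_not[OF assms(2)]]] by simp

lemma regular_ball:
  assumes "finite A" "\<And>a. a \<in> A \<Longrightarrow> regular W (P a)" shows "regular W (\<lambda>n g i h. \<forall>a\<in>A. P a n g i h)"
  using assms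
proof (induction A)
  case empty
  then show ?case using regular_const[of W True] by simp
next
  case (insert a A)
  then show ?case using regular_conj[of W "P a" "\<lambda>n g i h. \<forall>a\<in>A. P a n g i h"] by simp
qed

lemma regular_bex:
  assumes "finite A" "\<And>a. a \<in> A \<Longrightarrow> regular W (P a)" shows "regular W (\<lambda>n g i h. \<exists>a\<in>A. P a n g i h)"
  using regular_not[OF regular_ball[OF assms(1) regular_not[OF assms(2)]]] by simp

lemma regular_count: "regular W (\<lambda>n g i h. length (filter p (stream W n g i h)) = c)"
\<comment> \<open>The counter saturates at \<open>Suc c\<close>, which stands for every count above
  \<open>c\<close>.\<close>
proof (rule regularI[of "{..Suc c}" 0 "\<lambda>q a. if p a then min (Suc q) (Suc c) else q" _ "\<lambda>q e. q = c"])
  have "foldl (\<lambda>q a. if p a then min (Suc q) (Suc c) else q) q as = min (q + length (filter p as)) (Suc c)"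
    if "q \<le> Suc c" for q as
    using that by (induction as arbitrary: q) auto
  then show "(length (filter p (stream W n g i h)) = c) \<longleftrightarrow>
      (foldl (\<lambda>q a. if p a then min (Suc q) (Suc c) else q) 0 (stream W n g i h) = c)" for n g i h
    by (auto simp: min_def)
qed auto

lemma regular_list_all: "regular W (\<lambda>n g i h. \<forall>a\<in>set (stream W n g i h). p a)"
  using regular_count[of W "\<lambda>a. \<not> p a" 0] by (simp add: filter_empty_conv)

lemma foldl_filter: "foldl (\<lambda>q a. if p a then d q a else q) q as = foldl d q (filter p as)"
  by (induction as arbitrary: q) auto

lemma filter_stream: "filter (\<lambda>a. fst a = f) (stream W n g i h) = pass W f n g i h"
  by (cases f) (auto simp: stream_def pass_def column_def filter_empty_conv intro!: filter_True)

lemma length_pass [simp]: "length (pass W f n g i h) = width W n g h"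
  by (simp add: pass_def)

text \<open>The automaton for a linear inequality adds up the binary digits, least significant digit
  first; its state is the carry.\<close>

lemma foldl_carry:
  "foldl (\<lambda>c a. (c + wt a) div 2) (c::int) as = (c + horner_sum wt 2 as) div 2 ^ length as"
proof (induction as arbitrary: c)
  case (Cons a as)
  have "(c + wt a) div 2 + horner_sum wt 2 as = (c + (wt a + 2 * horner_sum wt 2 as)) div 2"
    by (simp flip: add.assoc)
  then show ?case
    by (simp add: Cons zdiv_zmult2_eq)
qed simp

lemma le_div_pos_iff: "0 < k \<Longrightarrow> e \<le> x div k \<longleftrightarrow> e * k \<le> x" for e x k :: int
proof
  assume k: "0 < k"
  have x: "x = x div k * k + x mod k" "0 \<le> x mod k" "x mod k < k" using k by auto
  show "e * k \<le> x" if "e \<le> x div k"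
    using mult_right_mono[OF that, of k] k x by linarith
  show "e \<le> x div k" if "e * k \<le> x"
    using zdiv_mono1[OF that k] k by simp
qed

text \<open>By \<open>foldl_carry\<close> the final carry is the sum divided by
  \<open>2 ^ width\<close> and rounded down, so comparing it with \<open>e\<close> decides the
  inequality. Halving keeps the carry within \<open>\<bar>c\<bar> + B\<close>, and columns of the
  other pass leave it unchanged.\<close>

lemma regular_weight:
  assumes B: "\<And>a. \<bar>wt a\<bar> \<le> (B::int)"
  shows "regular W (\<lambda>n g i h. c + horner_sum wt 2 (pass W f n g i h) \<ge> e * 2 ^ width W n g h)"
proof (rule regularI[of "{- (\<bar>c\<bar> + B)..\<bar>c\<bar> + B}" c
      "\<lambda>q a. if fst a = f then (q + wt a) div 2 else q" _ "\<lambda>q _. e \<le> q"])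
  show "c \<in> {- (\<bar>c\<bar> + B)..\<bar>c\<bar> + B}" using B[of undefined] by auto
  show "(if fst a = f then (q + wt a) div 2 else q) \<in> {- (\<bar>c\<bar> + B)..\<bar>c\<bar> + B}"
    if "q \<in> {- (\<bar>c\<bar> + B)..\<bar>c\<bar> + B}" for q a
    using that B[of a] by auto
  show "(c + horner_sum wt 2 (pass W f n g i h) \<ge> e * 2 ^ width W n g h) \<longleftrightarrow>
    e \<le> foldl (\<lambda>q a. if fst a = f then (q + wt a) div 2 else q) c (stream W n g i h)" for n g i h
    by (simp add: foldl_filter foldl_carry filter_stream le_div_pos_iff)
qed auto

text \<open>The binary numbers that a sequence of columns carries in parallel: \<open>n\<close>,
  \<open>i\<close>, and the \<open>t\<close>-th track of \<open>g\<close> or of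
  \<open>h\<close>.\<close>

datatype channel = ChN | ChI | ChG nat | ChH nat

fun chbit :: "channel \<Rightarrow> column \<Rightarrow> bool" where
  "chbit ChN (f, a, c, b) \<longleftrightarrow> a = 2"
| "chbit ChI (f, a, c, b) \<longleftrightarrow> c = 2"
| "chbit (ChG t) (f, a, c, b) \<longleftrightarrow> fst (b ! t) = 2"
| "chbit (ChH t) (f, a, c, b) \<longleftrightarrow> snd (b ! t) = 2"

definition cval :: "nat \<Rightarrow> bool \<Rightarrow> bool list \<Rightarrow> bool list \<Rightarrow> bool list \<Rightarrow> bool list \<Rightarrow> channel \<Rightarrow> nat" where
  "cval W f n g i h ch = horner_sum of_bool 2 (map (chbit ch) (pass W f n g i h))"

text \<open>Horner sums are additive, so a linear combination of channel values is one Horner sum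
  over columnwise combinations of bits, and these are bounded by the sum of the
  \<open>\<bar>c\<bar>\<close>.\<close>

lemma regular_lin_ge:
  "regular W (\<lambda>n g i h. (\<Sum>(c, ch)\<leftarrow>ts. c * int (cval W f n g i h ch)) + d \<ge> e * 2 ^ width W n g h)"
proof -
  define wt where "wt = (\<lambda>a. \<Sum>(c, ch)\<leftarrow>ts. c * (of_bool (chbit ch a) :: int))"
  have "\<bar>wt a\<bar> \<le> (\<Sum>(c, ch)\<leftarrow>ts. \<bar>c\<bar>)" for a
    unfolding wt_def by (induction ts) auto
  note w = regular_weight[where wt = wt, OF this, where W = W]
 
  have "regular W (\<lambda>n g i h. d + horner_sum wt 2 (pass W f n g i h) \<ge> e * 2 ^ width W n g h)"
    by (rule w)
  moreover have "horner_sum wt 2 as = (\<Sum>(c, ch)\<leftarrow>ts. c * int (horner_sum of_bool 2 (map (chbit ch) as)))" for as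
  proof (induction as)
    case Nil
    then show ?case by (induction ts) auto
  next
    case (Cons a as)
    have "wt a + 2 * (\<Sum>(c, ch)\<leftarrow>ts. c * int (horner_sum of_bool 2 (map (chbit ch) as))) =
      (\<Sum>(c, ch)\<leftarrow>ts. c * int (horner_sum of_bool 2 (map (chbit ch) (a # as))))"
      unfolding wt_def by (induction ts) (auto simp: algebra_simps)
    then show ?case using Cons by simp
  qed
  ultimately show ?thesis by (simp add: cval_def add.commute)
qed

lemma regular_lin_eq:
  "regular W (\<lambda>n g i h. (\<Sum>(c, ch)\<leftarrow>ts. c * int (cval W f n g i h ch)) = d)"
proof -
  have "(\<Sum>(c, ch)\<leftarrow>map (\<lambda>(c, ch). (- c, ch)) ts. c * int (cval W f n g i h ch)) =
     - (\<Sum>(c, ch)\<leftarrow>ts. c * int (cval W f n g i h ch))" for n g i h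
    by (induction ts) auto
  note neg = this
  show ?thesis
    using regular_conj[OF regular_lin_ge[where W = W and f = f and ts = ts and d = "- d" and e = 0]
        regular_lin_ge[where W = W and f = f and ts = "map (\<lambda>(c, ch). (- c, ch)) ts" and d = d and e = 0]]
    unfolding neg by (rule back_subst[of "regular W"]) (intro ext, auto)
qed

lemma regular_ch_eq_const: "regular W (\<lambda>n g i h. cval W f n g i h ch = k)"
  using regular_lin_eq[where W = W and f = f and ts = "[(1, ch)]" and d = "int k"] by simp

lemma regular_ch_eq: "regular W (\<lambda>n g i h. cval W f n g i h ch = cval W f n g i h ch')"
  using regular_lin_eq[where W = W and f = f and ts = "[(1, ch), (- 1, ch')]" and d = 0] by simp

lemma regular_ch_less: "regular W (\<lambda>n g i h. cval W f n g i h ch < cval W f n g i h ch')"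
  using regular_lin_ge[where W = W and f = f and ts = "[(1, ch'), (- 1, ch)]" and d = "- 1" and e = 0]
  by (rule back_subst[of "regular W"]) (auto intro!: ext)

text \<open>The state keeps the last nonblank symbol of \<open>i\<close>: 0 if there was none, 1 for
  the digit 0, 2 for the digit 1. A most significant digit 0 is excluded, and \<open>i\<close> must
  end within the two passes; this singles out the numerals produced by
  \<open>nat_bits\<close>.\<close>

lemma regular_canonical: "regular W (\<lambda>n g i h. length i \<le> 2 * width W n g h \<and> (i = [] \<or> last i))"
proof (rule regularI[of "{0, 1, 2::nat}" 0 "\<lambda>q a. if fst (snd (snd a)) = 0 then q else min (fst (snd (snd a))) 2"
      _ "\<lambda>q e. q \<noteq> 1 \<and> e = 0"])
  fix n g i h
  let ?J = "width W n g h"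
  have sym: "map (\<lambda>a. fst (snd (snd a))) (stream W n g i h) = map (sy i) [0..<2 * ?J]"
  proof -
    have "map (\<lambda>a. fst (snd (snd a))) (stream W n g i h) = map (sy i) ([0..<?J] @ map ((+) ?J) [0..<?J])"
      by (simp add: stream_def pass_def column_def)
    also have "[0..<?J] @ map ((+) ?J) [0..<?J] = [0..<2 * ?J]"
      by (rule nth_equalityI) (auto simp: nth_append)
    finally show ?thesis .
  qed
  have f1: "foldl (\<lambda>q a. if fst (snd (snd a)) = 0 then q else min (fst (snd (snd a))) 2) q as =
    foldl (\<lambda>q s. if s = 0 then q else min s 2) q (map (\<lambda>a. fst (snd (snd a))) as)" for q and as :: "column list"
    by (induction as arbitrary: q) auto
  have f2: "foldl (\<lambda>q s. if s = 0 then q else min s 2) 0 (map (sy i) [0..<m]) =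
    (if m = 0 \<or> i = [] then 0 else sy i (min m (length i) - 1))" for m
  proof (induction m)
    case (Suc m)
    then show ?case by (cases "m < length i"; cases i) (auto simp: sy_def min_def)
  qed simp
  show "(length i \<le> 2 * width W n g h \<and> (i = [] \<or> last i)) \<longleftrightarrow>
    (foldl (\<lambda>q a. if fst (snd (snd a)) = 0 then q else min (fst (snd (snd a))) 2) 0 (stream W n g i h) \<noteq> 1 \<and>
      sy i (2 * width W n g h) = 0)"
    unfolding f1 sym f2 by (auto simp: sy_def min_def last_conv_nth)
qed auto

text \<open>The shape of gate names: \<open>W\<close> digits per column and \<open>c0\<close>
  columns more than \<open>n\<close> has digits. For \<open>h\<close> there is only a bound, as
  \<open>h\<close> is empty where a single gate is tested.\<close>

definition fmt :: "nat \<Rightarrow> nat \<Rightarrow> bool list \<Rightarrow> bool list \<Rightarrow> bool list \<Rightarrow> bool list \<Rightarrow> bool" where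
  "fmt W c0 n g i h \<longleftrightarrow> length g = W * (length n + c0) \<and> length h \<le> length g"

lemma fmt_width: "W > 0 \<Longrightarrow> fmt W c0 n g i h \<Longrightarrow> width W n g h = length n + c0"
  unfolding width_def fmt_def by (intro Least_equality) (auto simp: mult.commute)

text \<open>\<open>g\<close> fills the columns iff none of its cells is blank. The number of columns
  is then checked by counting, in the first pass, those in which \<open>n\<close> has already
  ended.\<close>

lemma regular_fmt:
  assumes W: "W > 0" shows "regular W (fmt W c0)"
proof -
  have eq: "fmt W c0 n g i h \<longleftrightarrow>
      (\<forall>a\<in>set (stream W n g i h). \<forall>t<W. fst (snd (snd (snd a)) ! t) \<noteq> 0) \<and>
      length (filter (\<lambda>a. \<not> fst a \<and> fst (snd a) = 0) (stream W n g i h)) = c0" (is "_ = (?A \<and> ?B)")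
    for n g i h
  proof -
    let ?J = "width W n g h"
    note wp = width_props[OF W, where n = n and g = g and h = h]
    have A: "?A \<longleftrightarrow> length g = ?J * W"
    proof -
      have "?A \<longleftrightarrow> (\<forall>j<?J. \<forall>t<W. j * W + t < length g)"
        by (simp add: stream_def pass_def column_def ball_Un not_le) auto
      also have "\<dots> \<longleftrightarrow> ?J * W \<le> length g"
      proof safe
        assume *: "\<forall>j<?J. \<forall>t<W. j * W + t < length g"
        show "?J * W \<le> length g"
        proof (cases ?J)
          case (Suc j)
          with *[rule_format, of j "W - 1"] W show ?thesis by (simp add: algebra_simps)
        qed simp
      next
        fix j t assume *: "?J * W \<le> length g" "j < ?J" "t < W"
        have "Suc j * W \<le> ?J * W" using * by (intro mult_le_mono1) auto
        then show "j * W + t < length g" using * by simp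
      qed
      finally show ?thesis using wp by linarith
    qed
    have "filter (\<lambda>a. \<not> fst a \<and> fst (snd a) = 0) (stream W n g i h) =
       filter (\<lambda>a. fst (snd a) = 0) (pass W False n g i h)"
      unfolding filter_stream[symmetric] filter_filter by (rule filter_cong) auto
    also have "length \<dots> = length (filter (\<lambda>j. length n \<le> j) [0..<?J])"
      by (simp add: pass_def filter_map column_def comp_def)
    also have "filter (\<lambda>j. length n \<le> j) [0..<?J] = [length n..<?J]"
    proof -
      have "[0..<?J] = [0..<length n] @ [length n..<?J]"
        using wp upt_add_eq_append[of 0 "length n" "?J - length n"] by simp
      then show ?thesis by simp
    qed
    finally have B: "?B \<longleftrightarrow> ?J = length n + c0" using wp by auto
    show ?thesis
    proof
      assume "fmt W c0 n g i h"
      then show "?A \<and> ?B" using A B fmt_width[OF W, of c0 n g i h] by (simp add: fmt_def mult.commute)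
    next
      assume "?A \<and> ?B"
      then show "fmt W c0 n g i h" using A B wp by (simp add: fmt_def mult.commute)
    qed
  qed
  show ?thesis
    unfolding eq[abs_def] by (intro regular_conj regular_count regular_list_all)
qed

lemma regular_hfull:
  assumes W: "W > 0" shows "regular W (\<lambda>n g i h. fmt W c0 n g i h \<and> length h = length g)"
proof -
  have eq: "fmt W c0 n g i h \<and> length h = length g \<longleftrightarrow> fmt W c0 n g i h \<and>
      (\<forall>a\<in>set (stream W n g i h). \<forall>t<W. snd (snd (snd (snd a)) ! t) \<noteq> 0)" for n g i h
  proof (rule conj_cong[OF refl])
    assume f: "fmt W c0 n g i h"
    let ?J = "width W n g h"
    have J: "?J = length n + c0" "length g = ?J * W" "length h \<le> ?J * W"
      using f fmt_width[OF W f] by (auto simp: fmt_def mult.commute)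
    have "(\<forall>a\<in>set (stream W n g i h). \<forall>t<W. snd (snd (snd (snd a)) ! t) \<noteq> 0) \<longleftrightarrow>
        (\<forall>j<?J. \<forall>t<W. j * W + t < length h)"
      by (simp add: stream_def pass_def column_def ball_Un not_le) auto
    also have "\<dots> \<longleftrightarrow> ?J * W \<le> length h"
    proof safe
      assume *: "\<forall>j<?J. \<forall>t<W. j * W + t < length h"
      show "?J * W \<le> length h"
      proof (cases ?J)
        case (Suc j)
        with *[rule_format, of j "W - 1"] W show ?thesis by (simp add: algebra_simps)
      qed simp
    next
      fix j t assume *: "?J * W \<le> length h" "j < ?J" "t < W"
      have "Suc j * W \<le> ?J * W" using * by (intro mult_le_mono1) auto
      then show "j * W + t < length h" using * by simp
    qed
    finally show "length h = length g \<longleftrightarrow>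
       (\<forall>a\<in>set (stream W n g i h). \<forall>t<W. snd (snd (snd (snd a)) ! t) \<noteq> 0)" using J by auto
  qed
  show ?thesis
    unfolding eq[abs_def] by (intro regular_conj regular_fmt[OF W] regular_list_all)
qed

section \<open>Names of gates\<close>

definition bval :: "bool list \<Rightarrow> nat" where
  "bval w = horner_sum of_bool 2 w"

definition gate_name :: "nat \<Rightarrow> nat \<Rightarrow> (nat \<Rightarrow> nat) \<Rightarrow> bool list" where
  "gate_name W K v = map (\<lambda>s. bit (v (s mod W)) (s div W)) [0..<K * W]"

definition track :: "nat \<Rightarrow> nat \<Rightarrow> bool list \<Rightarrow> nat \<Rightarrow> nat" where
  "track W K g t = bval (map (\<lambda>j. g ! (j * W + t)) [0..<K])"

lemma bit_bval: "bit (bval w) j \<longleftrightarrow> j < length w \<and> w ! j"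
  by (simp add: bval_def bit_horner_sum_bit_iff)

lemma bval_less: "bval w < 2 ^ length w"
  unfolding bval_def by (induction w) auto

lemma bval_nat_bits [simp]: "bval (nat_bits n) = n"
proof (induction n rule: less_induct)
  case (less n)
  show ?case
  proof (cases "n = 0")
    case True
    then show ?thesis by (simp add: nat_bits.simps bval_def)
  next
    case False
    then have "bval (nat_bits n) = of_bool (odd n) + 2 * bval (nat_bits (n div 2))"
      by (subst nat_bits.simps) (simp add: bval_def)
    also have "\<dots> = n" using less[of "n div 2"] False by (simp add: odd_two_times_div_two_succ)
    finally show ?thesis .
  qed
qed

lemma nat_bits_inj: "nat_bits m = nat_bits n \<longleftrightarrow> m = n"
  by (metis bval_nat_bits)

lemma nat_bits_last: "nat_bits n = [] \<or> last (nat_bits n)"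
proof (induction n rule: less_induct)
  case (less n)
  show ?case
  proof (cases "n = 0")
    case False
    then have eq: "nat_bits n = odd n # nat_bits (n div 2)" by (subst nat_bits.simps) simp
    show ?thesis
    proof (cases "n div 2 = 0")
      case True
      then have "n = 1" using False by simp
      then show ?thesis by (simp add: nat_bits.simps)
    next
      case n2: False
      then have "nat_bits (n div 2) \<noteq> []" by (subst nat_bits.simps) simp
      then show ?thesis using less[of "n div 2"] False by (simp add: eq)
    qed
  qed (simp add: nat_bits.simps)
qed

lemma bval_last_ge: "w \<noteq> [] \<Longrightarrow> last w \<Longrightarrow> 2 ^ (length w - 1) \<le> bval w"
  using bit_bval[of w "length w - 1"] by (metis bit_take_bit_iff bit_nat_iff diff_less last_conv_nth
      length_greater_0_conv less_numeral_extra(1) linorder_not_less not_bit_1_Suc take_bit_nat_eq_self order_less_irrefl)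

lemma nat_bits_bval: "w = [] \<or> last w \<Longrightarrow> nat_bits (bval w) = w"
proof (induction w)
  case (Cons b w)
  show ?case
  proof (cases "w = []")
    case True
    then show ?thesis using Cons by (simp add: bval_def nat_bits.simps)
  next
    case False
    then have w: "last w" using Cons by simp
    have "bval w > 0" using bval_last_ge[OF False w] by (metis gr0I le_zero_eq power_not_zero zero_neq_numeral)
    moreover have "bval (b # w) = of_bool b + 2 * bval w" by (simp add: bval_def)
    ultimately show ?thesis using Cons.IH w by (subst nat_bits.simps) auto
  qed
qed (simp add: bval_def nat_bits.simps)

lemma nat_bits_length_le: "n < 2 ^ k \<Longrightarrow> length (nat_bits n) \<le> k"
proof (rule ccontr)
  assume n: "n < 2 ^ k" and "\<not> length (nat_bits n) \<le> k"
  then have "nat_bits n \<noteq> []" "k \<le> length (nat_bits n) - 1" by auto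
  moreover have "2 ^ (length (nat_bits n) - 1) \<le> n"
    using bval_last_ge[of "nat_bits n"] nat_bits_last[of n] \<open>nat_bits n \<noteq> []\<close> by simp
  ultimately show False using n
    by (meson le_trans linorder_not_less one_le_numeral power_increasing)
qed

lemma less_nat_bits: "n < 2 ^ length (nat_bits n)"
  using bval_less[of "nat_bits n"] by simp

lemma nat_bits_length_bound: "2 ^ length (nat_bits n) \<le> 2 * n + 1"
proof (cases "nat_bits n = []")
  case False
  then have "2 ^ (length (nat_bits n) - 1) \<le> n"
    using bval_last_ge[of "nat_bits n"] nat_bits_last[of n] by simp
  then show ?thesis using False by (cases "nat_bits n") auto
qed simp

lemma length_gate_name [simp]: "length (gate_name W K v) = W * K"
  by (simp add: gate_name_def)

lemma track_less: "track W K g t < 2 ^ K"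
  using bval_less[of "map (\<lambda>j. g ! (j * W + t)) [0..<K]"] by (simp add: track_def)

lemma column_index: "j < K \<Longrightarrow> t < W \<Longrightarrow> j * W + t < K * W" for j K t W :: nat
proof -
  assume "j < K" "t < W"
  then have "Suc j * W \<le> K * W" by (intro mult_le_mono1) auto
  then show ?thesis using \<open>t < W\<close> by simp
qed

lemma track_gate_name:
  assumes "t < W" "v t < 2 ^ K" shows "track W K (gate_name W K v) t = v t"
proof (rule bit_eqI)
  fix j
  have "bit (v t) j \<Longrightarrow> j < K"
    using assms(2) by (metis bit_take_bit_iff take_bit_nat_eq_self_iff)
  then show "bit (track W K (gate_name W K v) t) j = bit (v t) j"
    using assms column_index[of j K t W] by (auto simp: track_def bit_bval gate_name_def)
qed

lemma gate_name_track:
  assumes "W > 0" "length g = W * K" shows "gate_name W K (track W K g) = g"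
  using assms by (intro nth_equalityI)
    (auto simp: gate_name_def track_def bit_bval less_mult_imp_div_less mult.commute)

lemma gate_name_cong: "(\<And>t. t < W \<Longrightarrow> v t = v' t) \<Longrightarrow> gate_name W K v = gate_name W K v'"
  by (cases "W = 0") (auto simp: gate_name_def)

lemma cval_ChN: "length n \<le> width W n g h \<Longrightarrow> cval W f n g i h ChN = bval n"
  by (rule bit_eqI) (auto simp: cval_def bval_def[symmetric] bit_bval pass_def column_def)

lemma cval_ChG:
  assumes "t < W" "length g = W * width W n g h"
  shows "cval W f n g i h (ChG t) = track W (width W n g h) g t"
proof -
  have "j * W + t < length g" if "j < width W n g h" for j
    using column_index[OF that assms(1)] assms(2) by (simp add: mult.commute)
  then have "map (chbit (ChG t)) (pass W f n g i h) = map (\<lambda>j. g ! (j * W + t)) [0..<width W n g h]"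
    using assms(1) by (simp add: pass_def column_def)
  then show ?thesis by (simp add: cval_def track_def bval_def)
qed

lemma cval_ChH:
  assumes "t < W" "length h = W * width W n g h"
  shows "cval W f n g i h (ChH t) = track W (width W n g h) h t"
proof -
  have "j * W + t < length h" if "j < width W n g h" for j
    using column_index[OF that assms(1)] assms(2) by (simp add: mult.commute)
  then have "map (chbit (ChH t)) (pass W f n g i h) = map (\<lambda>j. h ! (j * W + t)) [0..<width W n g h]"
    using assms(1) by (simp add: pass_def column_def)
  then show ?thesis by (simp add: cval_def track_def bval_def)
qed

lemma cval_ChI_False: "cval W False n g i h ChI = bval i mod 2 ^ width W n g h"
  by (rule bit_eqI)
    (auto simp: cval_def bval_def[symmetric] bit_bval pass_def column_def bit_take_bit_iff
      simp flip: take_bit_eq_mod)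

text \<open>The second pass goes on in \<open>i\<close> where the first one stopped, hence the
  quotient. The bound on the length excludes digits that neither pass sees.\<close>

lemma cval_ChI_True: "length i \<le> 2 * width W n g h \<Longrightarrow> cval W True n g i h ChI = bval i div 2 ^ width W n g h"
  by (rule bit_eqI)
    (auto simp: cval_def bval_def[symmetric] bit_bval pass_def column_def bit_drop_bit_eq
      simp flip: drop_bit_eq_div)

section \<open>Formulas with oracle quantifiers\<close>

text \<open>Variables range over \<open>{0..<2 ^ K}\<close>.  An oracle string is indexed by pairs, since its length
  \<open>2 ^ K * n\<close> exceeds that range: in \<open>Orc j u w \<phi>\<close>, the variables \<open>u\<close> and \<open>w\<close> hold the low and the
  high part of the position.\<close>

datatype fm =
    Lin "(int \<times> nat) list" int int int
  | Inp nat
  | Neg fm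
  | Conj fm fm
  | Ex nat fm
  | Orc nat nat nat fm

text \<open>The multiple of \<open>2 ^ K\<close> makes the block length of the queries available to
  formulas. The automaton handles it by comparing its final carry with \<open>e\<close>.\<close>

definition lin :: "nat \<Rightarrow> nat \<Rightarrow> (int \<times> nat) list \<Rightarrow> int \<Rightarrow> int \<Rightarrow> int \<Rightarrow> (nat \<Rightarrow> nat) \<Rightarrow> bool" where
  "lin K n ts a d e s \<longleftrightarrow> (\<Sum>(c, v)\<leftarrow>ts. c * int (s v)) + a * int n + d \<ge> e * 2 ^ K"

fun sat :: "bool list set list \<Rightarrow> nat \<Rightarrow> bool list \<Rightarrow> fm \<Rightarrow> (nat \<Rightarrow> nat) \<Rightarrow> bool" where
  "sat Bs K x (Lin ts a d e) s = lin K (length x) ts a d e s"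
| "sat Bs K x (Inp v) s = (s v < length x \<and> x ! s v)"
| "sat Bs K x (Neg p) s = (\<not> sat Bs K x p s)"
| "sat Bs K x (Conj p q) s = (sat Bs K x p s \<and> sat Bs K x q s)"
| "sat Bs K x (Ex v p) s = (\<exists>a<2 ^ K. sat Bs K x p (s(v := a)))"
| "sat Bs K x (Orc j u w p) s =
    (map (\<lambda>i. sat Bs K x p (s(u := i mod 2 ^ K, w := i div 2 ^ K))) [0..<2 ^ K * length x] \<in> Bs ! j)"

fun wfm :: "nat \<Rightarrow> nat \<Rightarrow> fm \<Rightarrow> bool" where
  "wfm k r (Lin ts a d e) = (\<forall>(c, v)\<in>set ts. v < r)"
| "wfm k r (Inp v) = (v < r)"
| "wfm k r (Neg p) = wfm k r p"
| "wfm k r (Conj p q) = (wfm k r p \<and> wfm k r q)"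
| "wfm k r (Ex v p) = (v < r \<and> wfm k r p)"
| "wfm k r (Orc j u w p) = (j < k \<and> u < r \<and> w < r \<and> u \<noteq> w \<and> wfm k r p)"

fun subs :: "fm \<Rightarrow> fm set" where
  "subs (Neg p) = insert (Neg p) (subs p)"
| "subs (Conj p q) = insert (Conj p q) (subs p \<union> subs q)"
| "subs (Ex v p) = insert (Ex v p) (subs p)"
| "subs (Orc j u w p) = insert (Orc j u w p) (subs p)"
| "subs p = {p}"

lemma finite_subs: "finite (subs p)"
  by (induction p) auto

lemma subs_refl [simp]: "p \<in> subs p"
  by (cases p) auto

lemma subs_trans: "q \<in> subs p \<Longrightarrow> subs q \<subseteq> subs p"
  by (induction p) auto

lemma subs_wfm: "q \<in> subs p \<Longrightarrow> wfm k r p \<Longrightarrow> wfm k r q"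
  by (induction p) auto

lemma subs_size: "q \<in> subs p \<Longrightarrow> size q \<le> size p"
  by (induction p) auto

lemma lin_cong:
  assumes "\<forall>(c, v)\<in>set ts. v < r" "\<And>v. v < r \<Longrightarrow> s v = s' v"
  shows "lin K n ts a d e s = lin K n ts a d e s'"
proof -
  have "(\<Sum>(c, v)\<leftarrow>ts. c * int (s v)) = (\<Sum>(c, v)\<leftarrow>ts. c * int (s' v))"
    using assms by (induction ts) auto
  then show ?thesis by (simp add: lin_def)
qed

lemma sat_cong: "wfm k r p \<Longrightarrow> (\<And>v. v < r \<Longrightarrow> s v = s' v) \<Longrightarrow> sat Bs K x p s = sat Bs K x p s'"
proof (induction p arbitrary: s s')
  case (Lin ts a d e)
  then show ?case using lin_cong[of ts r s s'] by simp
next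
  case (Neg p)
  have "sat Bs K x p s = sat Bs K x p s'" by (rule Neg.IH) (use Neg.prems in auto)
  then show ?case by simp
next
  case (Conj p q)
  have "sat Bs K x p s = sat Bs K x p s'" by (rule Conj.IH(1)) (use Conj.prems in auto)
  moreover have "sat Bs K x q s = sat Bs K x q s'" by (rule Conj.IH(2)) (use Conj.prems in auto)
  ultimately show ?case by simp
next
  case (Ex v p)
  have "sat Bs K x p (s(v := a)) = sat Bs K x p (s'(v := a))" for a
    using Ex.prems by (intro Ex.IH) auto
  then show ?case by simp
next
  case (Orc j u w p)
  have "sat Bs K x p (s(u := a, w := b)) = sat Bs K x p (s'(u := a, w := b))" for a b
    using Orc.prems by (intro Orc.IH) auto
  then show ?case by simp
qed auto

section \<open>Circuits from formulas\<close>

text \<open>Truth values are gates without inputs: an empty conjunction is true, an empty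
  disjunction false. As the type of a \<open>Lin\<close> gate depends on its assignment, arithmetic
  is done by the machine that computes gate types, not by the circuit.\<close>

fun gate_kind :: "nat \<Rightarrow> nat \<Rightarrow> fm \<Rightarrow> (nat \<Rightarrow> nat) \<Rightarrow> gate_type" where
  "gate_kind K n (Lin ts a d e) s = (if lin K n ts a d e s then AndG else OrG)"
| "gate_kind K n (Inp v) s = (if s v < n then InputG (s v) else OrG)"
| "gate_kind K n (Neg p) s = NotG"
| "gate_kind K n (Conj p q) s = AndG"
| "gate_kind K n (Ex v p) s = OrG"
| "gate_kind K n (Orc j u w p) s = OracleG j"

fun gate_args :: "nat \<Rightarrow> nat \<Rightarrow> fm \<Rightarrow> (nat \<Rightarrow> nat) \<Rightarrow> (fm \<times> (nat \<Rightarrow> nat)) list" where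
  "gate_args K n (Neg p) s = [(p, s)]"
| "gate_args K n (Conj p q) s = [(p, s), (q, s)]"
| "gate_args K n (Ex v p) s = map (\<lambda>a. (p, s(v := a))) [0..<2 ^ K]"
| "gate_args K n (Orc j u w p) s =
    map (\<lambda>i. (p, s(u := i mod 2 ^ K, w := i div 2 ^ K))) [0..<2 ^ K * n]"
| "gate_args K n p s = []"

lemma gate_args_subs: "(q, s') \<in> set (gate_args K n p s) \<Longrightarrow> q \<in> subs p \<and> size q < size p"
  by (cases p) auto

lemma div_less_pow: "i < 2 ^ K * n \<Longrightarrow> i div 2 ^ K < n" for i K n :: nat
  by (simp add: less_mult_imp_div_less mult.commute)

lemma gate_args_less:
  "(q, s') \<in> set (gate_args K n p s) \<Longrightarrow> n < 2 ^ K \<Longrightarrow> \<forall>v<r. s v < 2 ^ K \<Longrightarrow> v < r \<Longrightarrow> s' v < 2 ^ K"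
  by (cases p) (auto dest!: div_less_pow)

lemma length_gate_args: "length (gate_args K n p s) \<le> 2 + 2 ^ K + 2 ^ K * n"
  by (cases p) auto

lemma sat_gate_fun:
  "sat Bs K x p s = gate_fun Bs x (gate_kind K (length x) p s)
     (map (\<lambda>(q, s'). sat Bs K x q s') (gate_args K (length x) p s))"
  by (cases p) (auto simp: comp_def)

text \<open>\<open>r\<close> bounds the variables of \<open>p0\<close>; names have a further track,
  numbered \<open>r\<close>, for the code of the subformula. The \<open>c0\<close> extra columns
  give room for the codes. At least one of them is required so that \<open>2 ^ K\<close> exceeds 1
  and the second input of a conjunction has an index with high half 0.\<close>

locale formula_circuit =
  fixes k r c0 :: nat and p0 :: fm and code :: "fm \<Rightarrow> nat"
  assumes wf: "wfm k r p0" and inj: "inj_on code (subs p0)"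
    and code_less: "\<And>p. p \<in> subs p0 \<Longrightarrow> code p < 2 ^ c0" and c0: "0 < c0"
begin

abbreviation "W \<equiv> Suc r"

definition KK :: "nat \<Rightarrow> nat" where
  "KK n = length (nat_bits n) + c0"

definition nm :: "nat \<Rightarrow> fm \<times> (nat \<Rightarrow> nat) \<Rightarrow> gate" where
  "nm n = (\<lambda>(p, s). gate_name W (KK n) (s(r := code p)))"

definition is_gate :: "nat \<Rightarrow> gate \<Rightarrow> bool" where
  "is_gate n g \<longleftrightarrow> length g = W * KK n \<and> (\<exists>p\<in>subs p0. track W (KK n) g r = code p)"

definition node :: "nat \<Rightarrow> gate \<Rightarrow> fm" where
  "node n g = inv_into (subs p0) code (track W (KK n) g r)"

definition circ :: "nat \<Rightarrow> circuit" where
  "circ n = \<lparr>gates = {g. is_gate n g}, outgate = nm n (p0, \<lambda>_. 0),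
     gtype = (\<lambda>g. gate_kind (KK n) n (node n g) (track W (KK n) g)),
     ins = (\<lambda>g. map (nm n) (gate_args (KK n) n (node n g) (track W (KK n) g)))\<rparr>"

lemma code_KK: "p \<in> subs p0 \<Longrightarrow> code p < 2 ^ KK n"
  by (rule less_le_trans[OF code_less power_increasing]) (auto simp: KK_def)

lemma n_KK: "n < 2 ^ KK n"
  by (rule less_le_trans[OF less_nat_bits power_increasing]) (auto simp: KK_def)

lemma node_eq: "p \<in> subs p0 \<Longrightarrow> track W (KK n) g r = code p \<Longrightarrow> node n g = p"
  by (simp add: node_def inj)

lemma is_gateD: "is_gate n g \<Longrightarrow> node n g \<in> subs p0 \<and> track W (KK n) g r = code (node n g) \<and>
    length g = W * KK n"
  by (auto simp: is_gate_def node_eq)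

lemma
  assumes p: "p \<in> subs p0" and s: "\<forall>v<r. s v < 2 ^ KK n"
  shows is_gate_nm: "is_gate n (nm n (p, s))" and node_nm: "node n (nm n (p, s)) = p"
    and track_nm: "v < r \<Longrightarrow> track W (KK n) (nm n (p, s)) v = s v"
proof -
  have "track W (KK n) (nm n (p, s)) r = code p"
    unfolding nm_def using code_KK[OF p] by (simp add: track_gate_name)
  then show "is_gate n (nm n (p, s))" "node n (nm n (p, s)) = p"
    using p by (auto simp: is_gate_def node_eq nm_def)
  show "v < r \<Longrightarrow> track W (KK n) (nm n (p, s)) v = s v"
    unfolding nm_def using s by (simp add: track_gate_name)
qed

lemma arg_props:
  assumes g: "is_gate n g" and a: "(q, s') \<in> set (gate_args (KK n) n (node n g) (track W (KK n) g))"
  shows "q \<in> subs p0" "size q < size (node n g)" "\<forall>v<r. s' v < 2 ^ KK n"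
  using gate_args_subs[OF a] subs_trans[of "node n g" p0] is_gateD[OF g]
    gate_args_less[OF a n_KK, of r] track_less by auto

lemma ins_gate: "is_gate n g \<Longrightarrow> h \<in> set (ins (circ n) g) \<Longrightarrow> is_gate n h \<and> size (node n h) < size (node n g)"
  using arg_props is_gate_nm node_nm by (fastforce simp: circ_def)

lemma finite_gates: "finite (gates (circ n))" and card_gates: "card (gates (circ n)) \<le> 2 ^ (W * KK n)"
proof -
  have sub: "gates (circ n) \<subseteq> {g. set g \<subseteq> (UNIV :: bool set) \<and> length g = W * KK n}"
    by (auto simp: circ_def is_gate_def)
  have fin: "finite {g. set g \<subseteq> (UNIV :: bool set) \<and> length g = W * KK n}"
    by (rule finite_lists_length_eq) simp
  show "finite (gates (circ n))" using sub fin by (rule finite_subset)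
  show "card (gates (circ n)) \<le> 2 ^ (W * KK n)"
    using card_mono[OF fin sub] card_lists_length_eq[of "UNIV :: bool set" "W * KK n"] by simp
qed

lemma wf_circ: "wf_circuit n k (circ n)"
  unfolding wf_circuit_def
proof (intro conjI ballI)
  show "finite (gates (circ n))" by (rule finite_gates)
  show "outgate (circ n) \<in> gates (circ n)"
    using is_gate_nm[of p0 "\<lambda>_. 0"] by (simp add: circ_def)
next
  fix g assume "g \<in> gates (circ n)"
  then have g: "is_gate n g" by (simp add: circ_def)
  show "set (ins (circ n) g) \<subseteq> gates (circ n)"
    using ins_gate[OF g] by (auto simp: circ_def)
  have "wfm k r (node n g)" using subs_wfm[OF _ wf] is_gateD[OF g] by blast
  then show "case gtype (circ n) g of InputG j \<Rightarrow> j < n \<and> ins (circ n) g = []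
         | NotG \<Rightarrow> length (ins (circ n) g) = 1 | OracleG i \<Rightarrow> i < k | _ \<Rightarrow> True"
    by (cases "node n g") (auto simp: circ_def)
qed

text \<open>Every wire leads to a strictly larger subformula.\<close>

lemma circ_depth: "depth_at_most (circ n) (size p0)"
proof -
  have "size (node n h) + m \<le> size (node n g) \<and> is_gate n g" if "(h, g) \<in> wire_rel (circ n) ^^ m" "m > 0" for h g m
    using that
  proof (induction m arbitrary: g)
    case (Suc m)
    then obtain f where f: "(h, f) \<in> wire_rel (circ n) ^^ m" "(f, g) \<in> wire_rel (circ n)" by auto
    then have g: "is_gate n g" "f \<in> set (ins (circ n) g)" by (auto simp: wire_rel_def circ_def)
    from ins_gate[OF this] f Suc.IH[of f] g show ?case by (cases m) auto
  qed simp
  then have "False" if "(h, g) \<in> wire_rel (circ n) ^^ Suc (size p0)" for h g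
    using that is_gateD[of n g] subs_size[of "node n g" p0] by fastforce
  then show ?thesis unfolding depth_at_most_def by auto
qed

text \<open>A gate computes the truth of its subformula under its own assignment. That no other
  values are consistent follows by induction on the size of the subformula.\<close>

lemma circ_accepts:
  assumes "length x = n"
  shows "accepts Bs (circ n) x \<longleftrightarrow> sat Bs (KK n) x p0 (\<lambda>_. 0)"
proof -
  define v0 where "v0 = (\<lambda>g. sat Bs (KK n) x (node n g) (track W (KK n) g))"
  have v0_nm: "v0 (nm n (q, s')) = sat Bs (KK n) x q s'" if "q \<in> subs p0" "\<forall>v<r. s' v < 2 ^ KK n" for q s'
    using that subs_wfm[OF _ wf] by (auto simp: v0_def node_nm track_nm intro!: sat_cong)
  have cons: "v0 g = gate_fun Bs x (gtype (circ n) g) (map v0 (ins (circ n) g))" if g: "is_gate n g" for g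
  proof -
    have ins: "map v0 (ins (circ n) g) = map (\<lambda>(q, s'). sat Bs (KK n) x q s')
        (gate_args (KK n) n (node n g) (track W (KK n) g))"
      using arg_props[OF g] by (auto simp: circ_def intro!: v0_nm)
    have "v0 g = sat Bs (KK n) x (node n g) (track W (KK n) g)" by (simp add: v0_def)
    then show ?thesis
      unfolding ins using sat_gate_fun[of Bs "KK n" x "node n g" "track W (KK n) g"] assms
      by (simp add: circ_def)
  qed
  have uniq: "v g = v0 g"
    if v: "\<forall>g\<in>gates (circ n). v g = gate_fun Bs x (gtype (circ n) g) (map v (ins (circ n) g))"
      and g: "is_gate n g" for v g
    using g
  proof (induction "size (node n g)" arbitrary: g rule: less_induct)
    case less
    have "map v (ins (circ n) g) = map v0 (ins (circ n) g)"
      using less ins_gate[of n g] by auto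
    moreover have "g \<in> gates (circ n)" using less.prems by (simp add: circ_def)
    ultimately show ?case using v cons[OF less.prems] by metis
  qed
  have out: "is_gate n (nm n (p0, \<lambda>_. 0))" "v0 (nm n (p0, \<lambda>_. 0)) = sat Bs (KK n) x p0 (\<lambda>_. 0)"
    by (auto simp: is_gate_nm v0_nm)
  have og: "outgate (circ n) = nm n (p0, \<lambda>_. 0)" "\<And>g. g \<in> gates (circ n) \<longleftrightarrow> is_gate n g"
    by (auto simp: circ_def)
  show ?thesis
    unfolding accepts_def og(1)
  proof
    assume "\<exists>v. (\<forall>g\<in>gates (circ n). v g = gate_fun Bs x (gtype (circ n) g) (map v (ins (circ n) g))) \<and>
        v (nm n (p0, \<lambda>_. 0))"
    then show "sat Bs (KK n) x p0 (\<lambda>_. 0)" using uniq out by blast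
  next
    assume "sat Bs (KK n) x p0 (\<lambda>_. 0)"
    then show "\<exists>v. (\<forall>g\<in>gates (circ n). v g = gate_fun Bs x (gtype (circ n) g) (map v (ins (circ n) g))) \<and>
        v (nm n (p0, \<lambda>_. 0))"
      using cons out og by (intro exI[of _ v0]) auto
  qed
qed

lemma pow_KK: "2 ^ KK n \<le> (n + 2) ^ (c0 + 1)"
proof -
  have "2 ^ KK n \<le> (2 * n + 1) * 2 ^ c0"
    unfolding KK_def power_add by (rule mult_le_mono1[OF nat_bits_length_bound])
  \<comment> \<open>One factor 2 is split off because \<open>2 * (2 * n + 1)\<close> is at most
    \<open>(n + 2) ^ 2\<close>; each remaining factor is at most \<open>n + 2\<close>.\<close>
  also have "(2::nat) ^ c0 = 2 ^ (c0 - 1) * 2" using c0 by (cases c0) auto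
  also have "(2 * n + 1) * (2 ^ (c0 - 1) * 2) \<le> (n + 2) ^ (c0 - 1) * (2 * (2 * n + 1))"
    using mult_right_mono[OF power_mono[of 2 "n + 2" "c0 - 1"], of "2 * (2 * n + 1)"]
    by (simp only: ac_simps)
  also have "\<dots> \<le> (n + 2) ^ (c0 - 1) * (n + 2) ^ 2"
    by (rule mult_le_mono2) (simp add: power2_eq_square algebra_simps)
  also have "\<dots> = (n + 2) ^ (c0 + 1)"
    unfolding power_add[symmetric] using c0 by simp
  finally show ?thesis .
qed

text \<open>The exponent \<open>(c0 + 1) * W\<close> accounts for the number of gates and
  \<open>c0 + 5\<close> for one plus the fan-in.\<close>

lemma circ_size: "circuit_size (circ n) \<le> (n + 2) ^ ((c0 + 1) * W + (c0 + 5))"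
proof -
  let ?E = "(n + 2) ^ (c0 + 1)"
  have "circuit_size (circ n) \<le> card (gates (circ n)) + card (gates (circ n)) * (2 + 2 ^ KK n + 2 ^ KK n * n)"
    unfolding circuit_size_def
    using sum_bounded_above[of "gates (circ n)" "\<lambda>g. length (ins (circ n) g)" "2 + 2 ^ KK n + 2 ^ KK n * n"]
      length_gate_args by (simp add: circ_def)
  also have "\<dots> = card (gates (circ n)) * (3 + 2 ^ KK n + 2 ^ KK n * n)"
    by (simp add: algebra_simps)
  also have "\<dots> \<le> 2 ^ (W * KK n) * (3 + ?E + ?E * n)"
    using card_gates pow_KK[of n] by (intro mult_le_mono add_mono) auto
  also have "(2::nat) ^ (W * KK n) = (2 ^ KK n) ^ W"
    by (simp only: power_mult[symmetric] mult.commute)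
  also have "(2 ^ KK n) ^ W * (3 + ?E + ?E * n) \<le> ?E ^ W * (?E * (n + 2) ^ 4)"
  proof (intro mult_le_mono power_mono pow_KK)
    have "3 + E + E * n \<le> E * (n + 4)" if "1 \<le> E" for E :: nat using that by (simp add: algebra_simps)
    then have "3 + ?E + ?E * n \<le> ?E * (n + 4)" by (metis one_le_power le_add2 one_le_numeral order_trans)
    also have "n + 4 \<le> (n + 2) ^ 2" by (simp add: power2_eq_square)
    also have "(n + 2) ^ 2 \<le> (n + 2) ^ 4" by (rule power_increasing) auto
    finally show "3 + ?E + ?E * n \<le> ?E * (n + 2) ^ 4" by simp
  qed auto
  also have "\<dots> = (n + 2) ^ ((c0 + 1) * W + (c0 + 5))"
    by (simp only: power_mult[symmetric] power_add[symmetric]) (simp add: add.assoc)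
  finally show ?thesis .
qed

section \<open>Uniformity of the circuits\<close>

lemma fmt_cval:
  assumes "fmt W c0 (nat_bits n) g i h"
  shows "width W (nat_bits n) g h = KK n" "length g = W * KK n"
    "cval W f (nat_bits n) g i h ChN = n"
    "t < W \<Longrightarrow> cval W f (nat_bits n) g i h (ChG t) = track W (KK n) g t"
    "cval W False (nat_bits n) g i h ChI = bval i mod 2 ^ KK n"
    "length i \<le> 2 * KK n \<Longrightarrow> cval W True (nat_bits n) g i h ChI = bval i div 2 ^ KK n"
    "length h = length g \<Longrightarrow> t < W \<Longrightarrow> cval W f (nat_bits n) g i h (ChH t) = track W (KK n) h t"
proof -
  show w: "width W (nat_bits n) g h = KK n"
    using fmt_width[OF _ assms] by (simp add: KK_def)
  show l: "length g = W * KK n" using assms by (simp add: fmt_def KK_def)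
  show "cval W f (nat_bits n) g i h ChN = n"
    by (subst cval_ChN) (use w in \<open>simp_all add: KK_def\<close>)
  show "t < W \<Longrightarrow> cval W f (nat_bits n) g i h (ChG t) = track W (KK n) g t"
    using cval_ChG[of t W g "nat_bits n" h] w l by simp
  show "cval W False (nat_bits n) g i h ChI = bval i mod 2 ^ KK n"
    using cval_ChI_False[of W "nat_bits n" g i h] w by simp
  show "length i \<le> 2 * KK n \<Longrightarrow> cval W True (nat_bits n) g i h ChI = bval i div 2 ^ KK n"
    using cval_ChI_True[of i W "nat_bits n" g h] w by simp
  show "length h = length g \<Longrightarrow> t < W \<Longrightarrow> cval W f (nat_bits n) g i h (ChH t) = track W (KK n) h t"
    using cval_ChH[of t W h "nat_bits n" g] w l by simp
qed

lemma fmt_iff: "h = [] \<Longrightarrow> fmt W c0 (nat_bits n) g i h \<longleftrightarrow> length g = W * KK n"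
  by (simp add: fmt_def KK_def)

text \<open>A string of the right length is determined by its tracks, so equality with a gate name
  turns into equations that an automaton can check.\<close>

lemma nm_eq_iff:
  assumes "length h = W * KK n" "p \<in> subs p0" "\<forall>v<r. s v < 2 ^ KK n"
  shows "h = nm n (p, s) \<longleftrightarrow> track W (KK n) h r = code p \<and> (\<forall>t<r. track W (KK n) h t = s t)" (is "_ \<longleftrightarrow> ?R")
proof
  assume "h = nm n (p, s)"
  then show ?R using track_nm[OF assms(2,3)] is_gateD[OF is_gate_nm[OF assms(2,3)]] node_nm[OF assms(2,3)] by auto
next
  assume ?R
  then have "gate_name W (KK n) (track W (KK n) h) = nm n (p, s)"
    by (auto simp: nm_def less_Suc_eq intro!: gate_name_cong)
  then show "h = nm n (p, s)" using gate_name_track[of W h "KK n"] assms(1) by simp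
qed

lemma uniform_outgate: "dlogtime_decidable 1 {(n, [outgate (circ n)]) | n. True}"
proof -
  have "dlogtime_decidable 1 {(n, [g]) | n g. g = nm n (p0, \<lambda>_. 0)}"
  proof (rule regular_dlogtime_1)
    show "regular W (\<lambda>n g i h. fmt W c0 n g i h \<and> cval W False n g i h (ChG r) = code p0 \<and>
        (\<forall>t\<in>{..<r}. cval W False n g i h (ChG t) = 0))"
      by (intro regular_conj regular_fmt regular_ball regular_ch_eq_const) auto
    show "g = nm n (p0, \<lambda>_. 0) \<longleftrightarrow> fmt W c0 (nat_bits n) g [] [] \<and>
        cval W False (nat_bits n) g [] [] (ChG r) = code p0 \<and>
        (\<forall>t\<in>{..<r}. cval W False (nat_bits n) g [] [] (ChG t) = 0)" for n g
      using nm_eq_iff[of g n p0 "\<lambda>_. 0"] is_gateD[OF is_gate_nm[of p0 "\<lambda>_. 0" n]]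
      by (auto simp: fmt_iff fmt_cval)
  qed simp
  then show ?thesis by (simp add: circ_def)
qed

text \<open>Only for the atoms \<open>Lin\<close> and \<open>Inp\<close> does the type of a gate
  vary with its assignment, and there a linear comparison of tracks decides.\<close>

lemma regular_kind:
  assumes p: "p \<in> subs p0" and t: "t \<in> {NotG, AndG, OrG} \<union> range OracleG"
  shows "\<exists>P. regular W P \<and> (\<forall>n g. length g = W * KK n \<longrightarrow>
    P (nat_bits n) g [] [] = (gate_kind (KK n) n p (track W (KK n) g) = t))"
proof -
  have w: "wfm k r p" using subs_wfm[OF p wf] .
  have const: "\<exists>P. regular W P \<and> (\<forall>n g. length g = W * KK n \<longrightarrow> P (nat_bits n) g [] [] = (ty = t))" for ty
    by (intro exI[of _ "\<lambda>n g i h. ty = t"] conjI regular_const) auto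
  show ?thesis
  proof (cases p)
    case (Lin ts a d e)
    let ?ts = "map (\<lambda>(c, v). (c, ChG v)) ts @ [(a, ChN)]"
    define L where "L = (\<lambda>n g i h. (\<Sum>(c, ch)\<leftarrow>?ts. c * int (cval W False n g i h ch)) + d \<ge> e * 2 ^ width W n g h)"
    have L: "regular W L" unfolding L_def by (rule regular_lin_ge)
    have "L (nat_bits n) g [] [] = lin (KK n) n ts a d e (track W (KK n) g)" if "length g = W * KK n" for n g
    proof -
      have f: "fmt W c0 (nat_bits n) g [] []" using that by (simp add: fmt_iff)
      have "(\<Sum>(c, ch)\<leftarrow>map (\<lambda>(c, v). (c, ChG v)) ts. c * int (cval W False (nat_bits n) g [] [] ch))
         = (\<Sum>(c, v)\<leftarrow>ts. c * int (track W (KK n) g v))"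
        using w unfolding Lin by (induction ts) (auto simp: fmt_cval(4)[OF f])
      then show ?thesis
        by (simp add: L_def lin_def fmt_cval(1,3)[OF f])
    qed
    then show ?thesis
      using regular_conj[OF L regular_const[of W "t = AndG"]]
        regular_conj[OF regular_not[OF L] regular_const[of W "t = OrG"]] t
      by (intro exI[of _ "\<lambda>n g i h. L n g i h \<and> t = AndG \<or> \<not> L n g i h \<and> t = OrG"] conjI regular_disj)
        (auto simp: Lin)
  next
    case (Inp v)
    have v: "v < W" using w Inp by simp
    show ?thesis
      using t v
      by (intro exI[of _ "\<lambda>n g i h. \<not> cval W False n g i h (ChG v) < cval W False n g i h ChN \<and> t = OrG"] conjI
          regular_conj regular_not regular_ch_less regular_const)
        (auto simp: Inp fmt_iff fmt_cval)
  qed (use const in auto)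
qed

lemma uniform_kind:
  assumes t: "t \<in> {NotG, AndG, OrG} \<union> range OracleG"
  shows "dlogtime_decidable 1 {(n, [g]) | n g. g \<in> gates (circ n) \<and> gtype (circ n) g = t}"
proof -
  obtain P where P: "\<And>p. p \<in> subs p0 \<Longrightarrow> regular W (P p)"
    "\<And>p n g. p \<in> subs p0 \<Longrightarrow> length g = W * KK n \<Longrightarrow>
      P p (nat_bits n) g [] [] = (gate_kind (KK n) n p (track W (KK n) g) = t)"
    using regular_kind[OF _ t] by metis
  show ?thesis
  proof (rule regular_dlogtime_1)
    show "regular W (\<lambda>n g i h. fmt W c0 n g i h \<and> (\<exists>p\<in>subs p0. cval W False n g i h (ChG r) = code p \<and> P p n g i h))"
      by (intro regular_conj regular_fmt regular_bex regular_ch_eq_const P finite_subs) auto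
    show "g \<in> gates (circ n) \<and> gtype (circ n) g = t \<longleftrightarrow> fmt W c0 (nat_bits n) g [] [] \<and>
        (\<exists>p\<in>subs p0. cval W False (nat_bits n) g [] [] (ChG r) = code p \<and> P p (nat_bits n) g [] [])" for n g
      by (auto simp: circ_def is_gate_def fmt_iff fmt_cval P node_eq)
  qed simp
qed

lemma regular_index:
  "regular W (\<lambda>n g i h. fmt W c0 n g i h \<and> length i \<le> 2 * width W n g h \<and> (i = [] \<or> last i))"
  by (rule regular_conj[OF regular_fmt regular_canonical]) simp

lemma index_iff:
  assumes "fmt W c0 (nat_bits n) g i h"
  shows "length i \<le> 2 * width W (nat_bits n) g h \<and> (i = [] \<or> last i) \<longleftrightarrow> (\<exists>j<2 ^ (2 * KK n). i = nat_bits j)"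
proof -
  have w: "width W (nat_bits n) g h = KK n" using fmt_cval(1)[OF assms] .
  show ?thesis
  proof
    assume i: "length i \<le> 2 * width W (nat_bits n) g h \<and> (i = [] \<or> last i)"
    then have "bval i < 2 ^ (2 * KK n)"
      using bval_less[of i] power_increasing[of "length i" "2 * KK n" "2::nat"] w by linarith
    then show "\<exists>j<2 ^ (2 * KK n). i = nat_bits j"
      using nat_bits_bval[of i] i by (intro exI[of _ "bval i"]) auto
  next
    assume "\<exists>j<2 ^ (2 * KK n). i = nat_bits j"
    then show "length i \<le> 2 * width W (nat_bits n) g h \<and> (i = [] \<or> last i)"
      using nat_bits_length_le nat_bits_last w by auto
  qed
qed

lemma uniform_input:
  "dlogtime_decidable 2 {(n, [g, nat_bits j]) | n g j. g \<in> gates (circ n) \<and> gtype (circ n) g = InputG j}"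
proof -
  define V where "V = {v. v < r \<and> Inp v \<in> subs p0}"
  have V: "Inp v \<in> subs p0 \<longleftrightarrow> v \<in> V" for v
    using subs_wfm[of "Inp v", OF _ wf] by (auto simp: V_def)
  \<comment> \<open>The high half of \<open>i\<close> must vanish and its low half must equal the
    track of the variable; together with the canonical form this makes \<open>i\<close> the numeral
    of the input position.\<close>
  let ?P = "\<lambda>n g i h. (fmt W c0 n g i h \<and> length i \<le> 2 * width W n g h \<and> (i = [] \<or> last i)) \<and>
      (\<exists>v\<in>V. cval W False n g i h (ChG r) = code (Inp v) \<and> cval W False n g i h (ChG v) < cval W False n g i h ChN \<and>
        cval W False n g i h ChI = cval W False n g i h (ChG v) \<and> cval W True n g i h ChI = 0)"
  have gk: "gate_kind K n p s = InputG j \<longleftrightarrow> (\<exists>v. p = Inp v \<and> s v < n \<and> j = s v)" for K n p s j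
    by (cases p) auto
  have "dlogtime_decidable 2 {(n, [g, i]) | n g i. is_gate n g \<and>
    (\<exists>v. node n g = Inp v \<and> track W (KK n) g v < n \<and> i = nat_bits (track W (KK n) g v))}"
  proof (rule regular_dlogtime_2)
    show "regular W ?P"
      by (intro regular_conj[OF regular_index] regular_bex regular_conj regular_ch_eq_const regular_ch_eq regular_ch_less)
        (auto simp: V_def)
    fix n g i
    have "is_gate n g \<and> (\<exists>v. node n g = Inp v \<and> track W (KK n) g v < n \<and> i = nat_bits (track W (KK n) g v)) \<longleftrightarrow>
      length g = W * KK n \<and> (\<exists>v\<in>V. track W (KK n) g r = code (Inp v) \<and> track W (KK n) g v < n \<and>
        i = nat_bits (track W (KK n) g v))"
      using is_gateD[of n g] V node_eq by (auto simp: is_gate_def) metis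
    also have "\<dots> \<longleftrightarrow> ?P (nat_bits n) g i []"
    proof (cases "length g = W * KK n")
      case True
      then have f: "fmt W c0 (nat_bits n) g i []" by (simp add: fmt_iff)
      have e: "i = nat_bits a \<longleftrightarrow> (\<exists>j<2 ^ (2 * KK n). i = nat_bits j) \<and> bval i mod 2 ^ KK n = a \<and> bval i div 2 ^ KK n = 0"
        if "a < 2 ^ KK n" for a
      proof -
        have "a < 2 ^ (2 * KK n)" using that power_increasing[of "KK n" "2 * KK n" "2::nat"] by linarith
        then show ?thesis using that by (auto simp: div_eq_0_iff)
      qed
      have l: "cval W True (nat_bits n) g i [] ChI = bval i div 2 ^ KK n" if "i = nat_bits j" "j < 2 ^ (2 * KK n)" for j
        using fmt_cval(6)[OF f] that nat_bits_length_le by auto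
      show ?thesis
        unfolding index_iff[OF f]
        using True f e[OF track_less[of W "KK n" g]] l
        by (auto simp: fmt_cval(2-5)[OF f] V_def less_SucI)
    next
      case False
      then show ?thesis using fmt_iff[of "[]" n g i] by auto
    qed
    finally show "is_gate n g \<and> (\<exists>v. node n g = Inp v \<and> track W (KK n) g v < n \<and> i = nat_bits (track W (KK n) g v)) \<longleftrightarrow>
      ?P (nat_bits n) g i []" .
  qed simp
  also have "{(n, [g, i]) | n g i. is_gate n g \<and>
      (\<exists>v. node n g = Inp v \<and> track W (KK n) g v < n \<and> i = nat_bits (track W (KK n) g v))} =
    {(n, [g, nat_bits j]) | n g j. g \<in> gates (circ n) \<and> gtype (circ n) g = InputG j}"
    by (auto simp: circ_def gk)
  finally show ?thesis .
qed

definition same :: "nat set \<Rightarrow> (nat \<Rightarrow> nat) \<Rightarrow> (nat \<Rightarrow> nat) \<Rightarrow> bool" where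
  "same S s s' \<longleftrightarrow> (\<forall>t\<in>{..<r} - S. s' t = s t)"

text \<open>Says that the gate with tracks \<open>s'\<close> is input number
  \<open>hi * 2 ^ K + lo\<close> of the gate for the given formula and \<open>s\<close>, by
  comparisons of tracks only; \<open>conn_iff\<close> ties it to \<open>gate_args\<close>.\<close>

fun conn :: "nat \<Rightarrow> fm \<Rightarrow> (nat \<Rightarrow> nat) \<Rightarrow> nat \<Rightarrow> nat \<Rightarrow> (nat \<Rightarrow> nat) \<Rightarrow> bool" where
  "conn n (Neg p) s lo hi s' \<longleftrightarrow> lo = 0 \<and> hi = 0 \<and> s' r = code p \<and> same {} s s'"
| "conn n (Conj p q) s lo hi s' \<longleftrightarrow> hi = 0 \<and> (lo = 0 \<and> s' r = code p \<or> lo = 1 \<and> s' r = code q) \<and> same {} s s'"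
| "conn n (Ex v p) s lo hi s' \<longleftrightarrow> hi = 0 \<and> s' v = lo \<and> s' r = code p \<and> same {v} s s'"
| "conn n (Orc j u w p) s lo hi s' \<longleftrightarrow> hi < n \<and> s' u = lo \<and> s' w = hi \<and> s' r = code p \<and> same {u, w} s s'"
| "conn n p s lo hi s' \<longleftrightarrow> False"

lemma index_cases:
  "(b \<and> a) = c \<Longrightarrow> (a \<and> b \<and> x) = (c \<and> x)"
  "(hi \<and> a) = c \<Longrightarrow> (hi \<and> b) = d \<Longrightarrow>
    (hi \<and> (a \<and> x \<or> b \<and> y) \<and> z) = (c \<and> x \<and> z \<or> d \<and> y \<and> z)"
  by blast+

lemma conn_iff:
  assumes p: "p \<in> subs p0" and g: "length g = W * KK n" and h: "length h = W * KK n"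
  shows "conn n p (track W (KK n) g) (j mod 2 ^ KK n) (j div 2 ^ KK n) (track W (KK n) h) \<longleftrightarrow>
    j < length (gate_args (KK n) n p (track W (KK n) g)) \<and> h = nm n (gate_args (KK n) n p (track W (KK n) g) ! j)"
    (is "conn n p ?s ?lo ?hi ?s' \<longleftrightarrow> _")
proof -
  have s: "\<forall>v<r. ?s v < 2 ^ KK n" using track_less by blast
  have w: "wfm k r p" using subs_wfm[OF p wf] .
  have eq: "h = nm n (q, t) \<longleftrightarrow> ?s' r = code q \<and> (\<forall>v<r. ?s' v = t v)"
    if "q \<in> subs p" "\<forall>v<r. t v < 2 ^ KK n" for q t
    using nm_eq_iff[OF h, of q t] subs_trans[OF p] that by auto
  have small: "?hi = 0 \<and> ?lo = a \<longleftrightarrow> j = a" if "a < 2 ^ KK n" for a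
    using that by (auto simp: div_eq_0_iff)
  have pow_pos: "0 < (2::nat) ^ KK n" by simp
  have K1: "1 < (2::nat) ^ KK n" using c0 by (intro one_less_power) (auto simp: KK_def)
  show ?thesis
  proof (cases p)
    case (Neg q)
    have e: "h = nm n (q, ?s) \<longleftrightarrow> ?s' r = code q \<and> same {} ?s ?s'"
      using eq[OF _ s, of q] unfolding Neg same_def by auto
    have "conn n p ?s ?lo ?hi ?s' \<longleftrightarrow> j = 0 \<and> h = nm n (q, ?s)"
      unfolding Neg conn.simps e by (rule index_cases(1)[OF small[OF pow_pos]])
    also have "\<dots> \<longleftrightarrow> j < length (gate_args (KK n) n p ?s) \<and> h = nm n (gate_args (KK n) n p ?s ! j)"
      unfolding Neg by auto
    finally show ?thesis .
  next
    case (Conj q q')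
    have e: "h = nm n (a, ?s) \<longleftrightarrow> ?s' r = code a \<and> same {} ?s ?s'" if "a = q \<or> a = q'" for a
      using eq[OF _ s, of a] that unfolding Conj same_def by auto
    have "conn n p ?s ?lo ?hi ?s' \<longleftrightarrow> j = 0 \<and> h = nm n (q, ?s) \<or> j = 1 \<and> h = nm n (q', ?s)"
      unfolding Conj conn.simps e[OF disjI1[OF refl]] e[OF disjI2[OF refl]]
      by (rule index_cases(2)[OF small[OF pow_pos] small[OF K1]])
    also have "\<dots> \<longleftrightarrow> j < length (gate_args (KK n) n p ?s) \<and> h = nm n (gate_args (KK n) n p ?s ! j)"
      unfolding Conj by (auto simp: less_Suc_eq)
    finally show ?thesis .
  next
    case (Ex v q)
    then have v: "v < r" using w by simp
    have eq': "a < 2 ^ KK n \<Longrightarrow> h = nm n (q, ?s(v := a)) \<longleftrightarrow> ?s' r = code q \<and> (?s' v = a \<and> same {v} ?s ?s')" for a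
      using eq[of q "?s(v := a)"] s Ex v by (auto simp: same_def)
    have lt: "?hi = 0 \<longleftrightarrow> j < 2 ^ KK n" by (simp add: div_eq_0_iff)
    show ?thesis using eq'[of j] unfolding Ex conn.simps lt by auto
  next
    case (Orc i u w' q)
    then have v: "u < r" "w' < r" "u \<noteq> w'" using w by auto
    have eq': "h = nm n (q, ?s(u := ?lo, w' := ?hi)) \<longleftrightarrow> ?s' r = code q \<and> (?s' u = ?lo \<and> ?s' w' = ?hi \<and> same {u, w'} ?s ?s')"
      if "?hi < n"
      using eq[of q "?s(u := ?lo, w' := ?hi)"] s Orc v that n_KK[of n] by (auto simp: same_def)
    have lt: "?hi < n \<longleftrightarrow> j < 2 ^ KK n * n"
      by (simp add: div_less_iff_less_mult mult.commute)
    show ?thesis using eq' unfolding Orc conn.simps lt by auto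
  qed auto
qed

text \<open>The two passes read \<open>2 * K\<close> digits of an index. These suffice because an
  oracle gate has \<open>2 ^ K * n\<close> inputs with \<open>n < 2 ^ K\<close>, and every other
  gate has at most two or \<open>2 ^ K\<close> of them.\<close>

lemma args_index_less: "j < length (gate_args (KK n) n p s) \<Longrightarrow> j < 2 ^ (2 * KK n)"
proof -
  assume j: "j < length (gate_args (KK n) n p s)"
  have E: "2 ^ KK n * 2 ^ KK n = (2::nat) ^ (2 * KK n)" by (simp flip: power_add add: mult_2)
  have K1: "2 \<le> (2::nat) ^ KK n" using c0 by (cases "KK n") (auto simp: KK_def)
  have "2 \<le> (2::nat) ^ (2 * KK n)" "(2::nat) ^ KK n \<le> 2 ^ (2 * KK n)" "2 ^ KK n * n \<le> 2 ^ (2 * KK n)"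
    using K1 n_KK[of n] unfolding E[symmetric] by (auto intro: order_trans[OF K1])
  then show ?thesis using j by (cases p) (auto elim: less_le_trans)
qed

lemma regular_conn:
  assumes p: "p \<in> subs p0"
  shows "\<exists>P. regular W P \<and> (\<forall>n g i h. fmt W c0 (nat_bits n) g i h \<longrightarrow> length h = length g \<longrightarrow>
    length i \<le> 2 * KK n \<longrightarrow> P (nat_bits n) g i h =
      conn n p (track W (KK n) g) (bval i mod 2 ^ KK n) (bval i div 2 ^ KK n) (track W (KK n) h))"
proof -
  have w: "wfm k r p" using subs_wfm[OF p wf] .
  let ?same = "\<lambda>S n g i h. \<forall>t\<in>{..<r} - S. cval W False n g i h (ChH t) = cval W False n g i h (ChG t)"
  let ?code = "\<lambda>q n g i h. cval W False n g i h (ChH r) = code q"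
  have S: "regular W (?same S)" for S by (intro regular_ball regular_ch_eq) auto
  note R = S regular_conj regular_disj regular_ch_eq_const regular_ch_eq regular_ch_less
  show ?thesis
  proof (cases p)
    case (Neg q)
    show ?thesis
      by (intro exI[of _ "\<lambda>n g i h. cval W False n g i h ChI = 0 \<and> cval W True n g i h ChI = 0 \<and>
          ?code q n g i h \<and> ?same {} n g i h"] conjI R) (auto simp: Neg fmt_cval same_def)
  next
    case (Conj q q')
    show ?thesis
      by (intro exI[of _ "\<lambda>n g i h. cval W True n g i h ChI = 0 \<and>
          (cval W False n g i h ChI = 0 \<and> ?code q n g i h \<or> cval W False n g i h ChI = 1 \<and> ?code q' n g i h) \<and>
          ?same {} n g i h"] conjI R) (auto simp: Conj fmt_cval same_def)
  next
    case (Ex v q)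
    show ?thesis
      by (intro exI[of _ "\<lambda>n g i h. cval W True n g i h ChI = 0 \<and>
          cval W False n g i h (ChH v) = cval W False n g i h ChI \<and> ?code q n g i h \<and>
          ?same {v} n g i h"] conjI R) (use w in \<open>auto simp: Ex fmt_cval same_def\<close>)
  next
    case (Orc j u v q)
    \<comment> \<open>The low half of the index is compared with the track \<open>u\<close> in the
      first pass, the high half with the track \<open>v\<close> and with \<open>n\<close> in the
      second one. This case is the reason for having two passes.\<close>
    show ?thesis
      by (intro exI[of _ "\<lambda>n g i h. cval W True n g i h ChI < cval W True n g i h ChN \<and>
          cval W False n g i h (ChH u) = cval W False n g i h ChI \<and>
          cval W True n g i h (ChH v) = cval W True n g i h ChI \<and> ?code q n g i h \<and>
          ?same {u, v} n g i h"] conjI R) (use w in \<open>auto simp: Orc fmt_cval same_def\<close>)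
  qed (auto intro!: exI[of _ "\<lambda>n g i h. False"] regular_const)
qed

lemma uniform_wires:
  "dlogtime_decidable 3 {(n, [g, nat_bits i, ins (circ n) g ! i]) | n g i.
     g \<in> gates (circ n) \<and> i < length (ins (circ n) g)}" (is "dlogtime_decidable 3 ?R")
proof -
  obtain C where C: "\<And>p. p \<in> subs p0 \<Longrightarrow> regular W (C p)"
    "\<And>p n g i h. p \<in> subs p0 \<Longrightarrow> fmt W c0 (nat_bits n) g i h \<Longrightarrow> length h = length g \<Longrightarrow>
    length i \<le> 2 * KK n \<Longrightarrow> C p (nat_bits n) g i h =
      conn n p (track W (KK n) g) (bval i mod 2 ^ KK n) (bval i div 2 ^ KK n) (track W (KK n) h)"
    using regular_conn by metis
  let ?P = "\<lambda>n g i h. (fmt W c0 n g i h \<and> length i \<le> 2 * width W n g h \<and> (i = [] \<or> last i)) \<and>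
      (fmt W c0 n g i h \<and> length h = length g) \<and>
      (\<exists>p\<in>subs p0. cval W False n g i h (ChG r) = code p \<and> C p n g i h)"
  let ?args = "\<lambda>n g. gate_args (KK n) n (node n g) (track W (KK n) g)"
  have "dlogtime_decidable 3 {(n, [g, i, h]) | n g i h.
    is_gate n g \<and> (\<exists>j<length (?args n g). i = nat_bits j \<and> h = nm n (?args n g ! j))}"
  proof (rule regular_dlogtime_3)
    show "regular W ?P"
      by (intro regular_conj[OF regular_index] regular_conj[OF regular_hfull] regular_bex regular_conj
          regular_ch_eq_const C finite_subs) auto
    fix n g i h
    show "is_gate n g \<and> (\<exists>j<length (?args n g). i = nat_bits j \<and> h = nm n (?args n g ! j)) \<longleftrightarrow> ?P (nat_bits n) g i h"
    proof (cases "length g = W * KK n \<and> length h = W * KK n")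
      case True
      then have f: "fmt W c0 (nat_bits n) g i h" by (simp add: fmt_def KK_def)
      have "?P (nat_bits n) g i h \<longleftrightarrow> (\<exists>j<2 ^ (2 * KK n). i = nat_bits j) \<and>
          (\<exists>p\<in>subs p0. track W (KK n) g r = code p \<and> C p (nat_bits n) g i h)"
        using True f index_iff[OF f] by (simp add: fmt_cval[OF f])
      also have "\<dots> \<longleftrightarrow> (\<exists>j<2 ^ (2 * KK n). i = nat_bits j \<and> (\<exists>p\<in>subs p0. track W (KK n) g r = code p \<and>
          j < length (gate_args (KK n) n p (track W (KK n) g)) \<and>
          h = nm n (gate_args (KK n) n p (track W (KK n) g) ! j)))"
      proof -
        have "C p (nat_bits n) g (nat_bits j) h \<longleftrightarrow> j < length (gate_args (KK n) n p (track W (KK n) g)) \<and>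
          h = nm n (gate_args (KK n) n p (track W (KK n) g) ! j)"
          if "p \<in> subs p0" "j < 2 ^ (2 * KK n)" "i = nat_bits j" for p j
          using C(2)[OF that(1) f] conn_iff[OF that(1), of g n h] True nat_bits_length_le[OF that(2)] that(3) by simp
        then show ?thesis by auto
      qed
      also have "\<dots> \<longleftrightarrow> is_gate n g \<and> (\<exists>j<length (?args n g). i = nat_bits j \<and> h = nm n (?args n g ! j))"
        using True node_eq args_index_less unfolding is_gate_def by (auto; metis)
      finally show ?thesis by blast
    next
      case False
      have "length h = W * KK n" if "is_gate n g" "j < length (?args n g)" "h = nm n (?args n g ! j)" for j
        using that by (auto simp: nm_def split: prod.splits)
      then show ?thesis using False is_gateD[of n g] by (auto simp: fmt_def KK_def)
    qed
  qed simp
  also have "{(n, [g, i, h]) | n g i h. is_gate n g \<and> (\<exists>j<length (?args n g). i = nat_bits j \<and> h = nm n (?args n g ! j))} = ?R"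
    by (auto simp: circ_def nat_bits_inj)
  finally show ?thesis .
qed

lemma uniform_circ: "dlogtime_uniform circ"
  unfolding dlogtime_uniform_def
proof (intro conjI)
  show "\<exists>c. \<forall>n. \<forall>g\<in>gates (circ n). length g \<le> c * (1 + length (nat_bits n))"
    by (intro exI[of _ "W * (c0 + 1)"]) (auto simp: circ_def is_gate_def KK_def algebra_simps)
qed (use uniform_outgate uniform_kind uniform_input uniform_wires in auto)

end

text \<open>The formula has to be right for all large \<open>K\<close>, since \<open>K\<close> is
  fixed only here: \<open>c0\<close> must respect \<open>k0\<close> and also leave room for the
  codes of the subformulas.\<close>

theorem formula_AC0:
  assumes wf: "wfm (length Bs) r p"
    and sat: "\<And>x K. length (nat_bits (length x)) + k0 \<le> K \<Longrightarrow> sat Bs K x p (\<lambda>_. 0) = (x \<in> A)"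
  shows "AC0_reducible A Bs"
proof -
  obtain code where code: "bij_betw code (subs p) {0..<card (subs p)}"
    using ex_bij_betw_finite_nat[OF finite_subs] by blast
  define c0 where "c0 = Suc (k0 + card (subs p))"
  have "card (subs p) < 2 ^ c0"
    by (rule less_le_trans[OF less_exp power_increasing]) (auto simp: c0_def)
  then interpret formula_circuit "length Bs" r c0 p code
    using wf code by unfold_locales (auto simp: bij_betw_def c0_def dest!: equalityD1)
  have "accepts Bs (circ n) x \<longleftrightarrow> x \<in> A" if "length x = n" for n x
  proof -
    have "length (nat_bits (length x)) + k0 \<le> KK n" unfolding KK_def using that by (simp add: c0_def)
    then show ?thesis using circ_accepts[OF that, of Bs] sat by blast
  qed
  then show ?thesis
    unfolding AC0_reducible_def using uniform_circ wf_circ circ_size circ_depth by blast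
qed

section \<open>Definable predicates\<close>

text \<open>The surplus \<open>k0\<close> decides which linear functions of \<open>length x\<close>
  stay within \<open>2 ^ K\<close>, see \<open>length_large\<close>. It may be increased freely, so
  the bounds of several formulas are combined by their maximum.\<close>

definition adm :: "nat \<Rightarrow> nat \<Rightarrow> bool list \<Rightarrow> (nat \<Rightarrow> nat) \<Rightarrow> bool" where
  "adm k0 K x s \<longleftrightarrow> length (nat_bits (length x)) + k0 \<le> K \<and> (\<forall>v. s v < 2 ^ K)"

definition definable :: "bool list set list \<Rightarrow> (nat \<Rightarrow> bool list \<Rightarrow> (nat \<Rightarrow> nat) \<Rightarrow> bool) \<Rightarrow> bool" where
  "definable Bs P \<longleftrightarrow> (\<exists>p k0 r. wfm (length Bs) r p \<and> (\<forall>K x s. adm k0 K x s \<longrightarrow> sat Bs K x p s = P K x s))"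

definition linear :: "(nat \<Rightarrow> bool list \<Rightarrow> (nat \<Rightarrow> nat) \<Rightarrow> nat) \<Rightarrow> bool" where
  "linear f \<longleftrightarrow> (\<exists>ts a d e. \<forall>K x s. int (f K x s) =
     (\<Sum>(c, v)\<leftarrow>ts. c * int (s v)) + a * int (length x) + d + e * 2 ^ K)"

lemma adm_mono: "adm k0 K x s \<Longrightarrow> k1 \<le> k0 \<Longrightarrow> adm k1 K x s"
  by (auto simp: adm_def)

lemma adm_upd: "adm k0 K x s \<Longrightarrow> a < 2 ^ K \<Longrightarrow> adm k0 K x (s(v := a))"
  by (auto simp: adm_def)

lemma adm_length: "adm k0 K x s \<Longrightarrow> length x < 2 ^ K"
  unfolding adm_def by (rule less_le_trans[OF less_nat_bits power_increasing]) auto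

lemma wfm_mono: "wfm k r p \<Longrightarrow> r \<le> r' \<Longrightarrow> wfm k r' p"
  by (induction p) auto

text \<open>Serves where two descriptions agree only once \<open>2 ^ K\<close> is large, for
  instance when a text has to fit into its block.\<close>

lemma definable_cong:
  assumes "definable Bs P" "\<And>K x s. adm k1 K x s \<Longrightarrow> P K x s = Q K x s"
  shows "definable Bs Q"
proof -
  obtain p k0 r where p: "wfm (length Bs) r p" "\<And>K x s. adm k0 K x s \<Longrightarrow> sat Bs K x p s = P K x s"
    using assms(1) unfolding definable_def by blast
  have "adm (max k0 k1) K x s \<Longrightarrow> sat Bs K x p s = Q K x s" for K x s
    using p(2) assms(2) adm_mono[of "max k0 k1" K x s k0] adm_mono[of "max k0 k1" K x s k1] by simp
  then show ?thesis unfolding definable_def using p(1) by blast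
qed

lemma definable_not: "definable Bs P \<Longrightarrow> definable Bs (\<lambda>K x s. \<not> P K x s)"
  unfolding definable_def
proof (elim exE conjE)
  fix p k0 r assume "wfm (length Bs) r p" "\<forall>K x s. adm k0 K x s \<longrightarrow> sat Bs K x p s = P K x s"
  then show "\<exists>p k0 r. wfm (length Bs) r p \<and> (\<forall>K x s. adm k0 K x s \<longrightarrow> sat Bs K x p s = (\<not> P K x s))"
    by (intro exI[of _ "Neg p"] exI[of _ k0] exI[of _ r]) auto
qed

lemma definable_conj:
  assumes "definable Bs P" "definable Bs Q"
  shows "definable Bs (\<lambda>K x s. P K x s \<and> Q K x s)"
proof -
  obtain p k0 r where p: "wfm (length Bs) r p" "\<And>K x s. adm k0 K x s \<Longrightarrow> sat Bs K x p s = P K x s"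
    using assms(1) unfolding definable_def by blast
  obtain q k1 r' where q: "wfm (length Bs) r' q" "\<And>K x s. adm k1 K x s \<Longrightarrow> sat Bs K x q s = Q K x s"
    using assms(2) unfolding definable_def by blast
  have "wfm (length Bs) (max r r') (Conj p q)"
    using wfm_mono[OF p(1), of "max r r'"] wfm_mono[OF q(1), of "max r r'"] by simp
  moreover have "adm (max k0 k1) K x s \<Longrightarrow> sat Bs K x (Conj p q) s = (P K x s \<and> Q K x s)" for K x s
    using p(2) q(2) adm_mono[of "max k0 k1" K x s k0] adm_mono[of "max k0 k1" K x s k1] by simp
  ultimately show ?thesis unfolding definable_def by blast
qed

lemma definable_disj:
  assumes "definable Bs P" "definable Bs Q"
  shows "definable Bs (\<lambda>K x s. P K x s \<or> Q K x s)"
  using definable_not[OF definable_conj[OF definable_not[OF assms(1)] definable_not[OF assms(2)]]] by simp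

lemma definable_imp:
  assumes "definable Bs P" "definable Bs Q"
  shows "definable Bs (\<lambda>K x s. P K x s \<longrightarrow> Q K x s)"
  using definable_disj[OF definable_not[OF assms(1)] assms(2)]
  by (rule definable_cong) auto

lemma definable_iff:
  assumes "definable Bs P" "definable Bs Q"
  shows "definable Bs (\<lambda>K x s. P K x s \<longleftrightarrow> Q K x s)"
  using definable_conj[OF definable_imp[OF assms] definable_imp[OF assms(2,1)]]
  by (rule definable_cong) auto

lemma linear_var: "linear (\<lambda>K x s. s v)"
  unfolding linear_def by (rule exI[of _ "[(1, v)]"], rule exI[of _ 0], rule exI[of _ 0], rule exI[of _ 0]) simp

lemma linear_const: "linear (\<lambda>K x s. c)"
  unfolding linear_def by (rule exI[of _ "[]"], rule exI[of _ 0], rule exI[of _ "int c"], rule exI[of _ 0]) simp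

lemma linear_length: "linear (\<lambda>K x s. length x)"
  unfolding linear_def by (rule exI[of _ "[]"], rule exI[of _ 1], rule exI[of _ 0], rule exI[of _ 0]) simp

lemma linear_pow: "linear (\<lambda>K x s. 2 ^ K)"
  unfolding linear_def by (rule exI[of _ "[]"], rule exI[of _ 0], rule exI[of _ 0], rule exI[of _ 1]) simp

lemma linear_add:
  assumes "linear f" "linear g" shows "linear (\<lambda>K x s. f K x s + g K x s)"
proof -
  obtain ts a d e where "\<And>K x s. int (f K x s) = (\<Sum>(c, v)\<leftarrow>ts. c * int (s v)) + a * int (length x) + d + e * 2 ^ K"
    using assms(1) unfolding linear_def by blast
  moreover obtain ts' a' d' e' where
    "\<And>K x s. int (g K x s) = (\<Sum>(c, v)\<leftarrow>ts'. c * int (s v)) + a' * int (length x) + d' + e' * 2 ^ K"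
    using assms(2) unfolding linear_def by blast
  ultimately have "\<forall>K x s. int (f K x s + g K x s) = (\<Sum>(c, v)\<leftarrow>ts @ ts'. c * int (s v)) + (a + a') * int (length x) +
      (d + d') + (e + e') * 2 ^ K"
    by (auto simp: algebra_simps)
  then show ?thesis unfolding linear_def by blast
qed

lemma linear_mult:
  assumes "linear f" shows "linear (\<lambda>K x s. k * f K x s)"
  by (induction k) (use linear_const[of 0] linear_add[OF assms] in auto)

lemmas linear_intros = linear_var linear_const linear_length linear_pow linear_add linear_mult

lemma vars_bound: "\<exists>r. \<forall>(c, v)\<in>set ts. v < r" for ts :: "(int \<times> nat) list"
proof (induction ts)
  case (Cons t ts)
  then obtain r where "\<forall>(c, v)\<in>set ts. v < r" by blast
  then show ?case by (intro exI[of _ "max r (Suc (snd t))"]) fastforce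
qed simp

lemma definable_less:
  assumes "linear f" "linear g" shows "definable Bs (\<lambda>K x s. f K x s < g K x s)"
proof -
  obtain ts a d e where f: "\<And>K x s. int (f K x s) = (\<Sum>(c, v)\<leftarrow>ts. c * int (s v)) + a * int (length x) + d + e * 2 ^ K"
    using assms(1) unfolding linear_def by blast
  obtain ts' a' d' e' where
    g: "\<And>K x s. int (g K x s) = (\<Sum>(c, v)\<leftarrow>ts'. c * int (s v)) + a' * int (length x) + d' + e' * 2 ^ K"
    using assms(2) unfolding linear_def by blast
  let ?us = "ts' @ map (\<lambda>(c, v). (- c, v)) ts"
  obtain r where r: "\<forall>(c, v)\<in>set ?us. v < r" using vars_bound by blast
  have neg: "(\<Sum>(c, v)\<leftarrow>map (\<lambda>(c, v). (- c, v)) ts. c * int (s v)) = - (\<Sum>(c, v)\<leftarrow>ts. c * int (s v))" for s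
    by (induction ts) auto
  have "f K x s < g K x s \<longleftrightarrow> lin K (length x) ?us (a' - a) (d' - d - 1) (e - e') s" for K x s
  proof -
    have "f K x s < g K x s \<longleftrightarrow> int (f K x s) + 1 \<le> int (g K x s)" by linarith
    also have "\<dots> \<longleftrightarrow> lin K (length x) ?us (a' - a) (d' - d - 1) (e - e') s"
      unfolding f g lin_def sum_list_append map_append neg by (auto simp: algebra_simps)
    finally show ?thesis .
  qed
  then show ?thesis unfolding definable_def
    using r by (intro exI[of _ "Lin ?us (a' - a) (d' - d - 1) (e - e')"] exI[of _ 0] exI[of _ r]) auto
qed

lemma definable_le: "linear f \<Longrightarrow> linear g \<Longrightarrow> definable Bs (\<lambda>K x s. f K x s \<le> g K x s)"
  using definable_not[OF definable_less[of g f Bs]] by (simp add: not_less)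

lemma definable_eq: "linear f \<Longrightarrow> linear g \<Longrightarrow> definable Bs (\<lambda>K x s. f K x s = g K x s)"
  using definable_conj[OF definable_le[of f g Bs] definable_le[of g f Bs]] by (simp add: eq_iff)

lemma definable_const: "definable Bs (\<lambda>K x s. b)"
  using definable_eq[OF linear_const[of 0] linear_const[of "if b then 0 else 1"], of Bs] by (cases b) simp_all

text \<open>The bound value is an argument of \<open>P\<close> of its own, and \<open>fresh\<close>
  says semantically that \<open>P\<close> does not depend on variable \<open>r\<close> otherwise.
  Predicates are thus combined as functions, without substitution in formulas.\<close>

lemma definable_ex:
  assumes "definable Bs (\<lambda>K x s. P K x s (s r))" and fresh: "\<And>K x s a b. P K x (s(r := a)) b = P K x s b"
  shows "definable Bs (\<lambda>K x s. \<exists>a<2 ^ K. P K x s a)"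
proof -
  obtain p k0 r' where p: "wfm (length Bs) r' p" "\<And>K x s. adm k0 K x s \<Longrightarrow> sat Bs K x p s = P K x s (s r)"
    using assms(1) unfolding definable_def by blast
  have "wfm (length Bs) (max r' (Suc r)) (Ex r p)" using wfm_mono[OF p(1)] by simp
  moreover have "sat Bs K x (Ex r p) s = (\<exists>a<2 ^ K. P K x s a)" if "adm k0 K x s" for K x s
    using p(2)[OF adm_upd[OF that]] fresh by auto
  ultimately show ?thesis unfolding definable_def by blast
qed

lemma definable_ex_le:
  assumes "definable Bs (\<lambda>K x s. P K x s (s r))" and fresh: "\<And>K x s a b. P K x (s(r := a)) b = P K x s b"
  shows "definable Bs (\<lambda>K x s. \<exists>a\<le>length x. P K x s a)"
proof -
  have "definable Bs (\<lambda>K x s. \<exists>a<2 ^ K. a \<le> length x \<and> P K x s a)"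
    by (rule definable_ex[of _ _ r])
      (intro definable_conj definable_le linear_intros assms, simp add: fresh)
  then show ?thesis
    by (rule definable_cong[where ?k1.0 = 0]) (meson adm_length order_le_less_trans)
qed

lemma definable_all_le:
  assumes "definable Bs (\<lambda>K x s. P K x s (s r))" and fresh: "\<And>K x s a b. P K x (s(r := a)) b = P K x s b"
  shows "definable Bs (\<lambda>K x s. \<forall>a\<le>length x. P K x s a)"
proof -
  have "definable Bs (\<lambda>K x s. \<not> (\<exists>a\<le>length x. \<not> P K x s a))"
    by (intro definable_not definable_ex_le[of _ "\<lambda>K x s a. \<not> P K x s a" r] assms(1)) (simp add: fresh)
  then show ?thesis by simp
qed

lemma definable_bex:
  assumes "finite A" "\<And>a. a \<in> A \<Longrightarrow> definable Bs (P a)"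
  shows "definable Bs (\<lambda>K x s. \<exists>a\<in>A. P a K x s)"
  using assms
proof (induction A)
  case empty
  then show ?case using definable_const[of Bs False] by simp
next
  case (insert a A)
  then show ?case using definable_disj[of Bs "P a" "\<lambda>K x s. \<exists>a\<in>A. P a K x s"] by simp
qed

lemma definable_ball:
  assumes "finite A" "\<And>a. a \<in> A \<Longrightarrow> definable Bs (P a)"
  shows "definable Bs (\<lambda>K x s. \<forall>a\<in>A. P a K x s)"
  using definable_not[OF definable_bex[OF assms(1) definable_not[OF assms(2)]]] by simp

text \<open>The high part of a position in the oracle string is less than \<open>length x\<close>,
  hence within the range of the variables.\<close>

lemma definable_oracle:
  assumes "definable Bs (\<lambda>K x s. P K x s (s u) (s w))" and "u \<noteq> w" and "j < length Bs"
    and fresh: "\<And>K x s a b c d. P K x (s(u := a, w := b)) c d = P K x s c d"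
  shows "definable Bs (\<lambda>K x s. map (\<lambda>i. P K x s (i mod 2 ^ K) (i div 2 ^ K)) [0..<2 ^ K * length x] \<in> Bs ! j)"
proof -
  obtain p k0 r where p: "wfm (length Bs) r p" "\<And>K x s. adm k0 K x s \<Longrightarrow> sat Bs K x p s = P K x s (s u) (s w)"
    using assms(1) unfolding definable_def by blast
  have "wfm (length Bs) (r + Suc u + Suc w) (Orc j u w p)" using wfm_mono[OF p(1)] assms by simp
  moreover have "sat Bs K x (Orc j u w p) s =
      (map (\<lambda>i. P K x s (i mod 2 ^ K) (i div 2 ^ K)) [0..<2 ^ K * length x] \<in> Bs ! j)" if a: "adm k0 K x s" for K x s
  proof -
    have "sat Bs K x p (s(u := i mod 2 ^ K, w := i div 2 ^ K)) = P K x s (i mod 2 ^ K) (i div 2 ^ K)"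
      if "i < 2 ^ K * length x" for i
    proof -
      have "i div 2 ^ K < 2 ^ K" using div_less_pow[OF that] adm_length[OF a] by simp
      then have "adm k0 K x (s(u := i mod 2 ^ K, w := i div 2 ^ K))" by (intro adm_upd a) auto
      from p(2)[OF this] show ?thesis using fresh \<open>u \<noteq> w\<close> by simp
    qed
    then have "map (\<lambda>i. sat Bs K x p (s(u := i mod 2 ^ K, w := i div 2 ^ K))) [0..<2 ^ K * length x] =
      map (\<lambda>i. P K x s (i mod 2 ^ K) (i div 2 ^ K)) [0..<2 ^ K * length x]" by auto
    then show ?thesis by (simp only: sat.simps)
  qed
  ultimately show ?thesis unfolding definable_def by blast
qed

lemma linear_fresh:
  assumes "linear f" shows "\<exists>r. \<forall>K x s a. f K x (s(r := a)) = f K x s"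
proof -
  obtain ts a d e where f: "\<And>K x s. int (f K x s) = (\<Sum>(c, v)\<leftarrow>ts. c * int (s v)) + a * int (length x) + d + e * 2 ^ K"
    using assms(1) unfolding linear_def by blast
  obtain r where r: "\<forall>(c, v)\<in>set ts. v < r" using vars_bound by blast
  have "(\<Sum>(c, v)\<leftarrow>ts. c * int ((s(r := b)) v)) = (\<Sum>(c, v)\<leftarrow>ts. c * int (s v))" for s b
    using r by (induction ts) auto
  then have "int (f K x (s(r := b))) = int (f K x s)" for K x s b
    unfolding f by presburger
  then show ?thesis using of_nat_eq_iff by blast
qed

text \<open>\<open>Inp\<close> takes a variable, so the value of \<open>f\<close> is first bound to
  one on which \<open>f\<close> does not depend.\<close>

lemma definable_bit:
  assumes "linear f" shows "definable Bs (\<lambda>K x s. f K x s < length x \<and> x ! f K x s)"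
proof -
  obtain r where r: "\<And>K x s a. f K x (s(r := a)) = f K x s" using linear_fresh[OF assms] by blast
  have inp: "definable Bs (\<lambda>K x s. s r < length x \<and> x ! s r)"
    unfolding definable_def by (intro exI[of _ "Inp r"] exI[of _ 0] exI[of _ "Suc r"]) auto
  have "definable Bs (\<lambda>K x s. \<exists>a\<le>length x. a = f K x s \<and> (a < length x \<and> x ! a))"
    by (rule definable_ex_le[of _ _ r]) (intro definable_conj definable_eq linear_var assms inp, simp add: r)
  then show ?thesis by (rule definable_cong) auto
qed

lemma definable_nbit:
  assumes "linear f" shows "definable Bs (\<lambda>K x s. f K x s < length x \<and> \<not> x ! f K x s)"
proof -
  have "definable Bs (\<lambda>K x s. f K x s < length x \<and> \<not> (f K x s < length x \<and> x ! f K x s))"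
    by (intro definable_conj definable_less definable_not definable_bit assms linear_intros)
  then show ?thesis by (rule definable_cong) auto
qed

lemmas definable_intros = definable_conj definable_disj definable_imp definable_not definable_eq definable_le
  definable_less definable_bit definable_nbit linear_intros

theorem definable_AC0:
  assumes "definable Bs (\<lambda>K x s. x \<in> A)" shows "AC0_reducible A Bs"
proof -
  obtain p k0 r where p: "wfm (length Bs) r p" "\<And>K x s. adm k0 K x s \<Longrightarrow> sat Bs K x p s = (x \<in> A)"
    using assms unfolding definable_def by blast
  show ?thesis by (rule formula_AC0[OF p(1), of k0]) (rule p(2), simp add: adm_def)
qed

section \<open>Parsing straight-line programs\<close>

text \<open>Positions count symbols, which consist of two bits each.\<close>

definition bit_at :: "bool list \<Rightarrow> nat \<Rightarrow> bool" where
  "bit_at x t \<longleftrightarrow> 2 * t + 1 < length x \<and> 2 * t < length x \<and> x ! (2 * t)"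

definition one_at :: "bool list \<Rightarrow> nat \<Rightarrow> bool" where
  "one_at x t \<longleftrightarrow> 2 * t + 1 < length x \<and> x ! (2 * t + 1)"

definition hash_at :: "bool list \<Rightarrow> nat \<Rightarrow> bool" where
  "hash_at x t \<longleftrightarrow> (2 * t < length x \<and> \<not> x ! (2 * t)) \<and> (2 * t + 1 < length x \<and> \<not> x ! (2 * t + 1))"

definition semi_at :: "bool list \<Rightarrow> nat \<Rightarrow> bool" where
  "semi_at x t \<longleftrightarrow> (2 * t < length x \<and> \<not> x ! (2 * t)) \<and> (2 * t + 1 < length x \<and> x ! (2 * t + 1))"

text \<open>A run of bit symbols closed by the separator at \<open>e\<close>: a variable name or the
  code of a letter.\<close>

definition field_at :: "bool list \<Rightarrow> nat \<Rightarrow> nat \<Rightarrow> bool" where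
  "field_at x s e \<longleftrightarrow> s \<le> e \<and> (\<forall>t\<le>length x. s \<le> t \<and> t < e \<longrightarrow> bit_at x t) \<and> (hash_at x e \<or> semi_at x e)"

definition rule_at :: "bool list \<Rightarrow> nat \<Rightarrow> bool" where
  "rule_at x s \<longleftrightarrow> 2 * s < length x \<and> (\<exists>t\<le>length x. s = t + 1 \<and> semi_at x t)"

definition pair_at :: "bool list \<Rightarrow> nat \<Rightarrow> nat \<Rightarrow> nat \<Rightarrow> bool" where
  "pair_at x s b c \<longleftrightarrow> (\<exists>e1\<le>length x. \<exists>e2\<le>length x. \<exists>e3\<le>length x. field_at x s e1 \<and> hash_at x e1 \<and> b = e1 + 1 \<and>
     field_at x b e2 \<and> hash_at x e2 \<and> c = e2 + 1 \<and> field_at x c e3 \<and> semi_at x e3)"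

definition letter_at :: "bool list \<Rightarrow> nat \<Rightarrow> bool list \<Rightarrow> bool" where
  "letter_at x s cd \<longleftrightarrow> (\<exists>e1\<le>length x. \<exists>b\<le>length x. \<exists>e2\<le>length x. field_at x s e1 \<and> hash_at x e1 \<and> b = e1 + 1 \<and>
     field_at x b e2 \<and> semi_at x e2 \<and> e2 = b + length cd \<and> (\<forall>k\<in>{..<length cd}. one_at x (b + k) = cd ! k))"

definition match :: "bool list \<Rightarrow> nat \<Rightarrow> nat \<Rightarrow> bool" where
  "match x s t \<longleftrightarrow> (\<exists>d\<le>length x. \<exists>e\<le>length x. \<exists>f\<le>length x. field_at x s e \<and> field_at x t f \<and> e = s + d \<and> f = t + d \<and>
     (\<forall>k\<le>length x. k < d \<longrightarrow> one_at x (s + k) = one_at x (t + k)))"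

text \<open>Leads from the name written at \<open>b\<close> to the start of the rule for this name.
  Positions thereby become the variables of the program.\<close>

definition refers :: "bool list \<Rightarrow> nat \<Rightarrow> nat \<Rightarrow> bool" where
  "refers x b p \<longleftrightarrow> rule_at x p \<and> match x p b"

definition pair_rule :: "bool list \<Rightarrow> nat \<Rightarrow> nat \<Rightarrow> nat \<Rightarrow> bool" where
  "pair_rule x s p q \<longleftrightarrow> (\<exists>b\<le>length x. \<exists>c\<le>length x. pair_at x s b c \<and> refers x b p \<and> refers x c q)"

text \<open>Every requirement on an encoded program except acyclicity. The last clause expresses
  that no variable has two rules.\<close>

definition well_formed :: "bool list set \<Rightarrow> bool list \<Rightarrow> bool" where
  "well_formed cds x \<longleftrightarrow> (\<exists>e\<le>length x. field_at x 0 e \<and> semi_at x e) \<and>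
     (\<exists>p\<le>length x. refers x 0 p) \<and>
     (\<forall>s\<le>length x. rule_at x s \<longrightarrow> (\<exists>p\<le>length x. \<exists>q\<le>length x. pair_rule x s p q) \<or> (\<exists>cd\<in>cds. letter_at x s cd)) \<and>
     (\<forall>s\<le>length x. \<forall>t\<le>length x. rule_at x s \<and> rule_at x t \<and> match x s t \<longrightarrow> s = t)"

context
  fixes Bs :: "bool list set list"
begin

lemma definable_bit_at: "linear f \<Longrightarrow> definable Bs (\<lambda>K x s. bit_at x (f K x s))"
  unfolding bit_at_def by (intro definable_intros)

lemma definable_one_at: "linear f \<Longrightarrow> definable Bs (\<lambda>K x s. one_at x (f K x s))"
  unfolding one_at_def by (intro definable_intros)

lemma definable_hash_at: "linear f \<Longrightarrow> definable Bs (\<lambda>K x s. hash_at x (f K x s))"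
  unfolding hash_at_def by (intro definable_intros)

lemma definable_semi_at: "linear f \<Longrightarrow> definable Bs (\<lambda>K x s. semi_at x (f K x s))"
  unfolding semi_at_def by (intro definable_intros)

lemma definable_field_at: "definable Bs (\<lambda>K x s. field_at x (s i) (s j))"
  unfolding field_at_def
  by (intro definable_all_le[where r = "Suc (i + j)"] definable_intros definable_bit_at definable_hash_at
      definable_semi_at) auto

lemma definable_rule_at: "definable Bs (\<lambda>K x s. rule_at x (s i))"
  unfolding rule_at_def
  by (intro definable_ex_le[where r = "Suc i"] definable_intros definable_semi_at) auto

lemma definable_pair_at: "definable Bs (\<lambda>K x s. pair_at x (s i) (s j) (s k))"
  unfolding pair_at_def
  apply (rule definable_ex_le[where r = "i + j + k + 1"])
   apply (rule definable_ex_le[where r = "i + j + k + 2"])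
    apply (rule definable_ex_le[where r = "i + j + k + 3"])
     apply (intro definable_intros definable_field_at definable_hash_at definable_semi_at)
    apply simp_all
  done

lemma definable_letter_at: "definable Bs (\<lambda>K x s. letter_at x (s i) cd)"
  unfolding letter_at_def
  apply (rule definable_ex_le[where r = "i + 1"])
   apply (rule definable_ex_le[where r = "i + 2"])
    apply (rule definable_ex_le[where r = "i + 3"])
     apply (intro definable_intros definable_ball definable_iff definable_const definable_field_at definable_hash_at
      definable_semi_at definable_one_at finite_lessThan)
    apply simp_all
  done

lemma definable_match: "definable Bs (\<lambda>K x s. match x (s i) (s j))"
  unfolding match_def
  apply (rule definable_ex_le[where r = "i + j + 1"])
   apply (rule definable_ex_le[where r = "i + j + 2"])
    apply (rule definable_ex_le[where r = "i + j + 3"])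
     apply (intro definable_intros definable_field_at definable_all_le[where r = "i + j + 4"] definable_iff
      definable_one_at)
    apply simp_all
  done

lemma definable_refers: "definable Bs (\<lambda>K x s. refers x (s i) (s j))"
  unfolding refers_def by (intro definable_conj definable_rule_at definable_match)

lemma definable_refers_0: "definable Bs (\<lambda>K x s. refers x 0 (s j))"
proof -
  have "definable Bs (\<lambda>K x s. \<exists>b\<le>length x. b = 0 \<and> refers x b (s j))"
    by (rule definable_ex_le[where r = "j + 1"]) (intro definable_intros definable_refers, simp)
  then show ?thesis by simp
qed

lemma definable_pair_rule: "definable Bs (\<lambda>K x s. pair_rule x (s i) (s j) (s k))"
  unfolding pair_rule_def
  apply (rule definable_ex_le[where r = "i + j + k + 1"])
   apply (rule definable_ex_le[where r = "i + j + k + 2"])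
    apply (intro definable_intros definable_pair_at definable_refers)
   apply simp_all
  done

lemma definable_well_formed:
  assumes "finite cds" shows "definable Bs (\<lambda>K x s. well_formed cds x)"
proof -
  have f: "definable Bs (\<lambda>K x s. \<exists>b\<le>length x. \<exists>e\<le>length x. b = 0 \<and> field_at x b e \<and> semi_at x e)"
    apply (rule definable_ex_le[where r = 0])
     apply (rule definable_ex_le[where r = 1])
      apply (intro definable_intros definable_field_at definable_semi_at)
     apply simp_all
    done
  show ?thesis
    unfolding well_formed_def
    apply (intro definable_conj)
       apply (rule definable_cong[OF f])
       apply auto[1]
      apply (rule definable_ex_le[where r = 0])
       apply (rule definable_refers_0)
      apply simp
     apply (rule definable_all_le[where r = 0])
      apply (intro definable_intros definable_rule_at definable_bex definable_letter_at assms)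
      apply (rule definable_ex_le[where r = 1])
       apply (rule definable_ex_le[where r = 2])
        apply (rule definable_pair_rule)
       apply simp_all
    apply (rule definable_all_le[where r = 0])
     apply (rule definable_all_le[where r = 1])
      apply (intro definable_intros definable_rule_at definable_match)
     apply simp_all
    done
qed

end

section \<open>Evaluation of straight-line programs\<close>

definition ranked :: "'v set \<Rightarrow> ('v \<Rightarrow> ('v, 'l) rhs) \<Rightarrow> bool" where
  "ranked V rhs \<longleftrightarrow> (\<exists>f :: 'v \<Rightarrow> nat. \<forall>A\<in>V. \<forall>B\<in>rhs_vars (rhs A). f B < f A)"

text \<open>Given an order, the number of predecessors is a rank; given a rank, an order arises by
  breaking ties with an injection into the numbers. Ranks are easier than orders to carry through
  renamings and translations.\<close>

lemma is_slp_iff: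
  "is_slp L V S rhs \<longleftrightarrow> finite V \<and> S \<in> V \<and>
     (\<forall>A\<in>V. rhs_vars (rhs A) \<subseteq> V \<and> (\<forall>a. rhs A = Letter a \<longrightarrow> a \<in> L)) \<and> ranked V rhs"
    (is "_ \<longleftrightarrow> _ \<and> _ \<and> ?cl \<and> _")
proof -
  have "(\<exists>r. linear_order_on V r \<and> (\<forall>A\<in>V. \<forall>B\<in>rhs_vars (rhs A). (B, A) \<in> r \<and> B \<noteq> A)) \<longleftrightarrow> ranked V rhs"
    if fin: "finite V" and cl: ?cl
  proof
    assume "\<exists>r. linear_order_on V r \<and> (\<forall>A\<in>V. \<forall>B\<in>rhs_vars (rhs A). (B, A) \<in> r \<and> B \<noteq> A)"
    then obtain r where r: "linear_order_on V r" "\<And>A B. A \<in> V \<Longrightarrow> B \<in> rhs_vars (rhs A) \<Longrightarrow> (B, A) \<in> r \<and> B \<noteq> A"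
      by blast
    have tr: "trans r" and an: "antisym r"
      using r(1) by (auto simp: linear_order_on_def partial_order_on_def preorder_on_def)
    define f where "f A = card {B \<in> V. (B, A) \<in> r \<and> B \<noteq> A}" for A
    have "f B < f A" if "A \<in> V" "B \<in> rhs_vars (rhs A)" for A B
      unfolding f_def
    proof (rule psubset_card_mono)
      have BA: "(B, A) \<in> r" "B \<noteq> A" "B \<in> V" using r(2)[OF that] cl that by auto
      then show "{C \<in> V. (C, B) \<in> r \<and> C \<noteq> B} \<subset> {C \<in> V. (C, A) \<in> r \<and> C \<noteq> A}"
        using transD[OF tr] antisymD[OF an] by blast
    qed (use fin in simp)
    then show "ranked V rhs" unfolding ranked_def by blast
  next
    assume "ranked V rhs"
    then obtain f :: "_ \<Rightarrow> nat" where f: "\<And>A B. A \<in> V \<Longrightarrow> B \<in> rhs_vars (rhs A) \<Longrightarrow> f B < f A"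
      unfolding ranked_def by blast
    obtain g :: "_ \<Rightarrow> nat" where g: "inj_on g V"
      using ex_bij_betw_finite_nat[OF fin] by (auto simp: bij_betw_def)
    define r where "r = {(A, B). A \<in> V \<and> B \<in> V \<and> (f A < f B \<or> f A = f B \<and> g A \<le> g B)}"
    have "linear_order_on V r"
      unfolding linear_order_on_def partial_order_on_def preorder_on_def refl_on_def trans_def antisym_def
        total_on_def
      using g by (auto simp: r_def inj_on_def)
    moreover have "\<forall>A\<in>V. \<forall>B\<in>rhs_vars (rhs A). (B, A) \<in> r \<and> B \<noteq> A"
      using f cl by (fastforce simp: r_def)
    ultimately show "\<exists>r. linear_order_on V r \<and> (\<forall>A\<in>V. \<forall>B\<in>rhs_vars (rhs A). (B, A) \<in> r \<and> B \<noteq> A)"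
      by blast
  qed
  then show ?thesis unfolding is_slp_def by blast
qed

text \<open>Evaluates in the group without forming the derived word. Being inductive, it gives at
  most one value in any program, also a cyclic one, and a value to every variable of a closed and
  ranked one.\<close>

inductive evalto :: "('a, 'b) monoid_scheme \<Rightarrow> 'a list \<Rightarrow> ('v \<Rightarrow> ('v, letter) rhs) \<Rightarrow> 'v \<Rightarrow> 'a \<Rightarrow> bool"
  for K gs rhs where
  "rhs A = Letter a \<Longrightarrow> evalto K gs rhs A (letter_val K gs a)"
| "rhs A = Pair B C \<Longrightarrow> evalto K gs rhs B u \<Longrightarrow> evalto K gs rhs C v \<Longrightarrow> evalto K gs rhs A (u \<otimes>\<^bsub>K\<^esub> v)"

definition closed_slp :: "'a list \<Rightarrow> 'v set \<Rightarrow> ('v \<Rightarrow> ('v, letter) rhs) \<Rightarrow> bool" where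
  "closed_slp gs V rhs \<longleftrightarrow>
     (\<forall>A\<in>V. rhs_vars (rhs A) \<subseteq> V \<and> (\<forall>a. rhs A = Letter a \<longrightarrow> a \<in> letters gs))"

lemma closed_slpD:
  assumes "closed_slp gs V rhs" "A \<in> V"
  shows "rhs A = Letter a \<Longrightarrow> a \<in> letters gs" "rhs A = Pair B C \<Longrightarrow> B \<in> V \<and> C \<in> V"
proof -
  have "rhs_vars (rhs A) \<subseteq> V" "\<forall>a. rhs A = Letter a \<longrightarrow> a \<in> letters gs"
    using assms unfolding closed_slp_def by blast+
  then show "rhs A = Letter a \<Longrightarrow> a \<in> letters gs" "rhs A = Pair B C \<Longrightarrow> B \<in> V \<and> C \<in> V" by auto
qed

lemma evalto_unique: "evalto K gs rhs A z \<Longrightarrow> evalto K gs rhs A z' \<Longrightarrow> z = z'"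
proof (induction arbitrary: z' rule: evalto.induct)
  case (1 A a)
  from 1(2,1) show ?case by cases auto
next
  case (2 A B C u v)
  from 2(6,1) show ?case by cases (use 2(4,5) in auto)
qed

lemma evalto_total:
  assumes "closed_slp gs V rhs" "ranked V rhs" "A \<in> V" shows "\<exists>z. evalto K gs rhs A z"
proof -
  obtain f :: "_ \<Rightarrow> nat" where f: "\<And>A B. A \<in> V \<Longrightarrow> B \<in> rhs_vars (rhs A) \<Longrightarrow> f B < f A"
    using assms(2) unfolding ranked_def by blast
  show ?thesis
    using assms(3)
  proof (induction "f A" arbitrary: A rule: less_induct)
    case less
    show ?case
    proof (cases "rhs A")
      case (Letter a)
      then show ?thesis by (auto intro: evalto.intros)
    next
      case (Pair B C)
      then have "B \<in> V" "C \<in> V" "f B < f A" "f C < f A"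
        using less.prems assms(1) f[OF less.prems] by (fastforce simp: closed_slp_def)+
      then show ?thesis using less.hyps Pair by (metis evalto.intros(2))
    qed
  qed
qed

lemma letter_val_closed:
  assumes "group K" "set gs \<subseteq> carrier K" "a \<in> letters gs" shows "letter_val K gs a \<in> carrier K"
proof -
  obtain i e where a: "a = (i, e)" by fastforce
  then have "gs ! i \<in> carrier K" using assms by (auto simp: letters_def)
  then show ?thesis using a group.inv_closed[OF assms(1)] by simp
qed

lemma evalto_closed:
  assumes "group K" "set gs \<subseteq> carrier K" "closed_slp gs V rhs"
  shows "evalto K gs rhs A z \<Longrightarrow> A \<in> V \<Longrightarrow> z \<in> carrier K"
proof (induction rule: evalto.induct)
  case (1 A a)
  then show ?case using letter_val_closed[OF assms(1,2)] closed_slpD(1)[OF assms(3)] by blast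
next
  case (2 A B C u v)
  then show ?case using assms(3) monoid.m_closed[OF group.is_monoid[OF assms(1)]]
    by (fastforce simp: closed_slp_def)
qed

context
  fixes K :: "('a, 'b) monoid_scheme" and gs :: "'a list"
  assumes K: "group K" and gs: "set gs \<subseteq> carrier K"
begin

interpretation K: group K by (rule K)

lemma word_val_closed: "set w \<subseteq> letters gs \<Longrightarrow> word_val K gs w \<in> carrier K"
  using letter_val_closed[OF K gs] by (induction w) (auto simp: word_val_def)

lemma word_val_append:
  "set u \<subseteq> letters gs \<Longrightarrow> set v \<subseteq> letters gs \<Longrightarrow> word_val K gs (u @ v) = word_val K gs u \<otimes>\<^bsub>K\<^esub> word_val K gs v"
proof (induction u)
  case Nil
  then show ?case using word_val_closed[of v] by (simp add: word_val_def)
next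
  case (Cons a u)
  then have "letter_val K gs a \<in> carrier K" "word_val K gs u \<in> carrier K" "word_val K gs v \<in> carrier K"
    using letter_val_closed[OF K gs] word_val_closed by auto
  then show ?case using Cons by (simp add: word_val_def K.m_assoc)
qed

lemma derives_evalto:
  assumes cl: "closed_slp gs V rhs" and A: "A \<in> V"
  shows "(\<exists>w. derives rhs A w \<and> word_val K gs w = z) \<longleftrightarrow> evalto K gs rhs A z"
proof
  have "evalto K gs rhs A (word_val K gs w) \<and> set w \<subseteq> letters gs" if "derives rhs A w" "A \<in> V" for A w
    using that
  proof (induction rule: derives.induct)
    case (1 A a)
    then have a: "a \<in> letters gs" using closed_slpD(1)[OF cl] by blast
    then have "word_val K gs [a] = letter_val K gs a"
      using letter_val_closed[OF K gs] by (simp add: word_val_def)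
    then show ?case using 1 a by (auto intro: evalto.intros)
  next
    case (2 A B C u v)
    then have "B \<in> V" "C \<in> V" using cl by (fastforce simp: closed_slp_def)+
    then show ?case using 2 by (auto simp: word_val_append intro: evalto.intros)
  qed
  then show "\<exists>w. derives rhs A w \<and> word_val K gs w = z \<Longrightarrow> evalto K gs rhs A z" using A by blast
next
  have "\<exists>w. derives rhs A w \<and> word_val K gs w = z \<and> set w \<subseteq> letters gs" if "evalto K gs rhs A z" "A \<in> V" for A z
    using that
  proof (induction rule: evalto.induct)
    case (1 A a)
    then have a: "a \<in> letters gs" using closed_slpD(1)[OF cl] by blast
    then have "word_val K gs [a] = letter_val K gs a"
      using letter_val_closed[OF K gs] by (simp add: word_val_def)
    then show ?case using 1 a by (intro exI[of _ "[a]"]) (auto intro: derives.intros)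
  next
    case (2 A B C u v)
    then have "B \<in> V" "C \<in> V" using cl by (fastforce simp: closed_slp_def)+
    then obtain w w' where "derives rhs B w" "word_val K gs w = u" "set w \<subseteq> letters gs"
      "derives rhs C w'" "word_val K gs w' = v" "set w' \<subseteq> letters gs" using 2 by blast
    then show ?case using 2(1)
      by (intro exI[of _ "w @ w'"]) (auto simp: word_val_append intro: derives.intros)
  qed
  then show "evalto K gs rhs A z \<Longrightarrow> \<exists>w. derives rhs A w \<and> word_val K gs w = z" using A by blast
qed

end

section \<open>Encodings\<close>

lemma enc_bits_Nil [simp]: "enc_bits [] = []"
  and enc_bits_Cons [simp]: "enc_bits (b # w) = True # b # enc_bits w"
  by (auto simp: enc_bits_def)

lemma length_enc_bits [simp]: "length (enc_bits w) = 2 * length w"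
  by (induction w) auto

text \<open>The first bit of a symbol tells digits from separators, so the text itself shows where a
  field ends.\<close>

lemma enc_bits_inj:
  "enc_bits u @ False # r = enc_bits v @ False # r' \<longleftrightarrow> u = v \<and> r = r'"
proof (induction u arbitrary: v)
  case Nil
  then show ?case by (cases v) auto
next
  case (Cons b u)
  then show ?case by (cases v) auto
qed

definition code :: "letter \<Rightarrow> bool list" where
  "code a = (case a of (i, e) \<Rightarrow> e # nat_bits i)"

lemma enc_rhs_Letter: "enc_rhs (Letter a) = enc_bits (code a)"
  by (cases a) (simp add: code_def)

lemma code_inj: "code a = code b \<longleftrightarrow> a = b"
  by (auto simp: code_def nat_bits_inj split: prod.splits)

lemma enc_rhs_inj:
  "enc_rhs R @ False # True # r = enc_rhs R' @ False # True # r' \<longleftrightarrow> R = R' \<and> r = r'"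
  by (cases R; cases R')
    (auto simp del: enc_rhs.simps(1) simp: enc_rhs_Letter enc_hash_def enc_bits_inj code_inj)

definition rule_text :: "bool list \<Rightarrow> (bool list, letter) rhs \<Rightarrow> bool list" where
  "rule_text A R = enc_bits A @ enc_hash @ enc_rhs R @ enc_semi"

lemma rule_text_inj: "rule_text A R @ r = rule_text A' R' @ r' \<longleftrightarrow> A = A' \<and> R = R' \<and> r = r'"
  by (auto simp: rule_text_def enc_hash_def enc_semi_def enc_bits_inj enc_rhs_inj)

lemma rule_text_neq_Nil: "rule_text A R \<noteq> []"
  by (simp add: rule_text_def enc_hash_def)

lemma enc_slp_rule_text:
  "enc_slp As S rhs = enc_bits S @ enc_semi @ concat (map (\<lambda>A. rule_text A (rhs A)) As)"
  by (simp add: enc_slp_def rule_text_def)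

lemma enc_slp_inj:
  assumes "enc_slp As S rhs = enc_slp As' S' rhs'"
  shows "S = S' \<and> As = As' \<and> (\<forall>A\<in>set As. rhs A = rhs' A)"
proof -
  have S: "S = S'" and eq: "concat (map (\<lambda>A. rule_text A (rhs A)) As) = concat (map (\<lambda>A. rule_text A (rhs' A)) As')"
    using assms by (auto simp: enc_slp_rule_text enc_semi_def enc_bits_inj)
  from eq have "As = As' \<and> (\<forall>A\<in>set As. rhs A = rhs' A)"
  proof (induction As arbitrary: As')
    case Nil
    then show ?case using rule_text_neq_Nil by (cases As') auto
  next
    case (Cons A As)
    then show ?case using rule_text_neq_Nil by (cases As') (auto simp: rule_text_inj)
  qed
  then show ?thesis using S by blast
qed

text \<open>Prints a program over any type of variables under the names \<open>nm\<close>. This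
  covers both decoded inputs, whose variables are positions, and queries.\<close>

definition slp_text :: "('v \<Rightarrow> bool list) \<Rightarrow> 'v list \<Rightarrow> 'v \<Rightarrow> ('v \<Rightarrow> ('v, letter) rhs) \<Rightarrow> bool list" where
  "slp_text nm As S rhs = enc_bits (nm S) @ enc_semi @
     concat (map (\<lambda>A. rule_text (nm A) (map_rhs nm id (rhs A))) As)"

lemma rhs_vars_map: "rhs_vars (map_rhs f g R) = f ` rhs_vars R"
  by (cases R) auto

lemma rename_evalto:
  assumes cl: "closed_slp gs V rhs" and rn: "\<And>A. A \<in> V \<Longrightarrow> rhs' (nm A) = map_rhs nm id (rhs A)" and A: "A \<in> V"
    and inj: "inj_on nm V"
  shows "evalto K gs rhs' (nm A) z \<longleftrightarrow> evalto K gs rhs A z"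
proof
  show "evalto K gs rhs' (nm A) z" if "evalto K gs rhs A z"
    using that A
  proof (induction rule: evalto.induct)
    case (1 A a)
    then show ?case using rn by (intro evalto.intros) auto
  next
    case (2 A B C u v)
    then have "B \<in> V" "C \<in> V" using cl by (fastforce simp: closed_slp_def)+
    then show ?case using 2 rn by (intro evalto.intros(2)[of _ _ "nm B" "nm C"]) auto
  qed
next
  have "\<forall>A\<in>V. nm A = A' \<longrightarrow> evalto K gs rhs A z" if "evalto K gs rhs' A' z" for A' z
    using that
  proof (induction rule: evalto.induct)
    case (1 A' a)
    show ?case
    proof safe
      fix A assume A: "A \<in> V" "A' = nm A"
      then have "rhs A = Letter a" using 1 rn[OF A(1)] by (cases "rhs A") auto
      then show "evalto K gs rhs A (letter_val K gs a)" by (rule evalto.intros)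
    qed
  next
    case (2 A' B' C' u v)
    show ?case
    proof safe
      fix A assume A: "A \<in> V" "A' = nm A"
      then obtain B C where BC: "rhs A = Pair B C" "B' = nm B" "C' = nm C"
        using 2(1) rn[OF A(1)] by (cases "rhs A") auto
      then have "B \<in> V" "C \<in> V" using cl A by (fastforce simp: closed_slp_def)+
      then show "evalto K gs rhs A (u \<otimes>\<^bsub>K\<^esub> v)" using 2 BC by (auto intro: evalto.intros)
    qed
  qed
  then show "evalto K gs rhs' (nm A) z \<Longrightarrow> evalto K gs rhs A z" using A by blast
qed

lemma slp_text_CWP:
  assumes K: "group K" "set gs \<subseteq> carrier K" and As: "distinct As" "S \<in> set As" "inj_on nm (set As)"
    and cl: "closed_slp gs (set As) rhs"
  shows "slp_text nm As S rhs \<in> CWP K gs \<longleftrightarrow> ranked (set As) rhs \<and> evalto K gs rhs S \<one>\<^bsub>K\<^esub>"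
proof -
  define rhs1 where "rhs1 = (\<lambda>B. map_rhs nm id (rhs (inv_into (set As) nm B)))"
  have rn: "A \<in> set As \<Longrightarrow> rhs1 (nm A) = map_rhs nm id (rhs A)" for A
    using As(3) by (simp add: rhs1_def)
  have tx: "slp_text nm As S rhs = enc_slp (map nm As) (nm S) rhs1"
    unfolding slp_text_def enc_slp_rule_text using rn by (simp add: comp_def cong: map_cong)
  \<comment> \<open>Stated for every \<open>rhs2\<close> that agrees with the renamed rules, because
    membership in \<open>CWP\<close> yields a right-hand side function that is determined only on
    the names of \<open>As\<close>.\<close>
  have key: "is_slp (letters gs) (nm ` set As) (nm S) rhs2 \<and> evalto K gs rhs2 (nm S) \<one>\<^bsub>K\<^esub> \<and> closed_slp gs (nm ` set As) rhs2
      \<longleftrightarrow> ranked (set As) rhs \<and> evalto K gs rhs S \<one>\<^bsub>K\<^esub>"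
    if rn: "\<And>A. A \<in> set As \<Longrightarrow> rhs2 (nm A) = map_rhs nm id (rhs A)" for rhs2
  proof -
    have let_iff: "map_rhs nm id R = Letter a \<longleftrightarrow> R = Letter a" for R :: "('c, letter) rhs" and a
      by (cases R) auto
    have cl2: "closed_slp gs (nm ` set As) rhs2"
      using cl rn by (auto simp: closed_slp_def rhs_vars_map let_iff)
    have "ranked (nm ` set As) rhs2 \<longleftrightarrow> ranked (set As) rhs"
    proof
      assume "ranked (nm ` set As) rhs2"
      then obtain f :: "_ \<Rightarrow> nat" where "\<forall>A\<in>nm ` set As. \<forall>B\<in>rhs_vars (rhs2 A). f B < f A"
        unfolding ranked_def by blast
      then show "ranked (set As) rhs"
        unfolding ranked_def using rn by (intro exI[of _ "f \<circ> nm"]) (auto simp: rhs_vars_map)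
    next
      assume "ranked (set As) rhs"
      then obtain f :: "_ \<Rightarrow> nat" where f: "\<And>A B. A\<in>set As \<Longrightarrow> B\<in>rhs_vars (rhs A) \<Longrightarrow> f B < f A"
        unfolding ranked_def by blast
      have "f (inv_into (set As) nm B) < f (inv_into (set As) nm (nm A))" if A: "A \<in> set As" and B: "B \<in> rhs_vars (rhs2 (nm A))" for A B
      proof -
        obtain C where C: "C \<in> rhs_vars (rhs A)" "B = nm C" using B rn[OF A] by (auto simp: rhs_vars_map)
        then have "C \<in> set As" using cl A by (auto simp: closed_slp_def)
        then show ?thesis using f[OF A C(1)] C A As(3) by simp
      qed
      then show "ranked (nm ` set As) rhs2"
        unfolding ranked_def by (intro exI[of _ "f \<circ> inv_into (set As) nm"]) auto
    qed
    then show ?thesis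
      using rename_evalto[OF cl rn As(2,3), where K = K and z = "\<one>\<^bsub>K\<^esub>"] cl2 As(2)
      unfolding is_slp_iff by (auto simp: closed_slp_def)
  qed
  show ?thesis
  proof
    assume "slp_text nm As S rhs \<in> CWP K gs"
    then obtain As' S' rhs' w where *: "slp_text nm As S rhs = enc_slp As' S' rhs'" "distinct As'"
      "is_slp (letters gs) (set As') S' rhs'" "derives rhs' S' w" "word_val K gs w = \<one>\<^bsub>K\<^esub>"
      unfolding CWP_def by blast
    from enc_slp_inj[OF *(1)[unfolded tx]]
    have e: "S' = nm S" "As' = map nm As" "\<forall>A\<in>set As. rhs' (nm A) = map_rhs nm id (rhs A)"
      using rn by auto
    have c: "closed_slp gs (set As') rhs'" "S' \<in> set As'" using *(3) by (auto simp: is_slp_def closed_slp_def)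
    have "evalto K gs rhs' S' \<one>\<^bsub>K\<^esub>"
      using iffD1[OF derives_evalto[OF K c, of "\<one>\<^bsub>K\<^esub>"]] *(4,5) by blast
    moreover have "set As' = nm ` set As" using e(2) by simp
    moreover have "\<And>A. A \<in> set As \<Longrightarrow> rhs' (nm A) = map_rhs nm id (rhs A)" using e(3) by blast
    ultimately show "ranked (set As) rhs \<and> evalto K gs rhs S \<one>\<^bsub>K\<^esub>"
      using iffD1[OF key[of rhs']] *(3) c(1) e(1) by metis
  next
    assume "ranked (set As) rhs \<and> evalto K gs rhs S \<one>\<^bsub>K\<^esub>"
    then have k: "is_slp (letters gs) (nm ` set As) (nm S) rhs1" "evalto K gs rhs1 (nm S) \<one>\<^bsub>K\<^esub>"
      "closed_slp gs (nm ` set As) rhs1"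
      using iffD2[OF key[of rhs1]] rn by blast+
    have "nm S \<in> nm ` set As" using As(2) by simp
    then have "\<exists>w. derives rhs1 (nm S) w \<and> word_val K gs w = \<one>\<^bsub>K\<^esub>"
      using iffD2[OF derives_evalto[OF K k(3)]] k(2) by blast
    moreover have "distinct (map nm As)" using As by (simp add: distinct_map)
    ultimately show "slp_text nm As S rhs \<in> CWP K gs"
      unfolding CWP_def mem_Collect_eq
      by (intro exI[of _ "map nm As"] exI[of _ "nm S"] exI[of _ rhs1]) (use k(1) tx in simp)
  qed
qed

section \<open>Correctness of the parser\<close>

lemma nth_enc_bits:
  "k < length w \<Longrightarrow> enc_bits w ! (2 * k) \<and> enc_bits w ! Suc (2 * k) = w ! k"
proof (induction w arbitrary: k)
  case (Cons b w)
  then show ?case by (cases k) auto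
qed simp

context
  fixes x :: "bool list"
begin

text \<open>\<open>drop (2 * s) x\<close> is the rest of the text from symbol \<open>s\<close> on.
  The lemma reads off what the parser predicates see in the first field of this rest.\<close>

lemma drop_field:
  assumes "drop (2 * s) x = enc_bits w @ [False, d] @ r"
  shows "drop (2 * (s + length w + 1)) x = r" "2 * (s + length w) + 1 < length x"
    "hash_at x (s + length w) \<longleftrightarrow> \<not> d" "semi_at x (s + length w) \<longleftrightarrow> d"
    "k < length w \<Longrightarrow> bit_at x (s + k)" "k < length w \<Longrightarrow> one_at x (s + k) = w ! k"
    "k < length w \<Longrightarrow> \<not> semi_at x (s + k)"
proof -
  have len: "length x = 2 * s + 2 * length w + 2 + length r"
    using arg_cong[OF assms, of length] by (simp split: nat_diff_split_asm)
  have "drop (2 * (s + length w + 1)) x = drop (2 * length w + 2) (drop (2 * s) x)"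
    by (simp add: algebra_simps)
  then show "drop (2 * (s + length w + 1)) x = r" using assms by simp
  show l: "2 * (s + length w) + 1 < length x" using len by simp
  have nth: "x ! (2 * s + j) = (enc_bits w @ [False, d] @ r) ! j" if "2 * s + j < length x" for j
    using that assms by (metis add_leD1 less_or_eq_imp_le nth_drop)
  have "x ! (2 * (s + length w)) = False" "x ! (2 * (s + length w) + 1) = d"
    using nth[of "2 * length w"] nth[of "2 * length w + 1"] len by (simp_all add: nth_append algebra_simps)
  then show "hash_at x (s + length w) \<longleftrightarrow> \<not> d" "semi_at x (s + length w) \<longleftrightarrow> d"
    using l by (auto simp: hash_at_def semi_at_def)
  assume k: "k < length w"
  then have "x ! (2 * (s + k)) = True" "x ! (2 * (s + k) + 1) = w ! k"
    using nth[of "2 * k"] nth[of "2 * k + 1"] len nth_enc_bits[OF k]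
    by (simp_all add: nth_append algebra_simps)
  then show "bit_at x (s + k)" "one_at x (s + k) = w ! k" "\<not> semi_at x (s + k)"
    using k len by (auto simp: bit_at_def one_at_def semi_at_def)
qed

lemma field_at_iff:
  "field_at x s e \<longleftrightarrow> (\<exists>w d r. drop (2 * s) x = enc_bits w @ [False, d] @ r \<and> e = s + length w)"
proof
  assume f: "field_at x s e"
  then show "\<exists>w d r. drop (2 * s) x = enc_bits w @ [False, d] @ r \<and> e = s + length w"
  proof (induction "e - s" arbitrary: s)
    case 0
    then have "e = s" "2 * s + 1 < length x" "\<not> x ! (2 * s)" by (auto simp: field_at_def hash_at_def semi_at_def)
    then have "drop (2 * s) x = [False, x ! (2 * s + 1)] @ drop (2 * s + 2) x"
      using Cons_nth_drop_Suc[of "2 * s" x] Cons_nth_drop_Suc[of "2 * s + 1" x] by simp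
    then show ?case using \<open>e = s\<close> by (intro exI[of _ "[]"]) auto
  next
    case (Suc m)
    have e: "2 * e + 1 < length x" "s < e" using Suc by (auto simp: field_at_def hash_at_def semi_at_def)
    then have b: "x ! (2 * s)" "2 * s + 1 < length x"
      using Suc.prems by (auto simp: field_at_def bit_at_def)
    have "field_at x (Suc s) e" using Suc.prems e by (auto simp: field_at_def)
    then obtain w d r where w: "drop (2 * Suc s) x = enc_bits w @ [False, d] @ r" "e = Suc s + length w"
      using Suc.hyps(1)[of "Suc s"] Suc.hyps(2) by (metis Suc_diff_Suc diff_Suc_Suc e(2) nat.inject)
    have "drop (2 * s) x = [True, x ! (2 * s + 1)] @ drop (2 * Suc s) x"
      using b Cons_nth_drop_Suc[of "2 * s" x] Cons_nth_drop_Suc[of "2 * s + 1" x] by simp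
    then show ?case using w by (intro exI[of _ "x ! (2 * s + 1) # w"]) auto
  qed
next
  assume "\<exists>w d r. drop (2 * s) x = enc_bits w @ [False, d] @ r \<and> e = s + length w"
  then obtain w d r where w: "drop (2 * s) x = enc_bits w @ [False, d] @ r" "e = s + length w" by blast
  have "bit_at x t" if "s \<le> t" "t < e" for t
    using drop_field(5)[OF w(1), of "t - s"] that w(2) by auto
  then show "field_at x s e"
    using drop_field(3,4)[OF w(1)] w(2) by (auto simp: field_at_def)
qed

lemma pair_at_iff:
  "pair_at x s b c \<longleftrightarrow> (\<exists>A B C r. drop (2 * s) x = rule_text A (Pair B C) @ r \<and>
     b = s + length A + 1 \<and> c = b + length B + 1)"
proof
  assume "pair_at x s b c"
  then obtain e1 e2 e3 where e: "field_at x s e1" "hash_at x e1" "b = e1 + 1" "field_at x b e2" "hash_at x e2"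
    "c = e2 + 1" "field_at x c e3" "semi_at x e3" unfolding pair_at_def by blast
  obtain A d r where A: "drop (2 * s) x = enc_bits A @ [False, d] @ r" "e1 = s + length A"
    using e(1) unfolding field_at_iff by blast
  obtain B d' r' where B: "drop (2 * b) x = enc_bits B @ [False, d'] @ r'" "e2 = b + length B"
    using e(4) unfolding field_at_iff by blast
  obtain C d'' r'' where C: "drop (2 * c) x = enc_bits C @ [False, d''] @ r''" "e3 = c + length C"
    using e(7) unfolding field_at_iff by blast
  have "drop (2 * s) x = rule_text A (Pair B C) @ r''"
    using A B C e drop_field(1,3)[OF A(1)] drop_field(1,3)[OF B(1)] drop_field(4)[OF C(1)]
    by (auto simp: rule_text_def enc_hash_def enc_semi_def)
  then show "\<exists>A B C r. drop (2 * s) x = rule_text A (Pair B C) @ r \<and> b = s + length A + 1 \<and> c = b + length B + 1"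
    using A B e by blast
next
  assume "\<exists>A B C r. drop (2 * s) x = rule_text A (Pair B C) @ r \<and> b = s + length A + 1 \<and> c = b + length B + 1"
  then obtain A B C r where *: "drop (2 * s) x = rule_text A (Pair B C) @ r" "b = s + length A + 1" "c = b + length B + 1"
    by blast
  have A: "drop (2 * s) x = enc_bits A @ [False, False] @ enc_bits B @ [False, False] @ enc_bits C @ [False, True] @ r"
    using * by (simp add: rule_text_def enc_hash_def enc_semi_def)
  note B = drop_field(1)[OF A, folded *(2)]
  note C = drop_field(1)[OF B, folded *(3)]
  have "field_at x s (s + length A)" "field_at x b (b + length B)" "field_at x c (c + length C)"
    using A B C unfolding field_at_iff by blast+
  moreover have "s + length A \<le> length x" "b + length B \<le> length x" "c + length C \<le> length x"
    using drop_field(2)[OF A] drop_field(2)[OF B] drop_field(2)[OF C] by auto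
  ultimately show "pair_at x s b c"
    unfolding pair_at_def
    using drop_field(3)[OF A] drop_field(3)[OF B] drop_field(4)[OF C] *(2,3) by blast
qed

lemma letter_at_iff:
  "letter_at x s (code a) \<longleftrightarrow> (\<exists>A r. drop (2 * s) x = rule_text A (Letter a) @ r)"
proof
  assume "letter_at x s (code a)"
  then obtain e1 b e2 where e: "field_at x s e1" "hash_at x e1" "b = e1 + 1" "field_at x b e2" "semi_at x e2"
    "e2 = b + length (code a)" "\<forall>k<length (code a). one_at x (b + k) = code a ! k" unfolding letter_at_def by auto
  obtain A d r where A: "drop (2 * s) x = enc_bits A @ [False, d] @ r" "e1 = s + length A"
    using e(1) unfolding field_at_iff by blast
  obtain B d' r' where B: "drop (2 * b) x = enc_bits B @ [False, d'] @ r'" "e2 = b + length B"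
    using e(4) unfolding field_at_iff by blast
  have "B = code a"
    using e(6,7) B(2) drop_field(6)[OF B(1)] by (intro nth_equalityI) auto
  then have "drop (2 * s) x = rule_text A (Letter a) @ r'"
    using A B e drop_field(1,3)[OF A(1)] drop_field(4)[OF B(1)]
    by (auto simp: rule_text_def enc_hash_def enc_semi_def enc_rhs_Letter simp del: enc_rhs.simps)
  then show "\<exists>A r. drop (2 * s) x = rule_text A (Letter a) @ r" by blast
next
  assume "\<exists>A r. drop (2 * s) x = rule_text A (Letter a) @ r"
  then obtain A r where *: "drop (2 * s) x = rule_text A (Letter a) @ r" by blast
  have A: "drop (2 * s) x = enc_bits A @ [False, False] @ enc_bits (code a) @ [False, True] @ r"
    using * by (simp add: rule_text_def enc_hash_def enc_semi_def enc_rhs_Letter del: enc_rhs.simps)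
  note B = drop_field(1)[OF A]
  have "field_at x s (s + length A)" "field_at x (s + length A + 1) (s + length A + 1 + length (code a))"
    using A B unfolding field_at_iff by blast+
  then show "letter_at x s (code a)"
    unfolding letter_at_def
    using drop_field(2,3)[OF A] drop_field(2,4,6)[OF B]
    by (intro exI[of _ "s + length A"] exI[of _ "s + length A + 1"] exI[of _ "s + length A + 1 + length (code a)"])
      auto
qed

lemma match_iff:
  "match x s t \<longleftrightarrow> (\<exists>A d r d' r'. drop (2 * s) x = enc_bits A @ [False, d] @ r \<and> drop (2 * t) x = enc_bits A @ [False, d'] @ r')"
proof
  assume "match x s t"
  then obtain l where l: "field_at x s (s + l)" "field_at x t (t + l)"
    "\<And>k. k \<le> length x \<Longrightarrow> k < l \<Longrightarrow> one_at x (s + k) = one_at x (t + k)" "l \<le> length x"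
    unfolding match_def by auto
  obtain A d r where A: "drop (2 * s) x = enc_bits A @ [False, d] @ r" "l = length A"
    using l(1) unfolding field_at_iff by auto
  obtain B d' r' where B: "drop (2 * t) x = enc_bits B @ [False, d'] @ r'" "l = length B"
    using l(2) unfolding field_at_iff by auto
  have "A = B"
  proof (rule nth_equalityI)
    fix k assume "k < length A"
    then show "A ! k = B ! k"
      using drop_field(6)[OF A(1), of k] drop_field(6)[OF B(1), of k] l(3)[of k] l(4) A B by auto
  qed (use A B in simp)
  then show "\<exists>A d r d' r'. drop (2 * s) x = enc_bits A @ [False, d] @ r \<and> drop (2 * t) x = enc_bits A @ [False, d'] @ r'"
    using A B by blast
next
  assume "\<exists>A d r d' r'. drop (2 * s) x = enc_bits A @ [False, d] @ r \<and> drop (2 * t) x = enc_bits A @ [False, d'] @ r'"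
  then obtain A d r d' r' where A: "drop (2 * s) x = enc_bits A @ [False, d] @ r"
    and B: "drop (2 * t) x = enc_bits A @ [False, d'] @ r'" by blast
  have "field_at x s (s + length A)" "field_at x t (t + length A)" using A B unfolding field_at_iff by auto
  then show "match x s t"
    unfolding match_def
    using drop_field(2,6)[OF A] drop_field(2,6)[OF B]
    by (intro exI[of _ "length A"]) auto
qed

lemma even_rule_text: "\<exists>l>0. length (rule_text A R) = 2 * l"
proof (cases R)
  case (Letter a)
  then show ?thesis
    by (intro exI[of _ "length A + length (code a) + 2"])
      (simp add: rule_text_def enc_hash_def enc_semi_def enc_rhs_Letter del: enc_rhs.simps)
next
  case (Pair B C)
  then show ?thesis
    by (intro exI[of _ "length A + length B + length C + 3"])
      (simp add: rule_text_def enc_hash_def enc_semi_def)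
qed

text \<open>Inside a field there is no semicolon, hence no rule starts there.\<close>

lemma rule_at_field:
  assumes "drop (2 * s) x = enc_bits w @ [False, d] @ r" "rule_at x p" "s < p"
  shows "p = s + length w + 1 \<and> d \<or> s + length w + 1 < p"
proof (rule ccontr)
  assume n: "\<not> (p = s + length w + 1 \<and> d \<or> s + length w + 1 < p)"
  obtain t where t: "p = t + 1" "semi_at x t" using assms(2) unfolding rule_at_def by auto
  have "t \<ge> s" using t assms(3) by simp
  have "\<not> t < s + length w"
  proof
    assume "t < s + length w"
    with \<open>t \<ge> s\<close> have "t - s < length w" by linarith
    from drop_field(7)[OF assms(1) this] show False using t(2) \<open>t \<ge> s\<close> by simp
  qed
  then show False
    using n t drop_field(4)[OF assms(1)] by (cases "t = s + length w") auto
qed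

lemma rule_at_next:
  assumes "drop (2 * s) x = rule_text A R @ r" "2 * l = length (rule_text A R)"
  shows "rule_at x p \<Longrightarrow> s < p \<Longrightarrow> s + l \<le> p"
    "rule_at x (s + l) \<longleftrightarrow> r \<noteq> []" "drop (2 * (s + l)) x = r"
proof -
  obtain w1 r1 where w1: "drop (2 * s) x = enc_bits w1 @ [False, False] @ r1"
    and r1: "r1 = enc_rhs R @ [False, True] @ r" and "w1 = A"
    using assms(1) by (auto simp: rule_text_def enc_hash_def enc_semi_def)
  note d1 = drop_field(1)[OF w1, unfolded r1]
  \<comment> \<open>It suffices to treat the last field of the rule, which starts at
    \<open>t\<close>: the earlier ones are closed by a hash, so no rule starts up to
    \<open>t\<close>.\<close>
  have "\<exists>w t. drop (2 * t) x = enc_bits w @ [False, True] @ r \<and> s + l = t + length w + 1 \<and> t > s \<and>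
      (\<forall>p. rule_at x p \<longrightarrow> s < p \<longrightarrow> t \<le> p \<and> t \<noteq> p)"
  proof (cases R)
    case (Letter a)
    have l: "l = length A + length (code a) + 2" using assms(2)
      unfolding Letter by (simp add: rule_text_def enc_hash_def enc_semi_def enc_rhs_Letter del: enc_rhs.simps)
    show ?thesis
      using d1 l \<open>w1 = A\<close> rule_at_field[OF w1] unfolding Letter enc_rhs_Letter
      by (intro exI[of _ "code a"] exI[of _ "s + length A + 1"]) fastforce
  next
    case (Pair B C)
    have l: "l = length A + length B + length C + 3" using assms(2)
      unfolding Pair by (simp add: rule_text_def enc_hash_def enc_semi_def)
    have d2: "drop (2 * (s + length w1 + 1)) x = enc_bits B @ [False, False] @ enc_bits C @ [False, True] @ r"
      using d1 unfolding Pair by (simp add: enc_hash_def)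
    note d3 = drop_field(1)[OF d2]
    show ?thesis
      using d3 l \<open>w1 = A\<close> rule_at_field[OF w1] rule_at_field[OF d2]
      by (intro exI[of _ C] exI[of _ "s + length w1 + 1 + length B + 1"]) fastforce
  qed
  then obtain w t where w: "drop (2 * t) x = enc_bits w @ [False, True] @ r" "s + l = t + length w + 1"
    and t: "t > s" "\<And>p. rule_at x p \<Longrightarrow> s < p \<Longrightarrow> t \<le> p \<and> t \<noteq> p" by blast
  show "s + l \<le> p" if "rule_at x p" "s < p"
    using rule_at_field[OF w(1) that(1)] t(2)[OF that] w(2) by auto
  show d: "drop (2 * (s + l)) x = r" using drop_field(1)[OF w(1)] w(2) by simp
  show "rule_at x (s + l) \<longleftrightarrow> r \<noteq> []"
    using drop_field(2,4)[OF w(1)] w(2) d by (auto simp: rule_at_def not_le)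
qed

text \<open>Local checks yield a global parse: behind each rule the text ends or another rule
  starts, and the remaining text gets shorter.\<close>

lemma rules_decompose:
  assumes rules: "\<And>s. rule_at x s \<Longrightarrow> \<exists>r. drop (2 * s) x = rule_text (nm s) (R s) @ r"
  shows "drop (2 * s) x = [] \<or> rule_at x s \<Longrightarrow>
    \<exists>Ps. drop (2 * s) x = concat (map (\<lambda>p. rule_text (nm p) (R p)) Ps) \<and> distinct Ps \<and>
      set Ps = {p. rule_at x p \<and> s \<le> p}"
proof (induction "length x - 2 * s" arbitrary: s rule: less_induct)
  case less
  show ?case
  proof (cases "rule_at x s")
    case False
    then have "drop (2 * s) x = []" using less.prems by simp
    moreover then have "{p. rule_at x p \<and> s \<le> p} = {}" by (auto simp: rule_at_def)
    ultimately show ?thesis by (intro exI[of _ "[]"]) simp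
  next
    case True
    obtain r where r: "drop (2 * s) x = rule_text (nm s) (R s) @ r" using rules[OF True] by blast
    obtain l where l: "l > 0" "length (rule_text (nm s) (R s)) = 2 * l" using even_rule_text by blast
    note nx = rule_at_next[OF r l(2)[symmetric]]
    have "2 * s < length x" using True by (simp add: rule_at_def)
    then have "\<exists>Ps. drop (2 * (s + l)) x = concat (map (\<lambda>p. rule_text (nm p) (R p)) Ps) \<and> distinct Ps \<and>
      set Ps = {p. rule_at x p \<and> s + l \<le> p}"
      using l nx by (intro less.hyps) auto
    then obtain Ps where Ps: "r = concat (map (\<lambda>p. rule_text (nm p) (R p)) Ps)" "distinct Ps"
      "set Ps = {p. rule_at x p \<and> s + l \<le> p}" using nx(3) by auto
    have "set (s # Ps) = {p. rule_at x p \<and> s \<le> p}"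
    proof -
      have "p = s \<or> s + l \<le> p" if "rule_at x p" "s \<le> p" for p
        using nx(1)[OF that(1)] that(2) by (cases "p = s") auto
      then show ?thesis using True Ps(3) by auto
    qed
    moreover have "distinct (s # Ps)" using Ps l by auto
    ultimately show ?thesis using r Ps(1) by (intro exI[of _ "s # Ps"]) auto
  qed
qed

text \<open>For a text known to be a concatenation of rules, this ties the positions found by the
  parser to the list of variables, in both directions.\<close>

lemma rules_locate:
  assumes "drop (2 * s) x = concat (map (\<lambda>A. rule_text A (R A)) As)"
  shows "rule_at x p \<Longrightarrow> s \<le> p \<Longrightarrow>
    \<exists>As1 A As2. As = As1 @ A # As2 \<and> drop (2 * p) x = concat (map (\<lambda>A. rule_text A (R A)) (A # As2))"
    "A \<in> set As \<Longrightarrow> rule_at x s \<Longrightarrow> \<exists>p r. rule_at x p \<and> drop (2 * p) x = rule_text A (R A) @ r"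
  using assms
proof (induction As arbitrary: s)
  case Nil
  {
    case 1
    then show ?case by (auto simp: rule_at_def)
  next
    case 2
    then show ?case by simp
  }
next
  case (Cons A' As)
  obtain l where l: "l > 0" "length (rule_text A' (R A')) = 2 * l" using even_rule_text by blast
  {
    case 1
    then have d: "drop (2 * s) x = rule_text A' (R A') @ concat (map (\<lambda>A. rule_text A (R A)) As)" by simp
    note nx = rule_at_next[OF d l(2)[symmetric]]
    show ?case
    proof (cases "p = s")
      case True
      then show ?thesis using 1(3) by blast
    next
      case False
      then have "s + l \<le> p" using nx(1) 1 by simp
      from Cons.IH(1)[OF 1(1) this nx(3)] obtain As1 A As2 where
        "As = As1 @ A # As2" "drop (2 * p) x = concat (map (\<lambda>A. rule_text A (R A)) (A # As2))" by blast
      then show ?thesis by (intro exI[of _ "A' # As1"]) auto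
    qed
  next
    case 2
    then have d: "drop (2 * s) x = rule_text A' (R A') @ concat (map (\<lambda>A. rule_text A (R A)) As)" by simp
    note nx = rule_at_next[OF d l(2)[symmetric]]
    show ?case
    proof (cases "A = A'")
      case True
      then show ?thesis using 2 d by blast
    next
      case False
      then have A: "A \<in> set As" using 2 by simp
      then have "concat (map (\<lambda>A. rule_text A (R A)) As) \<noteq> []" using rule_text_neq_Nil by auto
      then show ?thesis using Cons.IH(2)[OF A _ nx(3)] nx(2) by blast
    qed
  }
qed

lemma refers_iff:
  assumes "drop (2 * b) x = enc_bits B @ [False, d] @ r" "drop (2 * p) x = rule_text A R @ r'"
  shows "refers x b p \<longleftrightarrow> rule_at x p \<and> A = B"
proof -
  have "drop (2 * p) x = enc_bits A @ [False, False] @ enc_rhs R @ enc_semi @ r'"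
    using assms(2) by (simp add: rule_text_def enc_hash_def)
  then show ?thesis
    unfolding refers_def match_iff using assms(1) by (auto simp: enc_bits_inj)
qed

lemma rule_text_pair:
  assumes "drop (2 * s) x = rule_text A (Pair B C) @ r"
  shows "\<exists>b c d d' r r'. pair_at x s b c \<and> drop (2 * b) x = enc_bits B @ [False, d] @ r \<and>
    drop (2 * c) x = enc_bits C @ [False, d'] @ r'"
proof -
  have A: "drop (2 * s) x = enc_bits A @ [False, False] @ enc_bits B @ [False, False] @ enc_bits C @ [False, True] @ r"
    using assms by (simp add: rule_text_def enc_hash_def enc_semi_def)
  note B = drop_field(1)[OF A]
  note C = drop_field(1)[OF B]
  have "pair_at x s (s + length A + 1) (s + length A + 1 + length B + 1)"
    unfolding pair_at_iff using assms by blast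
  then show ?thesis using B C by blast
qed

lemma pair_at_le: "pair_at x s b c \<Longrightarrow> b \<le> length x \<and> c \<le> length x"
  by (auto simp: pair_at_def hash_at_def)

lemma pair_rule_iff:
  assumes "drop (2 * s) x = rule_text A R @ r"
    and "\<And>p. rule_at x p \<Longrightarrow> \<exists>R r. drop (2 * p) x = rule_text (nm p) R @ r"
  shows "pair_rule x s p q \<longleftrightarrow> rule_at x p \<and> rule_at x q \<and> R = Pair (nm p) (nm q)"
proof
  assume "pair_rule x s p q"
  then obtain b c where bc: "pair_at x s b c" "refers x b p" "refers x c q" unfolding pair_rule_def by blast
  obtain A' B C r' where "drop (2 * s) x = rule_text A' (Pair B C) @ r'"
    and b: "b = s + length A' + 1" "c = b + length B + 1" using bc(1) unfolding pair_at_iff by blast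
  then have R: "R = Pair B C" "A' = A" "r' = r" using assms(1) rule_text_inj by metis+
  have E: "drop (2 * s) x = enc_bits A @ [False, False] @ enc_bits B @ [False, False] @ enc_bits C @ [False, True] @ r"
    using assms(1) unfolding R by (simp add: rule_text_def enc_hash_def enc_semi_def)
  note B = drop_field(1)[OF E]
  note C = drop_field(1)[OF B]
  have pq: "rule_at x p" "rule_at x q" using bc unfolding refers_def by auto
  obtain T r1 where "drop (2 * p) x = rule_text (nm p) T @ r1" using assms(2)[OF pq(1)] by blast
  from refers_iff[OF B this] have "nm p = B" using bc(2) b R by simp
  moreover obtain T r1 where "drop (2 * q) x = rule_text (nm q) T @ r1" using assms(2)[OF pq(2)] by blast
  from refers_iff[OF C this] have "nm q = C" using bc(3) b R by simp
  ultimately show "rule_at x p \<and> rule_at x q \<and> R = Pair (nm p) (nm q)" using pq R by simp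
next
  assume pq: "rule_at x p \<and> rule_at x q \<and> R = Pair (nm p) (nm q)"
  then obtain b c d d' r1 r2 where bc: "pair_at x s b c" "drop (2 * b) x = enc_bits (nm p) @ [False, d] @ r1"
    "drop (2 * c) x = enc_bits (nm q) @ [False, d'] @ r2"
    using rule_text_pair assms(1) by blast
  obtain T r3 where "drop (2 * p) x = rule_text (nm p) T @ r3" using assms(2) pq by blast
  from refers_iff[OF bc(2) this] have "refers x b p" using pq by simp
  moreover obtain T r3 where "drop (2 * q) x = rule_text (nm q) T @ r3" using assms(2) pq by blast
  from refers_iff[OF bc(3) this] have "refers x c q" using pq by simp
  ultimately show "pair_rule x s p q" unfolding pair_rule_def using bc(1) pair_at_le by blast
qed

lemma rule_at_le: "rule_at x p \<Longrightarrow> p \<le> length x"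
  by (simp add: rule_at_def)

text \<open>The decoded program has rule positions as variables. The names are recovered as
  \<open>nm\<close>, so the input is itself a printed program and \<open>slp_text_CWP\<close>
  applies to it.\<close>

lemma well_formed_decode:
  assumes wf: "well_formed (code ` letters gs) x"
  shows "\<exists>Ps p0 nm R. x = slp_text nm Ps p0 R \<and> distinct Ps \<and> set Ps = {p. rule_at x p} \<and>
    inj_on nm (set Ps) \<and> p0 \<in> set Ps \<and> closed_slp gs (set Ps) R \<and> (\<forall>q. refers x 0 q \<longleftrightarrow> q = p0) \<and>
    (\<forall>p\<in>set Ps. (\<forall>q r. pair_rule x p q r \<longleftrightarrow> R p = Pair q r) \<and> (\<forall>a. letter_at x p (code a) \<longleftrightarrow> R p = Letter a))"
proof -
  have kinds: "(\<exists>p q. pair_rule x s p q) \<or> (\<exists>a\<in>letters gs. letter_at x s (code a))" if "rule_at x s" for s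
    using wf that rule_at_le[OF that] unfolding well_formed_def by blast
  have "\<exists>A T r. drop (2 * s) x = rule_text A T @ r" if "rule_at x s" for s
    using kinds[OF that] unfolding pair_rule_def pair_at_iff letter_at_iff by blast
  then obtain nm T where nmT: "\<And>s. rule_at x s \<Longrightarrow> \<exists>r. drop (2 * s) x = rule_text (nm s) (T s) @ r"
    by metis
  have pr: "pair_rule x s p q \<longleftrightarrow> rule_at x p \<and> rule_at x q \<and> T s = Pair (nm p) (nm q)" if "rule_at x s" for s p q
    using nmT[OF that] pair_rule_iff[of s "nm s" "T s" _ nm] nmT by blast
  have lt: "letter_at x s (code a) \<longleftrightarrow> T s = Letter a" if "rule_at x s" for s a
    using nmT[OF that] rule_text_inj unfolding letter_at_iff by metis
  obtain S r0 where S: "drop (2 * 0) x = enc_bits S @ [False, True] @ r0"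
  proof -
    obtain e where e: "field_at x 0 e" "semi_at x e" using wf unfolding well_formed_def by blast
    then obtain w d r where "drop (2 * 0) x = enc_bits w @ [False, d] @ r" "e = 0 + length w"
      unfolding field_at_iff by blast
    then show ?thesis using that drop_field(4) e(2) by metis
  qed
  let ?s = "length S + 1"
  have r0: "drop (2 * ?s) x = r0" using drop_field(1)[OF S] by simp
  have "rule_at x ?s" if "r0 \<noteq> []"
    using drop_field(2,4)[OF S] r0 that by (auto simp: rule_at_def not_le)
  then have "drop (2 * ?s) x = [] \<or> rule_at x ?s" unfolding r0 by blast
  from rules_decompose[OF nmT this] obtain Ps where
    Ps: "r0 = concat (map (\<lambda>p. rule_text (nm p) (T p)) Ps)" "distinct Ps" "set Ps = {p. rule_at x p \<and> ?s \<le> p}"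
    unfolding r0 by blast
  have all: "set Ps = {p. rule_at x p}"
    unfolding Ps(3) using rule_at_field[OF S] by (fastforce simp: rule_at_def)
  have ref0: "refers x 0 p \<longleftrightarrow> rule_at x p \<and> nm p = S" for p
    using refers_iff[OF S] nmT unfolding refers_def by blast
  have inj: "inj_on nm (set Ps)"
  proof (rule inj_onI)
    fix s t assume st: "s \<in> set Ps" "t \<in> set Ps" "nm s = nm t"
    then have r: "rule_at x s" "rule_at x t" using all by auto
    then obtain r1 r2 where "drop (2 * s) x = rule_text (nm s) (T s) @ r1" "drop (2 * t) x = rule_text (nm s) (T t) @ r2"
      using nmT st(3) by metis
    then have "match x s t"
      unfolding match_iff rule_text_def enc_hash_def by auto
    then show "s = t" using wf r rule_at_le unfolding well_formed_def by blast
  qed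
  obtain p0 where p0: "rule_at x p0" "nm p0 = S"
    using wf ref0 unfolding well_formed_def by blast
  have "refers x 0 q \<longleftrightarrow> q = p0" for q
    using ref0 p0 inj all by (auto simp: inj_on_def)
  \<comment> \<open>\<open>T\<close> has names on its right-hand sides; \<open>R\<close> has the
    positions of the rules for these names instead.\<close>
  moreover define R where "R = (\<lambda>p. map_rhs (inv_into (set Ps) nm) id (T p))"
  have inv: "p \<in> set Ps \<Longrightarrow> inv_into (set Ps) nm (nm p) = p" for p using inj by simp
  have pR: "pair_rule x p q r \<longleftrightarrow> R p = Pair q r" if p: "p \<in> set Ps" for p q r
  proof
    show "pair_rule x p q r \<Longrightarrow> R p = Pair q r" using pr p all inv by (auto simp: R_def)
  next
    assume R: "R p = Pair q r"
    have "\<not> letter_at x p (code a)" for a using lt p all R by (auto simp: R_def)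
    then obtain q' r' where "pair_rule x p q' r'" using kinds p all by blast
    moreover then have "R p = Pair q' r'" using pr p all inv by (auto simp: R_def)
    ultimately show "pair_rule x p q r" using R by simp
  qed
  have lR: "letter_at x p (code a) \<longleftrightarrow> R p = Letter a" if p: "p \<in> set Ps" for p a
    using lt p all by (cases "T p") (auto simp: R_def)
  have cl: "closed_slp gs (set Ps) R"
    unfolding closed_slp_def
  proof (intro ballI conjI allI impI)
    fix p assume p: "p \<in> set Ps"
    show "rhs_vars (R p) \<subseteq> set Ps"
    proof (cases "R p")
      case (Pair q r)
      then show ?thesis using pR[OF p, of q r] pr p all by auto
    qed simp
    fix a assume "R p = Letter a"
    then show "a \<in> letters gs" using kinds[of p] p all pR[OF p] lR[OF p] by auto
  qed
  have "map_rhs nm id (R p) = T p" if p: "p \<in> set Ps" for p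
  proof (cases "R p")
    case (Letter a)
    then show ?thesis using lR[OF p, of a] lt p all by auto
  next
    case (Pair q r)
    then show ?thesis using pR[OF p, of q r] pr p all by auto
  qed
  then have "slp_text nm Ps p0 R = enc_bits S @ enc_semi @ r0"
    unfolding slp_text_def Ps(1) by (simp add: p0(2) cong: map_cong)
  then have "x = slp_text nm Ps p0 R" using S by (simp add: enc_semi_def)
  ultimately show ?thesis using Ps(2) all inj p0(1) pR lR cl by blast
qed

lemma CWP_well_formed:
  assumes "x \<in> CWP K gs" shows "well_formed (code ` letters gs) x"
proof -
  obtain As S rhs where x: "x = enc_slp As S rhs" and As: "distinct As" and slp: "is_slp (letters gs) (set As) S rhs"
    using assms unfolding CWP_def by blast
  define rest where "rest = concat (map (\<lambda>A. rule_text A (rhs A)) As)"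
  have S: "drop (2 * 0) x = enc_bits S @ [False, True] @ rest"
    by (simp add: x enc_slp_rule_text enc_semi_def rest_def)
  let ?s = "length S + 1"
  have d: "drop (2 * ?s) x = rest" using drop_field(1)[OF S] by simp
  have SAs: "S \<in> set As" using slp by (simp add: is_slp_def)
  then have "rest \<noteq> []" using rule_text_neq_Nil by (auto simp: rest_def)
  then have first: "rule_at x ?s"
    using drop_field(2,4)[OF S] d by (auto simp: rule_at_def not_le)
  note loc = rules_locate[OF d[unfolded rest_def]]
  have pos: "\<exists>p r. rule_at x p \<and> drop (2 * p) x = rule_text A (rhs A) @ r" if "A \<in> set As" for A
    using loc(2)[OF that first] .
  have ex: "\<exists>A\<in>set As. \<exists>r. drop (2 * p) x = rule_text A (rhs A) @ r" if "rule_at x p" for p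
  proof -
    have "?s \<le> p" using rule_at_field[OF S that] that by (fastforce simp: rule_at_def)
    from loc(1)[OF that this] show ?thesis by auto
  qed
  have refd: "\<exists>p\<le>length x. refers x b p" if "drop (2 * b) x = enc_bits A @ [False, d] @ r" "A \<in> set As" for b A d r
    using pos[OF that(2)] refers_iff[OF that(1)] rule_at_le by blast
  have clo: "rhs_vars (rhs A) \<subseteq> set As" "rhs A = Letter a \<Longrightarrow> a \<in> letters gs" if "A \<in> set As" for A a
    using slp that unfolding is_slp_def by blast+
  show ?thesis
    unfolding well_formed_def
  proof (intro conjI allI impI)
    have "field_at x 0 (length S)" unfolding field_at_iff using S by auto
    then show "\<exists>e\<le>length x. field_at x 0 e \<and> semi_at x e"
      using drop_field(2,4)[OF S] by (intro exI[of _ "length S"]) auto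
    show "\<exists>p\<le>length x. refers x 0 p" using refd[OF S SAs] .
  next
    fix s assume s: "rule_at x s"
    then obtain A r where A: "A \<in> set As" "drop (2 * s) x = rule_text A (rhs A) @ r" using ex by blast
    show "(\<exists>p\<le>length x. \<exists>q\<le>length x. pair_rule x s p q) \<or> (\<exists>cd\<in>code ` letters gs. letter_at x s cd)"
    proof (cases "rhs A")
      case (Letter a)
      have "letter_at x s (code a)" unfolding letter_at_iff using A(2) Letter by metis
      then show ?thesis using clo(2)[OF A(1) Letter] by blast
    next
      case (Pair B C)
      then have BC: "B \<in> set As" "C \<in> set As" using clo(1)[OF A(1)] by auto
      from rule_text_pair[OF A(2)[unfolded Pair]] obtain b c d d' r r' where
        bc: "pair_at x s b c" "drop (2 * b) x = enc_bits B @ [False, d] @ r"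
        "drop (2 * c) x = enc_bits C @ [False, d'] @ r'" by blast
      obtain p q where pq: "p \<le> length x" "refers x b p" "q \<le> length x" "refers x c q"
        using refd[OF bc(2) BC(1)] refd[OF bc(3) BC(2)] by blast
      then have "pair_rule x s p q"
        unfolding pair_rule_def using bc(1) pair_at_le[OF bc(1)] by blast
      then show ?thesis using pq by blast
    qed
  next
    fix s t assume "rule_at x s \<and> rule_at x t \<and> match x s t"
    then have st: "rule_at x s" "rule_at x t" "match x s t" by auto
    have le: "?s \<le> s" "?s \<le> t" using rule_at_field[OF S] st by (fastforce simp: rule_at_def)+
    obtain As1 A As2 where A: "As = As1 @ A # As2"
      "drop (2 * s) x = concat (map (\<lambda>A. rule_text A (rhs A)) (A # As2))"
      using loc(1)[OF st(1) le(1)] by blast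
    obtain As1' A' As2' where A': "As = As1' @ A' # As2'"
      "drop (2 * t) x = concat (map (\<lambda>A. rule_text A (rhs A)) (A' # As2'))"
      using loc(1)[OF st(2) le(2)] by blast
    have "drop (2 * s) x = enc_bits A @ [False, False] @ enc_rhs (rhs A) @ enc_semi @ concat (map (\<lambda>A. rule_text A (rhs A)) As2)"
      "drop (2 * t) x = enc_bits A' @ [False, False] @ enc_rhs (rhs A') @ enc_semi @ concat (map (\<lambda>A. rule_text A (rhs A)) As2')"
      using A A' by (auto simp: rule_text_def enc_hash_def)
    then have eqA: "A = A'" using st(3) unfolding match_iff by (auto simp: enc_bits_inj)
    moreover have "A \<notin> set As1" "A \<notin> set As2" using As[unfolded A(1)] by auto
    \<comment> \<open>In a list without repetitions the same variable is followed by the same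
      remaining list, and the length of the remaining text determines the position.\<close>
    ultimately have "As2 = As2'" using A(1) A'(1) append_Cons_eq_iff[of A As1 As2 As1' As2'] by auto
    then have "drop (2 * s) x = drop (2 * t) x" using A(2) A'(2) eqA by simp
    then have "length x - 2 * s = length x - 2 * t" by (metis length_drop)
    moreover have "2 * s < length x" "2 * t < length x" using st by (auto simp: rule_at_def)
    ultimately show "s = t" by linarith
  qed
qed

end

section \<open>Definable strings\<close>

text \<open>The surplus of \<open>a + b\<close> bits contributes a factor
  \<open>2 ^ (a + b)\<close>, which exceeds \<open>a + b\<close>.\<close>

lemma length_large:
  assumes "adm (a + b) K x s" shows "a * length x + b \<le> 2 ^ K"
proof -
  have "a * length x + b \<le> (a + b) * (length x + 1)" by (simp add: algebra_simps)
  also have "\<dots> \<le> 2 ^ (a + b) * 2 ^ length (nat_bits (length x))"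
    by (intro mult_le_mono less_imp_le[OF less_exp]) (use less_nat_bits[of "length x"] in simp)
  also have "\<dots> = 2 ^ (length (nat_bits (length x)) + (a + b))" by (simp add: power_add mult.commute)
  also have "\<dots> \<le> 2 ^ K" by (rule power_increasing) (use assms in \<open>auto simp: adm_def\<close>)
  finally show ?thesis .
qed

definition definable3 :: "bool list set list \<Rightarrow> (nat \<Rightarrow> bool list \<Rightarrow> nat \<Rightarrow> nat \<Rightarrow> nat \<Rightarrow> bool) \<Rightarrow> bool" where
  "definable3 Bs R \<longleftrightarrow> (\<forall>i j v. definable Bs (\<lambda>K x s. R K x (s i) (s j) (s v)))"

text \<open>The length is linear in \<open>length x\<close> and independent of \<open>K\<close>,
  \<open>q\<close> and \<open>p\<close>, so that offsets inside a concatenation are linear terms.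
  Here \<open>q\<close> is a parameter of a whole query and \<open>p\<close> the number of a
  block.\<close>

definition definable_string :: "bool list set list \<Rightarrow> (nat \<Rightarrow> bool list \<Rightarrow> nat \<Rightarrow> nat \<Rightarrow> bool list) \<Rightarrow> bool" where
  "definable_string Bs F \<longleftrightarrow> (\<exists>a b. \<forall>K x q p. length (F K x q p) = a * length x + b) \<and>
     definable3 Bs (\<lambda>K x q p v. v < length (F K x q p) \<and> F K x q p ! v)"

lemma string_Nil: "definable_string Bs (\<lambda>K x q p. [])"
  using definable_const[of Bs False] by (auto simp: definable_string_def definable3_def)

lemma string_append:
  assumes "definable_string Bs F" "definable_string Bs F'"
  shows "definable_string Bs (\<lambda>K x q p. F K x q p @ F' K x q p)"
proof -
  obtain a b where l: "\<And>K x q p. length (F K x q p) = a * length x + b"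
    using assms(1) unfolding definable_string_def by blast
  obtain a' b' where l': "\<And>K x q p. length (F' K x q p) = a' * length x + b'"
    using assms(2) unfolding definable_string_def by blast
  have F: "definable Bs (\<lambda>K x s. s v < a * length x + b \<and> F K x (s i) (s j) ! s v)"
    and F': "definable Bs (\<lambda>K x s. s v < a' * length x + b' \<and> F' K x (s i) (s j) ! s v)" for i j v
    using assms unfolding definable_string_def definable3_def l l' by blast+
  \<comment> \<open>The offset in the second string is a quantified number \<open>c\<close>, since
    truncated subtraction is not linear.\<close>
  have "definable Bs (\<lambda>K x s. (s v < a * length x + b \<and> F K x (s i) (s j) ! s v) \<or>
    (\<exists>c<2 ^ K. s v = a * length x + b + c \<and> (c < a' * length x + b' \<and> F' K x (s i) (s j) ! c)))" for i j v
    by (intro definable_disj F definable_ex[where r = "i + j + v + 1"] definable_conj F' definable_eq linear_intros)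
      auto
  then have "definable Bs (\<lambda>K x s. s v < length (F K x (s i) (s j) @ F' K x (s i) (s j)) \<and>
      (F K x (s i) (s j) @ F' K x (s i) (s j)) ! s v)" for i j v
  proof (rule definable_cong)
    fix K x s assume "adm 0 K x s"
    then have lt: "s v < 2 ^ K" by (simp add: adm_def)
    show "(s v < a * length x + b \<and> F K x (s i) (s j) ! s v \<or>
        (\<exists>c<2 ^ K. s v = a * length x + b + c \<and> c < a' * length x + b' \<and> F' K x (s i) (s j) ! c)) =
       (s v < length (F K x (s i) (s j) @ F' K x (s i) (s j)) \<and> (F K x (s i) (s j) @ F' K x (s i) (s j)) ! s v)"
    proof (cases "s v < a * length x + b")
      case False
      then have ex: "(\<exists>c<2 ^ K. s v = a * length x + b + c \<and> Q c) \<longleftrightarrow> Q (s v - (a * length x + b))" for Q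
        using lt by (metis add_diff_cancel_left' le_add_diff_inverse less_imp_diff_less not_less)
      show ?thesis
        unfolding ex using False by (auto simp: nth_append l l')
    qed (auto simp: nth_append l l')
  qed
  moreover have "\<forall>K x q p. length (F K x q p @ F' K x q p) = (a + a') * length x + (b + b')"
    by (simp add: l l' algebra_simps)
  ultimately show ?thesis unfolding definable_string_def definable3_def by blast
qed

lemma string_const: "definable_string Bs (\<lambda>K x q p. w)"
proof (induction w)
  case Nil
  then show ?case by (rule string_Nil)
next
  case (Cons b w)
  have "definable Bs (\<lambda>K x s. s v = 0 \<and> b)" for v
    by (intro definable_conj definable_eq linear_intros definable_const)
  then have "definable Bs (\<lambda>K x s. s v < length [b] \<and> [b] ! s v)" for v
    by (rule definable_cong) auto
  then have "definable_string Bs (\<lambda>K x q p. [b])"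
    unfolding definable_string_def definable3_def by (intro conjI exI[of _ 0] exI[of _ 1] allI) auto
  from string_append[OF this Cons] show ?case by simp
qed

lemma string_concat:
  assumes "\<And>j. j \<in> set js \<Longrightarrow> definable_string Bs (F j)"
  shows "definable_string Bs (\<lambda>K x q p. concat (map (\<lambda>j. F j K x q p) js))"
  using assms by (induction js) (auto intro: string_Nil string_append)

lemma nth_enc_bits':
  "v < 2 * length w \<Longrightarrow> enc_bits w ! v \<longleftrightarrow> even v \<or> w ! (v div 2)"
  using nth_enc_bits[of "v div 2" w] by (cases "even v") (auto elim!: oddE evenE)

lemma string_name:
  assumes "definable3 Bs R"
  shows "definable_string Bs (\<lambda>K x q p. enc_bits (map (R K x q p) [0..<a * length x + b]))"
  unfolding definable_string_def definable3_def
proof (intro conjI exI allI)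
  fix i j v
  have R: "definable Bs (\<lambda>K x s. R K x (s i) (s j) (s v))" for i j v using assms unfolding definable3_def by blast
  have "definable Bs (\<lambda>K x s. \<exists>c<2 ^ K. c < a * length x + b \<and> (s v = 2 * c \<or> s v = 2 * c + 1 \<and> R K x (s i) (s j) c))"
    by (intro definable_ex[where r = "i + j + v + 1"] definable_intros R) auto
  then show "definable Bs (\<lambda>K x s. s v < length (enc_bits (map (R K x (s i) (s j)) [0..<a * length x + b])) \<and>
      enc_bits (map (R K x (s i) (s j)) [0..<a * length x + b]) ! s v)"
  proof (rule definable_cong)
    fix K x s assume "adm 0 K x s"
    then have lt: "s v < 2 ^ K" by (simp add: adm_def)
    let ?l = "a * length x + b"
    have "s v < 2 * ?l \<Longrightarrow> enc_bits (map (R K x (s i) (s j)) [0..<?l]) ! s v \<longleftrightarrow>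
        even (s v) \<or> R K x (s i) (s j) (s v div 2)"
      using nth_enc_bits'[of "s v" "map (R K x (s i) (s j)) [0..<?l]"] by auto
    moreover have "(\<exists>c<2 ^ K. c < ?l \<and> (s v = 2 * c \<or> s v = 2 * c + 1 \<and> R K x (s i) (s j) c)) \<longleftrightarrow>
        s v < 2 * ?l \<and> (even (s v) \<or> R K x (s i) (s j) (s v div 2))"
    proof
      assume "\<exists>c<2 ^ K. c < ?l \<and> (s v = 2 * c \<or> s v = 2 * c + 1 \<and> R K x (s i) (s j) c)"
      then show "s v < 2 * ?l \<and> (even (s v) \<or> R K x (s i) (s j) (s v div 2))" by auto
    next
      assume "s v < 2 * ?l \<and> (even (s v) \<or> R K x (s i) (s j) (s v div 2))"
      then show "\<exists>c<2 ^ K. c < ?l \<and> (s v = 2 * c \<or> s v = 2 * c + 1 \<and> R K x (s i) (s j) c)"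
        using lt by (intro exI[of _ "s v div 2"]) (auto elim!: oddE evenE)
    qed
    ultimately show "(\<exists>c<2 ^ K. c < ?l \<and> (s v = 2 * c \<or> s v = 2 * c + 1 \<and> R K x (s i) (s j) c)) =
      (s v < length (enc_bits (map (R K x (s i) (s j)) [0..<?l])) \<and> enc_bits (map (R K x (s i) (s j)) [0..<?l]) ! s v)"
      by auto
  qed
  show "length (enc_bits (map (R K x q p) [0..<a * length x + b])) = (2 * a) * length x + 2 * b" for K x q p
    by simp
qed

section \<open>Query texts\<close>

text \<open>The text of a query is divided into \<open>n\<close> blocks of \<open>2 ^ K\<close> bits each.  A block is filled up with
  the rule of a dummy variable, which has a name of suitable length.\<close>

definition pad :: "nat \<Rightarrow> nat \<Rightarrow> nat \<Rightarrow> bool list" where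
  "pad K l p = rule_text (map ((=) p) [0..<(2 ^ K - l - 6) div 2]) (Letter (0, False))"

lemma code_0: "code (0, False) = [False]"
  by (simp add: code_def nat_bits.simps)

lemma pad_eq: "pad K l p = enc_bits (map ((=) p) [0..<(2 ^ K - l - 6) div 2]) @ [False, False, True, False, False, True]"
  unfolding pad_def rule_text_def enc_rhs_Letter code_0 by (simp add: enc_hash_def enc_semi_def)

text \<open>Besides its name a dummy rule takes 6 bits: a hash, the one-symbol code of the letter
  \<open>(0, False)\<close> and a semicolon. Evenness makes the division by 2 exact.\<close>

lemma pad_length:
  assumes "even l" "l + 6 \<le> 2 ^ K" shows "l + length (pad K l p) = 2 ^ K"
proof -
  have "even ((2::nat) ^ K)" using assms(2) by (cases K) auto
  then have "2 * ((2 ^ K - l - 6) div 2) = 2 ^ K - l - 6" using assms by simp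
  then show ?thesis using assms by (simp add: pad_eq)
qed

text \<open>Set bits within the name are the markers at even offsets and the digit number
  \<open>p\<close>. The last six bits are \<open>[False, False, True, False, False, True]\<close>,
  with ones 4 and 1 places before the end of the block.\<close>

lemma pad_nth:
  assumes l: "even l" "l + 6 \<le> 2 ^ K" and v: "l \<le> v" "v < 2 ^ K"
  shows "pad K l p ! (v - l) \<longleftrightarrow>
    v + 6 < 2 ^ K \<and> ((\<exists>c<2 ^ K. v = l + 2 * c) \<or> v = l + 2 * p + 1) \<or> v + 4 = 2 ^ K \<or> v + 1 = 2 ^ K"
proof -
  let ?w = "map ((=) p) [0..<(2 ^ K - l - 6) div 2]"
  have ev: "even ((2::nat) ^ K)" using l(2) by (cases K) auto
  have len: "2 * length ?w = 2 ^ K - l - 6" using l ev by simp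
  show ?thesis
  proof (cases "v + 6 < 2 ^ K")
    case True
    then have "v - l < 2 * length ?w" using len v by linarith
    then have "pad K l p ! (v - l) \<longleftrightarrow> even (v - l) \<or> p = (v - l) div 2"
      using nth_enc_bits'[of "v - l" ?w] len by (auto simp: pad_eq nth_append)
    also have "\<dots> \<longleftrightarrow> (\<exists>c<2 ^ K. v = l + 2 * c) \<or> v = l + 2 * p + 1"
    proof -
      have "even (v - l) \<longleftrightarrow> (\<exists>c<2 ^ K. v = l + 2 * c)"
      proof
        assume "even (v - l)"
        then obtain c where "v - l = 2 * c" by blast
        then show "\<exists>c<2 ^ K. v = l + 2 * c" using v by (intro exI[of _ c]) auto
      qed auto
      moreover have "p = (v - l) div 2 \<longleftrightarrow> v = l + 2 * p + 1" if "odd (v - l)"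
      proof -
        from that obtain k where "v - l = 2 * k + 1" by (rule oddE)
        then have "v = l + 2 * k + 1" "(v - l) div 2 = k" using v by auto
        then show ?thesis by auto
      qed
      moreover have "v = l + 2 * p + 1 \<Longrightarrow> odd (v - l)" by auto
      ultimately show ?thesis by blast
    qed
    finally show ?thesis using True by auto
  next
    case False
    define d where "d = v + 6 - 2 ^ K"
    have d: "v - l = 2 * length ?w + d" "d < 6" using False len v l unfolding d_def by linarith+
    have v': "v + 6 = 2 ^ K + d" using False unfolding d_def by linarith
    have "pad K l p ! (v - l) = [False, False, True, False, False, True] ! d"
      unfolding d(1) pad_eq by (simp add: nth_append)
    also have "\<dots> \<longleftrightarrow> d = 2 \<or> d = 5" using d(2) by (auto simp: less_Suc_eq numeral_eq_Suc)
    also have "\<dots> \<longleftrightarrow> v + 4 = 2 ^ K \<or> v + 1 = 2 ^ K" using v' by linarith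
    finally show ?thesis using False by auto
  qed
qed

lemma padded_definable:
  assumes "definable_string Bs F" and ev: "\<And>K x q p. even (length (F K x q p))"
  shows "definable3 Bs (\<lambda>K x q p v. (F K x q p @ pad K (length (F K x q p)) p) ! v)"
  unfolding definable3_def
proof (intro allI)
  fix i j v
  obtain a b where l: "\<And>K x q p. length (F K x q p) = a * length x + b"
    using assms(1) unfolding definable_string_def by blast
  have F: "definable Bs (\<lambda>K x s. s v < a * length x + b \<and> F K x (s i) (s j) ! s v)"
    using assms unfolding definable_string_def definable3_def l by blast
  have "definable Bs (\<lambda>K x s. (s v < a * length x + b \<and> F K x (s i) (s j) ! s v) \<or>
     (a * length x + b \<le> s v \<and> (s v + 6 < 2 ^ K \<and> ((\<exists>c<2 ^ K. s v = (a * length x + b) + 2 * c) \<or>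
       s v = (a * length x + b) + 2 * s j + 1) \<or> s v + 4 = 2 ^ K \<or> s v + 1 = 2 ^ K)))"
    by (intro F definable_ex[where r = "v + 1"] definable_intros) auto
  then show "definable Bs (\<lambda>K x s. (F K x (s i) (s j) @ pad K (length (F K x (s i) (s j))) (s j)) ! s v)"
  proof (rule definable_cong[where ?k1.0 = "a + (b + 6)"])
    fix K x s assume A: "adm (a + (b + 6)) K x s"
    let ?l = "a * length x + b"
    have lt: "s v < 2 ^ K" using A by (simp add: adm_def)
    have large: "?l + 6 \<le> 2 ^ K" using length_large[OF A] by simp
    have "even ?l" using ev[of K x 0 0] l by simp
    then show "((s v < ?l \<and> F K x (s i) (s j) ! s v) \<or>
     (?l \<le> s v \<and> (s v + 6 < 2 ^ K \<and> ((\<exists>c<2 ^ K. s v = ?l + 2 * c) \<or>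
       s v = ?l + 2 * s j + 1) \<or> s v + 4 = 2 ^ K \<or> s v + 1 = 2 ^ K))) =
      (F K x (s i) (s j) @ pad K (length (F K x (s i) (s j))) (s j)) ! s v"
      unfolding nth_append l using pad_nth[OF _ large _ lt, of "s j"] by auto
  qed
qed

lemma concat_blocks:
  assumes "\<And>p. p < n \<Longrightarrow> length (f p) = N"
  shows "map (\<lambda>i. f (i div N) ! (i mod N)) [0..<N * n] = concat (map f [0..<n])"
  using assms
proof (induction n)
  case (Suc n)
  have "[0..<N * Suc n] = [0..<N * n] @ map (\<lambda>i. i + N * n) [0..<N]"
    using upt_add_eq_append[of 0 "N * n" N] map_add_upt[of "N * n" N] by (simp add: add.commute)
  moreover have "map (\<lambda>i. f ((i + N * n) div N) ! ((i + N * n) mod N)) [0..<N] = f n"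
    using Suc.prems[of n] by (intro nth_equalityI) auto
  ultimately show ?case using Suc by (simp add: comp_def)
qed simp

definition name :: "nat \<Rightarrow> (nat \<Rightarrow> bool) \<Rightarrow> bool list" where
  "name l P = map P [0..<l]"

text \<open>The constants of the table \<open>rs\<close> have the numbers below \<open>length rs\<close>; the \<open>j\<close>-th variable of
  position \<open>p\<close> has number \<open>length rs + m * p + j\<close>.  Names are unary: the only 1 is at the position given
  by the number.\<close>

definition body :: "nat \<Rightarrow> (nat, letter) rhs list \<Rightarrow> nat \<Rightarrow> (nat \<Rightarrow> nat \<Rightarrow> nat \<Rightarrow> bool) \<Rightarrow> (nat \<Rightarrow> nat \<Rightarrow> nat \<Rightarrow> bool) \<Rightarrow>
    nat \<Rightarrow> bool list" where
  "body m rs n B C p = concat (map (\<lambda>j. let l = m * n + length rs in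
     rule_text (name l ((=) (length rs + m * p + j))) (Pair (name l (B j p)) (name l (C j p)))) [0..<m])"

definition header :: "nat \<Rightarrow> (nat, letter) rhs list \<Rightarrow> nat \<Rightarrow> (nat \<Rightarrow> bool) \<Rightarrow> bool list" where
  "header m rs n St = (let l = m * n + length rs in enc_bits (name l St) @ enc_semi @
     concat (map (\<lambda>k. rule_text (name l ((=) k)) (map_rhs (\<lambda>c. name l ((=) c)) id (rs ! k))) [0..<length rs]))"

text \<open>The start variable and the constants share block 0 with its rules. The padding is
  computed from what is already there, so all blocks become equally long.\<close>

definition block :: "nat \<Rightarrow> nat \<Rightarrow> (nat, letter) rhs list \<Rightarrow> nat \<Rightarrow> (nat \<Rightarrow> bool) \<Rightarrow> (nat \<Rightarrow> nat \<Rightarrow> nat \<Rightarrow> bool) \<Rightarrow>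
    (nat \<Rightarrow> nat \<Rightarrow> nat \<Rightarrow> bool) \<Rightarrow> nat \<Rightarrow> bool list" where
  "block K m rs n St B C p = (let w = (if p = 0 then header m rs n St else []) @ body m rs n B C p in
     w @ pad K (length w) p)"

definition query :: "nat \<Rightarrow> nat \<Rightarrow> (nat, letter) rhs list \<Rightarrow> nat \<Rightarrow> (nat \<Rightarrow> bool) \<Rightarrow> (nat \<Rightarrow> nat \<Rightarrow> nat \<Rightarrow> bool) \<Rightarrow>
    (nat \<Rightarrow> nat \<Rightarrow> nat \<Rightarrow> bool) \<Rightarrow> bool list" where
  "query K m rs n St B C = concat (map (block K m rs n St B C) [0..<n])"

lemma even_length_rule_text: "even (length (rule_text A R))"
  using even_rule_text[of A R] by auto

lemma even_concat: "(\<And>w. w \<in> set ws \<Longrightarrow> even (length w)) \<Longrightarrow> even (length (concat ws))"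
  by (induction ws) auto

lemma even_body: "even (length (body m rs n B C p))"
  unfolding body_def Let_def by (rule even_concat) (auto simp: even_length_rule_text)

lemma even_header: "even (length (header m rs n St))"
proof -
  have "even (length (concat (map (\<lambda>k. rule_text (name (m * n + length rs) ((=) k))
      (map_rhs (\<lambda>c. name (m * n + length rs) ((=) c)) id (rs ! k))) [0..<length rs])))"
    by (rule even_concat) (auto simp: even_length_rule_text)
  then show ?thesis by (simp add: header_def Let_def enc_semi_def)
qed

lemma length_name [simp]: "length (name l P) = l"
  by (simp add: name_def)

lemma length_block:
  assumes "length (header m rs n St) + length (body m rs n B C p) + 6 \<le> 2 ^ K"
  shows "length (block K m rs n St B C p) = 2 ^ K"
  using pad_length[of "length (header m rs n St) + length (body m rs n B C p)" K p]
    pad_length[of "length (body m rs n B C p)" K p] assms even_header[of m rs n St] even_body[of m rs n B C p]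
  by (cases "p = 0") (simp_all add: block_def Let_def add.assoc)

lemma length_rule_text_Pair:
  "length (rule_text A (Pair B C)) = 2 * length A + 2 * length B + 2 * length C + 6"
  by (simp add: rule_text_def enc_hash_def enc_semi_def)


lemma string_rule_text:
  assumes "definable3 Bs A" "definable3 Bs B" "definable3 Bs C"
  shows "definable_string Bs (\<lambda>K x q p. rule_text (name (a * length x + b) (A K x q p))
    (Pair (name (a * length x + b) (B K x q p)) (name (a * length x + b) (C K x q p))))"
  unfolding rule_text_def enc_rhs.simps name_def append_assoc
  by (intro string_append string_name string_const assms)

lemma string_const_rule:
  "definable_string Bs (\<lambda>K x q p. rule_text (name (a * length x + b) ((=) k))
    (map_rhs (\<lambda>c. name (a * length x + b) ((=) c)) id R))"
proof -
  have eq: "definable3 Bs (\<lambda>K x q p y. c = y)" for c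
    unfolding definable3_def by (intro allI definable_eq linear_intros)
  show ?thesis
  proof (cases R)
    case (Letter l)
    have "definable_string Bs (\<lambda>K x q p. enc_bits (map ((=) k) [0..<a * length x + b]) @ enc_hash @ enc_bits (code l) @ enc_semi)"
      by (intro string_append string_name eq string_const)
    then show ?thesis unfolding Letter by (simp add: rule_text_def name_def enc_rhs_Letter del: enc_rhs.simps)
  next
    case (Pair c d)
    then show ?thesis using string_rule_text[OF eq[of k] eq[of c] eq[of d]] by simp
  qed
qed

text \<open>A reference is given by the predicate that \<open>y\<close> is the number of the
  variable referred to, and this is literally bit \<open>y\<close> of its unary name. No conversion
  of numbers into names is needed in the formulas.\<close>

lemma definable_query:
  assumes St: "definable3 Bs (\<lambda>K x q p. St K x q)"
    and B: "\<And>j. j < m \<Longrightarrow> definable3 Bs (\<lambda>K x q. B K x q j)"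
    and C: "\<And>j. j < m \<Longrightarrow> definable3 Bs (\<lambda>K x q. C K x q j)"
    and o: "t < length Bs"
  shows "definable Bs (\<lambda>K x s. query K m rs (length x) (St K x (s i)) (B K x (s i)) (C K x (s i)) \<in> Bs ! t)"
proof -
  have num: "definable3 Bs (\<lambda>K x q p y. length rs + m * p + j = y)" for j
    unfolding definable3_def by (intro allI definable_eq linear_intros)
  have "definable_string Bs (\<lambda>K x q p. body m rs (length x) (B K x q) (C K x q) p)"
    unfolding body_def Let_def
    by (intro string_concat string_rule_text num) (auto simp: B C)
  note bd = this
  have hd: "definable_string Bs (\<lambda>K x q p. header m rs (length x) (St K x q))"
    unfolding header_def Let_def name_def[of _ "St _ _ _"]
    by (intro string_append string_concat string_const_rule string_const string_name St)
  let ?h = "\<lambda>K x q. header m rs (length x) (St K x q)"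
  let ?b = "\<lambda>K x q p. body m rs (length x) (B K x q) (C K x q) p"
  have d0: "definable3 Bs (\<lambda>K x q p v. (?h K x q @ ?b K x q p @ pad K (length (?h K x q @ ?b K x q p)) p) ! v)"
    using padded_definable[OF string_append[OF hd bd]] even_header even_body by simp
  have d1: "definable3 Bs (\<lambda>K x q p v. (?b K x q p @ pad K (length (?b K x q p)) p) ! v)"
    using padded_definable[OF bd even_body] .
  let ?blk = "\<lambda>K x q p. block K m rs (length x) (St K x q) (B K x q) (C K x q) p"
  have blk: "definable Bs (\<lambda>K x s. ?blk K x (s i) (s w) ! s u)" for u w
  proof -
    have "definable Bs (\<lambda>K x s.
      s w = 0 \<and> (?h K x (s i) @ ?b K x (s i) (s w) @ pad K (length (?h K x (s i) @ ?b K x (s i) (s w))) (s w)) ! s u \<or>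
      s w \<noteq> 0 \<and> (?b K x (s i) (s w) @ pad K (length (?b K x (s i) (s w))) (s w)) ! s u)"
      by (intro definable_conj definable_disj definable_not definable_eq linear_intros d0[unfolded definable3_def, rule_format]
         d1[unfolded definable3_def, rule_format])
    then show ?thesis by (rule definable_cong) (auto simp: block_def Let_def)
  qed
  obtain a b where l0: "\<And>K x q p. length (?h K x q @ ?b K x q p) = a * length x + b"
    using string_append[OF hd bd] unfolding definable_string_def by blast
  have "definable Bs (\<lambda>K x s. map (\<lambda>k. ?blk K x (s i) (k div 2 ^ K) ! (k mod 2 ^ K)) [0..<2 ^ K * length x] \<in> Bs ! t)"
    by (rule definable_oracle[where u = "i + 1" and w = "i + 2" and P = "\<lambda>K x s c d. ?blk K x (s i) d ! c"])
      (auto intro!: blk o)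
  then show ?thesis
  proof (rule definable_cong[where ?k1.0 = "a + (b + 6)"])
    fix K x s assume A: "adm (a + (b + 6)) K x s"
    have len: "length (?blk K x (s i) p) = 2 ^ K" for p
      by (rule length_block) (use length_large[OF A] l0[of x K "s i" p] in simp)
    from concat_blocks[of "length x" "?blk K x (s i)", OF len]
    show "(map (\<lambda>k. ?blk K x (s i) (k div 2 ^ K) ! (k mod 2 ^ K)) [0..<2 ^ K * length x] \<in> Bs ! t) =
      (query K m rs (length x) (St K x (s i)) (B K x (s i)) (C K x (s i)) \<in> Bs ! t)"
      by (simp add: query_def)
  qed
qed

section \<open>Evaluation of query programs\<close>

datatype qvar = Const nat | Var nat nat | Pad nat

text \<open>Entries refer to earlier ones only, so a table is acyclic by its order and can be copied
  into any query.\<close>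

definition table :: "'a list \<Rightarrow> (nat, letter) rhs list \<Rightarrow> bool" where
  "table gs rs \<longleftrightarrow> (\<forall>k<length rs. rhs_vars (rs ! k) \<subseteq> {..<k} \<and> (\<forall>a. rs ! k = Letter a \<longrightarrow> a \<in> letters gs))"

fun number :: "nat \<Rightarrow> (nat, letter) rhs list \<Rightarrow> qvar \<Rightarrow> nat" where
  "number m rs (Const k) = k"
| "number m rs (Var p j) = length rs + m * p + j"
| "number m rs (Pad p) = 0"

fun qrhs :: "(nat, letter) rhs list \<Rightarrow> (nat \<Rightarrow> nat \<Rightarrow> qvar) \<Rightarrow> (nat \<Rightarrow> nat \<Rightarrow> qvar) \<Rightarrow> qvar \<Rightarrow> (qvar, letter) rhs" where
  "qrhs rs b c (Const k) = map_rhs Const id (rs ! k)"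
| "qrhs rs b c (Var p j) = Pair (b p j) (c p j)"
| "qrhs rs b c (Pad p) = Letter (0, False)"

definition qvars :: "nat \<Rightarrow> (nat, letter) rhs list \<Rightarrow> nat \<Rightarrow> qvar list" where
  "qvars m rs n = concat (map (\<lambda>p. (if p = 0 then map Const [0..<length rs] else []) @ map (Var p) [0..<m] @ [Pad p]) [0..<n])"

definition proper :: "nat \<Rightarrow> (nat, letter) rhs list \<Rightarrow> nat \<Rightarrow> qvar set" where
  "proper m rs n = Const ` {..<length rs} \<union> {Var p j | p j. p < n \<and> j < m}"

fun qname :: "nat \<Rightarrow> (nat, letter) rhs list \<Rightarrow> nat \<Rightarrow> (nat \<Rightarrow> nat) \<Rightarrow> qvar \<Rightarrow> bool list" where
  "qname m rs n pl (Pad p) = map ((=) p) [0..<pl p]"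
| "qname m rs n pl v = name (m * n + length rs) ((=) (number m rs v))"

lemma set_qvars: "0 < n \<Longrightarrow> set (qvars m rs n) = proper m rs n \<union> Pad ` {..<n}"
  by (auto simp: qvars_def proper_def split: if_splits)

lemma distinct_qvars: "distinct (qvars m rs n)"
proof (induction n)
  case (Suc n)
  have "set (qvars m rs n) \<subseteq> range Const \<union> {Var p j | p j. p < n} \<union> Pad ` {..<n}"
    by (auto simp: qvars_def split: if_splits)
  moreover have "n = 0 \<Longrightarrow> qvars m rs n = []" by (simp add: qvars_def)
  moreover have "qvars m rs (Suc n) = qvars m rs n @
      ((if n = 0 then map Const [0..<length rs] else []) @ map (Var n) [0..<m] @ [Pad n])"
    by (simp add: qvars_def)
  ultimately show ?case using Suc
    by (cases "n = 0") (auto simp: distinct_map inj_on_def)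
qed (simp add: qvars_def)

lemma number_less: "v \<in> proper m rs n \<Longrightarrow> number m rs v < m * n + length rs"
proof -
  have "m * p + j < m * n" if "p < n" "j < m" for p j
    using column_index[of p n j m] that by (simp add: mult.commute)
  then show "v \<in> proper m rs n \<Longrightarrow> number m rs v < m * n + length rs"
    by (auto simp: proper_def)
qed

lemma number_inj: "inj_on (number m rs) (proper m rs n)"
proof -
  have key: "p = p' \<and> j = j'" if "m * p + j = m * p' + j'" "j < m" "j' < m" for p j p' j'
  proof -
    have "(m * p + j) div m = p" if "j < m" for p j using that by auto
    from this[OF that(2), of p] this[OF that(3), of p'] have "p = p'" using that(1) by simp
    then show ?thesis using that by simp
  qed
  show ?thesis
  proof (rule inj_onI)
    fix v w assume vw: "v \<in> proper m rs n" "w \<in> proper m rs n" "number m rs v = number m rs w"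
    show "v = w"
    proof (cases v; cases w)
      fix p j p' j' assume e: "v = Var p j" "w = Var p' j'"
      then have "m * p + j = m * p' + j'" "j < m" "j' < m" using vw by (auto simp: proper_def)
      from key[OF this] show "v = w" using e by simp
    qed (use vw in \<open>auto simp: proper_def\<close>)
  qed
qed

lemma name_inj: "c < l \<Longrightarrow> name l ((=) c) = name l ((=) c') \<Longrightarrow> c = c'"
  unfolding name_def map_eq_conv by auto

lemma name_cong: "(\<And>y. y < l \<Longrightarrow> P y = Q y) \<Longrightarrow> name l P = name l Q"
  by (auto simp: name_def)

lemma qname_proper: "v \<in> proper m rs n \<Longrightarrow> qname m rs n pl v = name (m * n + length rs) ((=) (number m rs v))"
  by (auto simp: proper_def)

text \<open>Dummy names are longer than proper ones. Among themselves they differ in length or in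
  the place of their 1, for which \<open>n \<le> pl p\<close> leaves room.\<close>

lemma qname_inj:
  assumes pl: "\<And>p. p < n \<Longrightarrow> m * n + length rs < pl p \<and> n \<le> pl p" and n: "0 < n"
  shows "inj_on (qname m rs n pl) (set (qvars m rs n))"
proof (rule inj_onI)
  fix v w assume v: "v \<in> set (qvars m rs n)" and w: "w \<in> set (qvars m rs n)" and eq: "qname m rs n pl v = qname m rs n pl w"
  have proper_len: "length (qname m rs n pl v) = m * n + length rs" if "v \<in> proper m rs n" for v
    using that by (simp add: qname_proper)
  consider "v \<in> proper m rs n" "w \<in> proper m rs n" | p where "v \<in> proper m rs n" "w = Pad p" "p < n"
    | p where "w \<in> proper m rs n" "v = Pad p" "p < n" | p p' where "v = Pad p" "w = Pad p'" "p < n" "p' < n"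
    using v w n by (auto simp: set_qvars)
  then show "v = w"
  proof cases
    case 1
    then have "number m rs v = number m rs w" using eq name_inj[OF number_less] by (simp add: qname_proper)
    then show ?thesis using 1 number_inj[of m rs n] by (auto simp: inj_on_def)
  next
    case 2
    then show ?thesis using proper_len[of v] arg_cong[OF eq, of length] pl[of p] by simp
  next
    case 3
    then show ?thesis using proper_len[of w] arg_cong[OF eq, of length] pl[of p] by simp
  next
    case 4
    then have "pl p = pl p'" using arg_cong[OF eq, of length] by simp
    then show ?thesis using 4 eq pl[of p] name_inj[of p "pl p" p'] by (simp add: name_def)
  qed
qed

lemma concat_map_concat: "concat (map f (concat xss)) = concat (map (\<lambda>xs. concat (map f xs)) xss)"
  by (induction xss) auto

definition padding :: "nat \<Rightarrow> nat \<Rightarrow> (nat, letter) rhs list \<Rightarrow> nat \<Rightarrow> (nat \<Rightarrow> bool) \<Rightarrow> (nat \<Rightarrow> nat \<Rightarrow> nat \<Rightarrow> bool) \<Rightarrow>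
    (nat \<Rightarrow> nat \<Rightarrow> nat \<Rightarrow> bool) \<Rightarrow> nat \<Rightarrow> nat" where
  "padding K m rs n St B C p = (2 ^ K - length ((if p = 0 then header m rs n St else []) @ body m rs n B C p) - 6) div 2"

lemma query_slp_text:
  assumes n: "0 < n" and rs: "table gs rs" and st: "st \<in> proper m rs n"
    and b: "\<And>p j. p < n \<Longrightarrow> j < m \<Longrightarrow> b p j \<in> proper m rs n"
    and c: "\<And>p j. p < n \<Longrightarrow> j < m \<Longrightarrow> c p j \<in> proper m rs n"
    and St: "\<And>y. St y \<longleftrightarrow> y = number m rs st"
    and B: "\<And>p j y. p < n \<Longrightarrow> j < m \<Longrightarrow> B j p y \<longleftrightarrow> y = number m rs (b p j)"
    and C: "\<And>p j y. p < n \<Longrightarrow> j < m \<Longrightarrow> C j p y \<longleftrightarrow> y = number m rs (c p j)"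
  shows "query K m rs n St B C = slp_text (qname m rs n (padding K m rs n St B C))
      (qvars m rs n) st (qrhs rs b c)"
proof -
  let ?l = "m * n + length rs"
  define pl where "pl = padding K m rs n St B C"
  let ?nm = "qname m rs n pl"
  let ?pad = "\<lambda>p. pad K (length ((if p = 0 then header m rs n St else []) @ body m rs n B C p)) p"
  let ?rt = "\<lambda>v. rule_text (?nm v) (map_rhs ?nm id (qrhs rs b c v))"
  define cts where "cts = concat (map (\<lambda>k. ?rt (Const k)) [0..<length rs])"
  have nm: "name ?l P = ?nm v" if "v \<in> proper m rs n" "\<And>y. P y \<longleftrightarrow> y = number m rs v" for P v
    unfolding qname_proper[OF that(1)] by (rule name_cong) (use that(2) in auto)
  have header: "header m rs n St = enc_bits (?nm st) @ enc_semi @ cts"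
  proof -
    have "map_rhs (\<lambda>c. name ?l ((=) c)) id (rs ! k) = map_rhs ?nm id (qrhs rs b c (Const k))" if "k < length rs" for k
      by (cases "rs ! k") auto
    then have "concat (map (\<lambda>k. rule_text (name ?l ((=) k)) (map_rhs (\<lambda>c. name ?l ((=) c)) id (rs ! k))) [0..<length rs])
      = cts"
      unfolding cts_def by (intro arg_cong[of _ _ concat] map_cong) auto
    then show ?thesis unfolding header_def Let_def nm[OF st St] by simp
  qed
  have body: "body m rs n B C p = concat (map (\<lambda>j. ?rt (Var p j)) [0..<m])" if p: "p < n" for p
  proof -
    have "rule_text (name ?l ((=) (length rs + m * p + j))) (Pair (name ?l (B j p)) (name ?l (C j p))) = ?rt (Var p j)"
      if "j < m" for j
      using nm[OF b[OF p that] B[OF p that]] nm[OF c[OF p that] C[OF p that]] by simp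
    then show ?thesis unfolding body_def Let_def by (intro arg_cong[of _ _ concat] map_cong) auto
  qed
  have blk: "block K m rs n St B C p = (if p = 0 then enc_bits (?nm st) @ enc_semi @ cts else []) @
      concat (map (\<lambda>j. ?rt (Var p j)) [0..<m]) @ ?rt (Pad p)" if p: "p < n" for p
  proof -
    have "?pad p = ?rt (Pad p)" by (simp add: pad_def pl_def padding_def)
    then show ?thesis using header body[OF p] by (simp add: block_def Let_def)
  qed
  have up: "[0..<n] = 0 # [1..<n]" using n by (simp add: upt_conv_Cons)
  have "query K m rs n St B C = enc_bits (?nm st) @ enc_semi @
      concat (map (\<lambda>p. (if p = 0 then cts else []) @ concat (map (\<lambda>j. ?rt (Var p j)) [0..<m]) @ ?rt (Pad p)) [0..<n])"
  proof -
    have tl: "map (block K m rs n St B C) [1..<n] =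
      map (\<lambda>p. (if p = 0 then cts else []) @ concat (map (\<lambda>j. ?rt (Var p j)) [0..<m]) @ ?rt (Pad p)) [1..<n]"
      using blk by auto
    show ?thesis unfolding query_def up list.map concat.simps blk[OF n] tl by simp
  qed
  also have "\<dots> = enc_bits (?nm st) @ enc_semi @ concat (map ?rt (qvars m rs n))"
  proof -
    have "concat (map ?rt (qvars m rs n)) = concat (map (\<lambda>p. concat (map ?rt
        ((if p = 0 then map Const [0..<length rs] else []) @ map (Var p) [0..<m] @ [Pad p]))) [0..<n])"
      unfolding qvars_def concat_map_concat by (simp only: map_map comp_def)
    also have "\<dots> = concat (map (\<lambda>p. (if p = 0 then cts else []) @ concat (map (\<lambda>j. ?rt (Var p j)) [0..<m]) @ ?rt (Pad p)) [0..<n])"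
      by (intro arg_cong[of _ _ concat] map_cong refl) (simp add: cts_def comp_def)
    finally show ?thesis by simp
  qed
  finally show ?thesis unfolding slp_text_def pl_def .
qed

lemma closed_qrhs:
  assumes n: "0 < n" and rs: "table gs rs" and gs: "gs \<noteq> []"
    and b: "\<And>p j. p < n \<Longrightarrow> j < m \<Longrightarrow> b p j \<in> proper m rs n"
    and c: "\<And>p j. p < n \<Longrightarrow> j < m \<Longrightarrow> c p j \<in> proper m rs n"
  shows "closed_slp gs (set (qvars m rs n)) (qrhs rs b c)"
  unfolding closed_slp_def set_qvars[OF n]
proof
  fix v assume "v \<in> proper m rs n \<union> Pad ` {..<n}"
  then consider k where "v = Const k" "k < length rs" | p j where "v = Var p j" "p < n" "j < m" | p where "v = Pad p" "p < n"
    by (auto simp: proper_def)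
  then show "rhs_vars (qrhs rs b c v) \<subseteq> proper m rs n \<union> Pad ` {..<n} \<and>
    (\<forall>a. qrhs rs b c v = Letter a \<longrightarrow> a \<in> letters gs)"
  proof cases
    case 1
    then have "rhs_vars (rs ! k) \<subseteq> {..<k}" "\<forall>a. rs ! k = Letter a \<longrightarrow> a \<in> letters gs"
      using rs unfolding table_def by blast+
    then show ?thesis using 1 by (cases "rs ! k") (auto simp: proper_def)
  next
    case 2
    then show ?thesis using b c by auto
  next
    case 3
    then show ?thesis using gs by (auto simp: letters_def)
  qed
qed

text \<open>Of the constant 8 in \<open>big\<close>, 6 bits are for the separators and the letter of
  a dummy rule; the other 2, with the linear terms, make dummy names longer than proper ones and at
  least \<open>n\<close> long.\<close>

lemma query_CWP:
  assumes K: "group K" "generating_list K gs" and n: "0 < n" and rs: "table gs rs" and st: "st \<in> proper m rs n"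
    and b: "\<And>p j. p < n \<Longrightarrow> j < m \<Longrightarrow> b p j \<in> proper m rs n"
    and c: "\<And>p j. p < n \<Longrightarrow> j < m \<Longrightarrow> c p j \<in> proper m rs n"
    and St: "\<And>y. St y \<longleftrightarrow> y = number m rs st"
    and B: "\<And>p j y. p < n \<Longrightarrow> j < m \<Longrightarrow> B j p y \<longleftrightarrow> y = number m rs (b p j)"
    and C: "\<And>p j y. p < n \<Longrightarrow> j < m \<Longrightarrow> C j p y \<longleftrightarrow> y = number m rs (c p j)"
    and big: "\<And>p. p < n \<Longrightarrow> length (header m rs n St) + length (body m rs n B C p) + 8 + 2 * (m * n + length rs) + 2 * n \<le> 2 ^ k"
  shows "query k m rs n St B C \<in> CWP K gs \<longleftrightarrow>
    ranked (set (qvars m rs n)) (qrhs rs b c) \<and> evalto K gs (qrhs rs b c) st \<one>\<^bsub>K\<^esub>"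
proof -
  have gs: "gs \<noteq> []" "set gs \<subseteq> carrier K" using K(2) by (auto simp: generating_list_def)
  have eq: "query k m rs n St B C = slp_text (qname m rs n (padding k m rs n St B C))
      (qvars m rs n) st (qrhs rs b c)"
    by (rule query_slp_text[OF n rs st b c St B C])
  have half: "a < t div 2 \<and> n \<le> t div 2" if "2 * (a + 1 + n) \<le> t" for a n t :: nat
    using that by presburger
  show ?thesis
    unfolding eq
  proof (rule slp_text_CWP[OF K(1) gs(2) distinct_qvars])
    show "st \<in> set (qvars m rs n)" using st set_qvars[OF n] by blast
    show "closed_slp gs (set (qvars m rs n)) (qrhs rs b c)" by (rule closed_qrhs[OF n rs gs(1) b c])
    show "inj_on (qname m rs n (padding k m rs n St B C))
       (set (qvars m rs n))"
    proof (rule qname_inj[OF _ n])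
      fix p assume "p < n"
      then have "2 * (m * n + length rs + 1 + n) \<le> 2 ^ k - length ((if p = 0 then header m rs n St else []) @ body m rs n B C p) - 6"
        using big[of p] by auto
      from half[OF this] show "m * n + length rs < padding k m rs n St B C p \<and> n \<le> padding k m rs n St B C p"
        unfolding padding_def .
    qed
  qed
qed

lemma evalto_Const:
  assumes rs: "table gs rs" and "evalto K gs ((!) rs) k z" "k < length rs"
  shows "evalto K gs (qrhs rs b c) (Const k) z"
  using assms(2,3)
proof (induction rule: evalto.induct)
  case (1 k a)
  then show ?case by (intro evalto.intros) simp
next
  case (2 k i j u v)
  then have "i < k" "j < k" using rs by (auto simp: table_def)
  then show ?case using 2 by (intro evalto.intros(2)[of _ _ "Const i" "Const j"]) auto
qed

lemma evalto_append:
  assumes rs: "table gs rs" and "evalto K gs ((!) rs) k z" "k < length rs"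
  shows "evalto K gs ((!) (rs @ rs')) k z"
  using assms(2,3)
proof (induction rule: evalto.induct)
  case (1 k a)
  then show ?case by (intro evalto.intros) (simp add: nth_append)
next
  case (2 k i j u v)
  then have "i < k" "j < k" using rs by (auto simp: table_def)
  then show ?case using 2 by (intro evalto.intros(2)[of _ _ i j]) (auto simp: nth_append)
qed

lemma table_snoc:
  "table gs rs \<Longrightarrow> rhs_vars R \<subseteq> {..<length rs} \<Longrightarrow> (\<And>a. R = Letter a \<Longrightarrow> a \<in> letters gs) \<Longrightarrow> table gs (rs @ [R])"
  by (auto simp: table_def nth_append less_Suc_eq)

context
  fixes K :: "('a, 'b) monoid_scheme" and gs :: "'a list"
  assumes K: "group K" and gl: "generating_list K gs"
begin

definition has_value :: "(nat, letter) rhs list \<Rightarrow> 'a \<Rightarrow> bool" where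
  "has_value rs z \<longleftrightarrow> (\<exists>k<length rs. evalto K gs ((!) rs) k z)"

lemma has_value_append: "table gs rs \<Longrightarrow> has_value rs z \<Longrightarrow> has_value (rs @ rs') z"
  unfolding has_value_def by (metis evalto_append length_append trans_less_add1)

lemma has_value_Letter:
  assumes "table gs rs" "a \<in> letters gs"
  shows "\<exists>rs'. table gs (rs @ rs') \<and> has_value (rs @ rs') (letter_val K gs a)"
proof -
  have "evalto K gs ((!) (rs @ [Letter a])) (length rs) (letter_val K gs a)"
    by (rule evalto.intros) simp
  then show ?thesis using table_snoc[OF assms(1), of "Letter a"] assms(2)
    by (intro exI[of _ "[Letter a]"]) (auto simp: has_value_def)
qed

lemma has_value_mult:
  assumes rs: "table gs rs" and "has_value rs u" "has_value rs v"
  shows "\<exists>rs'. table gs (rs @ rs') \<and> has_value (rs @ rs') (u \<otimes>\<^bsub>K\<^esub> v)"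
proof -
  obtain i j where ij: "i < length rs" "j < length rs" "evalto K gs ((!) rs) i u" "evalto K gs ((!) rs) j v"
    using assms unfolding has_value_def by blast
  have "evalto K gs ((!) (rs @ [Pair i j])) (length rs) (u \<otimes>\<^bsub>K\<^esub> v)"
    by (rule evalto.intros(2)[of _ _ i j]) (auto intro!: evalto_append[OF rs] ij)
  then show ?thesis using table_snoc[OF rs, of "Pair i j"] ij
    by (intro exI[of _ "[Pair i j]"]) (auto simp: has_value_def)
qed

lemma table_extend:
  assumes "z \<in> generate K (set gs)" "table gs rs"
  shows "\<exists>rs'. table gs (rs @ rs') \<and> has_value (rs @ rs') z"
  using assms
proof (induction arbitrary: rs rule: generate.induct)
  case one
  \<comment> \<open>The identity need not be a letter, and no program derives the empty word; it is
    produced as a generator times its inverse.\<close>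
  have a: "(0, e) \<in> letters gs" for e using gl by (auto simp: letters_def generating_list_def)
  obtain r1 where 1: "table gs (rs @ r1)" "has_value (rs @ r1) (letter_val K gs (0, False))"
    using has_value_Letter[OF one a] by blast
  obtain r2 where 2: "table gs ((rs @ r1) @ r2)" "has_value ((rs @ r1) @ r2) (letter_val K gs (0, True))"
    using has_value_Letter[OF 1(1) a] by blast
  obtain r3 where 3: "table gs (((rs @ r1) @ r2) @ r3)"
    "has_value (((rs @ r1) @ r2) @ r3) (letter_val K gs (0, False) \<otimes>\<^bsub>K\<^esub> letter_val K gs (0, True))"
    using has_value_mult[OF 2(1) has_value_append[OF 1] 2(2)] by blast
  have "gs ! 0 \<in> carrier K" using gl by (auto simp: generating_list_def)
  then have "letter_val K gs (0, False) \<otimes>\<^bsub>K\<^esub> letter_val K gs (0, True) = \<one>\<^bsub>K\<^esub>"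
    using group.r_inv[OF K] by simp
  then show ?case using 3 by (intro exI[of _ "r1 @ r2 @ r3"]) simp
next
  case (incl h)
  then obtain i where "i < length gs" "gs ! i = h" by (metis in_set_conv_nth)
  then show ?case using has_value_Letter[OF incl(2), of "(i, False)"] by (auto simp: letters_def)
next
  case (inv h)
  then obtain i where "i < length gs" "gs ! i = h" by (metis in_set_conv_nth)
  then show ?case using has_value_Letter[OF inv(2), of "(i, True)"] by (auto simp: letters_def)
next
  case (eng h1 h2)
  obtain r1 where 1: "table gs (rs @ r1)" "has_value (rs @ r1) h1" using eng by blast
  obtain r2 where 2: "table gs ((rs @ r1) @ r2)" "has_value ((rs @ r1) @ r2) h2" using eng(4)[OF 1(1)] by blast
  obtain r3 where "table gs (((rs @ r1) @ r2) @ r3)" "has_value (((rs @ r1) @ r2) @ r3) (h1 \<otimes>\<^bsub>K\<^esub> h2)"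
    using has_value_mult[OF 2(1) has_value_append[OF 1] 2(2)] by blast
  then show ?case by (intro exI[of _ "r1 @ r2 @ r3"]) simp
qed

lemma table_exists:
  assumes "finite Z" "Z \<subseteq> carrier K"
  shows "\<exists>rs. table gs rs \<and> (\<forall>z\<in>Z. has_value rs z)"
  using assms
proof (induction Z)
  case empty
  then show ?case by (intro exI[of _ "[]"]) (simp add: table_def)
next
  case (insert z Z)
  then obtain rs where rs: "table gs rs" "\<forall>z\<in>Z. has_value rs z" by blast
  have "z \<in> generate K (set gs)" using insert gl by (simp add: generating_list_def)
  from table_extend[OF this rs(1)] show ?case using rs has_value_append[OF rs(1)] by blast
qed

end

section \<open>Queries about the parsed program\<close>

text \<open>Every position gets rules: where none starts, they refer to \<open>ke\<close>, which
  will be a constant for the identity, and position 0 carries the additional rule. A letter turns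
  into a constant whose partner in \<open>ref_right\<close> is \<open>ke\<close>.\<close>

definition ref_left :: "nat \<Rightarrow> (nat, letter) rhs list \<Rightarrow> (letter \<Rightarrow> nat \<Rightarrow> nat) \<Rightarrow> nat \<Rightarrow> letter set \<Rightarrow> (nat \<Rightarrow> nat \<Rightarrow> bool) \<Rightarrow>
    bool list \<Rightarrow> nat \<Rightarrow> nat \<Rightarrow> nat \<Rightarrow> nat \<Rightarrow> bool" where
  "ref_left m rs kl ke L zb x q j p y \<longleftrightarrow> p = 0 \<and> zb q y \<or> p \<noteq> 0 \<and>
    ((\<exists>p1\<le>length x. \<exists>p2\<le>length x. rule_at x p \<and> pair_rule x p p1 p2 \<and> y = length rs + m * p1 + j) \<or>
     rule_at x p \<and> (\<exists>a\<in>L. letter_at x p (code a) \<and> y = kl a j) \<or> \<not> rule_at x p \<and> y = ke)"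

text \<open>The index of the right factor depends on the value of the left one; this information
  comes in through \<open>act j p1 j'\<close>.\<close>

definition ref_right :: "nat \<Rightarrow> (nat, letter) rhs list \<Rightarrow> nat \<Rightarrow> nat \<Rightarrow> letter set \<Rightarrow> (nat \<Rightarrow> nat \<Rightarrow> nat \<Rightarrow> bool) \<Rightarrow>
    bool list \<Rightarrow> nat \<Rightarrow> nat \<Rightarrow> nat \<Rightarrow> bool" where
  "ref_right m rs ke kz L act x j p y \<longleftrightarrow> p = 0 \<and> y = kz \<or> p \<noteq> 0 \<and>
    ((\<exists>p1\<le>length x. \<exists>p2\<le>length x. rule_at x p \<and> pair_rule x p p1 p2 \<and>
        (\<exists>j'\<in>{..<m}. act j p1 j' \<and> y = length rs + m * p2 + j')) \<or>
     rule_at x p \<and> (\<exists>a\<in>L. letter_at x p (code a) \<and> y = ke) \<or> \<not> rule_at x p \<and> y = ke)"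

lemma definable_ref_left:
  assumes L: "finite L" and zb: "\<And>i v. definable Bs (\<lambda>K x s. zb (s i) (s v))"
  shows "definable3 Bs (\<lambda>K x q p y. ref_left m rs kl ke L zb x q j p y)"
  unfolding definable3_def
proof (intro allI)
  fix i p v
  have "definable Bs (\<lambda>K x s. \<exists>p1\<le>length x. \<exists>p2\<le>length x. rule_at x (s p) \<and> pair_rule x (s p) p1 p2 \<and> s v = length rs + m * p1 + j)"
    apply (rule definable_ex_le[where r = "p + v + 1"])
     apply (rule definable_ex_le[where r = "p + v + 2"])
      apply (intro definable_intros definable_rule_at definable_pair_rule)
     apply simp_all
    done
  then show "definable Bs (\<lambda>K x s. ref_left m rs kl ke L zb x (s i) j (s p) (s v))"
    unfolding ref_left_def
    by (intro definable_intros zb definable_bex L definable_letter_at definable_rule_at)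
qed

lemma definable_ref_right:
  assumes L: "finite L" and act: "\<And>j' i. j' < m \<Longrightarrow> definable Bs (\<lambda>K x s. act K x j (s i) j')"
  shows "definable3 Bs (\<lambda>K x q p y. ref_right m rs ke kz L (act K x) x j p y)"
  unfolding definable3_def
proof (intro allI)
  fix i p v
  have "definable Bs (\<lambda>K x s. \<exists>p1\<le>length x. \<exists>p2\<le>length x. rule_at x (s p) \<and> pair_rule x (s p) p1 p2 \<and>
      (\<exists>j'\<in>{..<m}. act K x j p1 j' \<and> s v = length rs + m * p2 + j'))"
    apply (rule definable_ex_le[where r = "p + v + 1"])
     apply (rule definable_ex_le[where r = "p + v + 2"])
      apply (intro definable_intros definable_rule_at definable_pair_rule definable_bex act)
       apply simp_all
    done
  then show "definable Bs (\<lambda>K x s. ref_right m rs ke kz L (act K x) x j (s p) (s v))"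
    unfolding ref_right_def
    by (intro definable_intros definable_bex L definable_letter_at definable_rule_at)
qed

lemma length_bound_concat:
  assumes "\<And>k. k \<in> set ks \<Longrightarrow> \<exists>a b. \<forall>n. length (g k n) \<le> a * n + b"
  shows "\<exists>a b. \<forall>n. length (concat (map (\<lambda>k. g k n) ks)) \<le> a * n + b"
  using assms
proof (induction ks)
  case (Cons k ks)
  obtain a b where 1: "\<And>n. length (g k n) \<le> a * n + b" using Cons.prems[of k] by auto
  obtain a' b' where 2: "\<And>n. length (concat (map (\<lambda>k. g k n) ks)) \<le> a' * n + b'" using Cons by auto
  have "length (concat (map (\<lambda>k. g k n) (k # ks))) \<le> (a + a') * n + (b + b')" for n
    using add_mono[OF 1[of n] 2[of n]] by (simp add: algebra_simps)
  then show ?case by blast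
qed simp

lemma query_large:
  "\<exists>k1. \<forall>K x s St B C p. adm k1 K x s \<longrightarrow> length (header m rs (length x) St) + length (body m rs (length x) B C p) + 8 +
    2 * (m * length x + length rs) + 2 * length x \<le> 2 ^ K"
proof -
  have "\<exists>a b. \<forall>n. length (rule_text (name (m * n + length rs) ((=) k))
      (map_rhs (\<lambda>c. name (m * n + length rs) ((=) c)) id (rs ! k))) \<le> a * n + b" for k
  proof (cases "rs ! k")
    case (Letter l)
    then show ?thesis
      by (intro exI[of _ "2 * m"] exI[of _ "2 * length rs + 4 + 2 * length (code l)"])
        (simp add: rule_text_def enc_rhs_Letter enc_hash_def enc_semi_def del: enc_rhs.simps)
  next
    case (Pair c d)
    then show ?thesis
      by (intro exI[of _ "6 * m"] exI[of _ "6 * length rs + 6"]) (simp add: length_rule_text_Pair)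
  qed
  then obtain a b where ab: "\<And>n. length (concat (map (\<lambda>k. rule_text (name (m * n + length rs) ((=) k))
      (map_rhs (\<lambda>c. name (m * n + length rs) ((=) c)) id (rs ! k))) [0..<length rs])) \<le> a * n + b"
    using length_bound_concat[of "[0..<length rs]" "\<lambda>k n. rule_text (name (m * n + length rs) ((=) k))
      (map_rhs (\<lambda>c. name (m * n + length rs) ((=) c)) id (rs ! k))"] by blast
  have hd: "length (header m rs n St) \<le> (a + 2 * m) * n + (b + 2 * length rs + 2)" for n St
    using ab[of n] by (simp add: header_def Let_def enc_semi_def algebra_simps)
  have bd: "length (body m rs n B C p) = 6 * m * m * n + m * (6 * length rs + 6)" for n B C p
    by (simp add: body_def Let_def length_concat length_rule_text_Pair comp_def sum_list_triv algebra_simps)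
  let ?a = "a + 2 * m + 6 * m * m + 2 * m + 2"
  let ?b = "b + 2 * length rs + 2 + m * (6 * length rs + 6) + 8 + 2 * length rs"
  have "length (header m rs (length x) St) + length (body m rs (length x) B C p) + 8 +
    2 * (m * length x + length rs) + 2 * length x \<le> 2 ^ K" if "adm (?a + ?b) K x s" for K x s St B C p
    using length_large[OF that] hd[of "length x" St] bd[of "length x" B C p] by (simp add: algebra_simps)
  then show ?thesis by blast
qed

section \<open>Translating the parsed program\<close>

text \<open>The variables are the positions where a rule starts.  Position 0 is none of them, which
  leaves room for one additional rule in a query.\<close>

locale parsed =
  fixes gs :: "'g list" and x :: "bool list" and Ps :: "nat set" and R :: "nat \<Rightarrow> (nat, letter) rhs"
  assumes Ps: "Ps = {p. rule_at x p}" and closed: "closed_slp gs Ps R"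
    and pair: "\<And>p q r. p \<in> Ps \<Longrightarrow> pair_rule x p q r \<longleftrightarrow> R p = Pair q r"
    and letter: "\<And>p a. p \<in> Ps \<Longrightarrow> letter_at x p (code a) \<longleftrightarrow> R p = Letter a"
begin

lemma Ps_bound: "p \<in> Ps \<Longrightarrow> 0 < p \<and> p < length x"
  by (auto simp: Ps rule_at_def)

lemma finite_Ps: "finite Ps"
  by (rule finite_subset[of _ "{..<length x}"]) (use Ps_bound in auto)

lemma pair_Ps: "p \<in> Ps \<Longrightarrow> R p = Pair q r \<Longrightarrow> q \<in> Ps \<and> r \<in> Ps"
  using closed_slpD(2)[OF closed] by blast

text \<open>\<open>left\<close> and \<open>right\<close> are the functions whose graphs
  \<open>ref_left\<close> and \<open>ref_right\<close> describe on a decoded input.\<close>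

definition left :: "(letter \<Rightarrow> nat \<Rightarrow> nat) \<Rightarrow> nat \<Rightarrow> qvar \<Rightarrow> nat \<Rightarrow> nat \<Rightarrow> qvar" where
  "left kl ke z p j = (if p = 0 then z else if p \<in> Ps then
     (case R p of Pair q r \<Rightarrow> Var q j | Letter a \<Rightarrow> Const (kl a j)) else Const ke)"

definition right :: "(nat \<Rightarrow> nat \<Rightarrow> nat) \<Rightarrow> nat \<Rightarrow> nat \<Rightarrow> nat \<Rightarrow> nat \<Rightarrow> qvar" where
  "right ix ke kz p j = (if p = 0 then Const kz else if p \<in> Ps then
     (case R p of Pair q r \<Rightarrow> Var r (ix j q) | Letter a \<Rightarrow> Const ke) else Const ke)"

lemma ref_left_iff:
  assumes z: "\<And>y. zb q y \<longleftrightarrow> y = number m rs z"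
  shows "ref_left m rs kl ke (letters gs) zb x q j p y \<longleftrightarrow> y = number m rs (left kl ke z p j)"
proof (cases "p \<in> Ps")
  case True
  then have p: "p \<noteq> 0" "rule_at x p" using Ps_bound Ps by auto
  show ?thesis
  proof (cases "R p")
    case (Letter a)
    then have "a \<in> letters gs" using closed_slpD(1)[OF closed True] by blast
    then show ?thesis using p True Letter by (auto simp: ref_left_def left_def pair letter)
  next
    case (Pair q' r)
    then have "q' \<le> length x" "r \<le> length x" using pair_Ps[OF True Pair] Ps_bound by (auto intro: less_imp_le)
    then show ?thesis using p True Pair by (auto simp: ref_left_def left_def pair letter)
  qed
next
  case False
  then have "\<not> rule_at x p" using Ps by blast
  then show ?thesis using False z by (auto simp: ref_left_def left_def)
qed

lemma ref_right_iff:
  assumes act: "\<And>q j'. q \<in> Ps \<Longrightarrow> j' < m \<Longrightarrow> act j q j' \<longleftrightarrow> j' = ix j q" and ix: "\<And>q. q \<in> Ps \<Longrightarrow> ix j q < m"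
  shows "ref_right m rs ke kz (letters gs) act x j p y \<longleftrightarrow> y = number m rs (right ix ke kz p j)"
proof (cases "p \<in> Ps")
  case True
  then have p: "p \<noteq> 0" "rule_at x p" using Ps_bound Ps by auto
  show ?thesis
  proof (cases "R p")
    case (Letter a)
    then have "a \<in> letters gs" using closed_slpD(1)[OF closed True] by blast
    then show ?thesis using p True Letter by (auto simp: ref_right_def right_def pair letter)
  next
    case (Pair q r)
    note qr = pair_Ps[OF True Pair]
    then have "q \<le> length x" "r \<le> length x" using Ps_bound by (auto intro: less_imp_le)
    moreover have "(\<exists>j'\<in>{..<m}. act j q j' \<and> y = length rs + m * r + j') \<longleftrightarrow> y = length rs + m * r + ix j q"
      using act[of q] ix[of q] qr by auto
    ultimately show ?thesis using p True Pair by (auto simp: ref_right_def right_def pair letter)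
  qed
next
  case False
  then have "\<not> rule_at x p" using Ps by blast
  then show ?thesis using False by (auto simp: ref_right_def right_def)
qed

context
  fixes m :: nat and rs :: "(nat, letter) rhs list" and kl :: "letter \<Rightarrow> nat \<Rightarrow> nat" and ke kz :: nat
    and ix :: "nat \<Rightarrow> nat \<Rightarrow> nat" and z :: qvar
  assumes kl: "\<And>a j. a \<in> letters gs \<Longrightarrow> j < m \<Longrightarrow> kl a j < length rs" and ke: "ke < length rs" and kz: "kz < length rs"
    and ix: "\<And>j q. j < m \<Longrightarrow> q \<in> Ps \<Longrightarrow> ix j q < m"
    and z: "(\<exists>k<length rs. z = Const k) \<or> (\<exists>q\<in>Ps. \<exists>j<m. z = Var q j)"
begin

lemma z_proper: "z \<in> proper m rs (length x)"
  using z Ps_bound by (auto simp: proper_def)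

lemma left_proper:
  assumes "j < m" shows "left kl ke z p j \<in> proper m rs (length x)"
proof (cases "p \<noteq> 0 \<and> p \<in> Ps")
  case True
  show ?thesis
  proof (cases "R p")
    case (Letter a)
    then have "kl a j < length rs" using kl closed_slpD(1)[OF closed] True assms by blast
    then show ?thesis using True Letter by (simp add: left_def proper_def)
  next
    case (Pair q r)
    then have "q < length x" using pair_Ps Ps_bound True by blast
    then show ?thesis using True Pair assms by (simp add: left_def proper_def)
  qed
next
  case False
  then show ?thesis using z_proper ke by (auto simp: left_def proper_def)
qed

lemma right_proper:
  assumes "j < m" shows "right ix ke kz p j \<in> proper m rs (length x)"
proof (cases "p \<noteq> 0 \<and> p \<in> Ps")
  case True
  show ?thesis
  proof (cases "R p")
    case (Letter a)
    then show ?thesis using True ke by (simp add: right_def proper_def)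
  next
    case (Pair q r)
    then have "r < length x" "ix j q < m" using pair_Ps Ps_bound True ix[OF assms] by blast+
    then show ?thesis using True Pair by (simp add: right_def proper_def)
  qed
next
  case False
  then show ?thesis using kz ke by (auto simp: right_def proper_def)
qed

lemma ranked_query:
  assumes rs: "table gs' rs" and R: "ranked Ps R" and n: "0 < length x"
  shows "ranked (set (qvars m rs (length x))) (qrhs rs (left kl ke z) (right ix ke kz))"
proof -
  obtain f :: "nat \<Rightarrow> nat" where f: "\<And>A B. A \<in> Ps \<Longrightarrow> B \<in> rhs_vars (R A) \<Longrightarrow> f B < f A"
    using R unfolding ranked_def by blast
  \<comment> \<open>Constants rank by their index, below every \<open>Var\<close>. Rule positions
    keep their rank up to a shift. Position 0 may refer to any of them and is placed above
    \<open>sum f Ps\<close>, which bounds each single \<open>f q\<close>.\<close>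
  define F where "F = (\<lambda>v. case v of Const k \<Rightarrow> k
    | Var p j \<Rightarrow> length rs + (if p = 0 then sum f Ps + 2 else if p \<in> Ps then f p + 1 else 0) | Pad p \<Rightarrow> 0)"
  have FC: "F (Const k) = k" and FV: "p \<in> Ps \<Longrightarrow> F (Var p j) = length rs + f p + 1" for k p j
    using Ps_bound by (auto simp: F_def)
  have F0: "F (Var 0 j) = length rs + sum f Ps + 2" for j by (simp add: F_def)
  have Fge: "length rs \<le> F (Var p j)" for p j by (simp add: F_def)
  have "f q \<le> sum f Ps" if "q \<in> Ps" for q by (rule member_le_sum[OF that]) (use finite_Ps in auto)
  then have zF: "F z < F (Var 0 j)" for j
    using z by (auto simp: FC FV F0 less_Suc_eq_le)
  have "F w < F v" if v: "v \<in> set (qvars m rs (length x))" and w: "w \<in> rhs_vars (qrhs rs (left kl ke z) (right ix ke kz) v)" for v w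
  proof -
    consider k where "v = Const k" "k < length rs" | p j where "v = Var p j" "p < length x" "j < m" | p where "v = Pad p"
      using v unfolding set_qvars[OF n] proper_def by auto
    then show ?thesis
    proof cases
      case 1
      then obtain i where "i \<in> rhs_vars (rs ! k)" "w = Const i" using w by (auto simp: rhs_vars_map)
      then show ?thesis using 1 rs by (auto simp: table_def FC)
    next
      case 2
      then have w: "w = left kl ke z p j \<or> w = right ix ke kz p j" using w by simp
      show ?thesis
      proof (cases "p = 0")
        case True
        then show ?thesis using w zF 2 kz by (auto simp: left_def right_def FC F0)
      next
        case p0: False
        show ?thesis
        proof (cases "p \<in> Ps")
          case False
          then show ?thesis using w 2 ke p0 Fge[of p j] by (auto simp: left_def right_def FC)
        next
          case True
          show ?thesis
          proof (cases "R p")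
            case (Letter a)
            then have "kl a j < length rs" using kl closed_slpD(1)[OF closed True] 2 by blast
            then show ?thesis using w 2 ke p0 True Letter Fge[of p j] by (auto simp: left_def right_def FC)
          next
            case (Pair q r)
            then have "f q < f p" "f r < f p" "q \<in> Ps" "r \<in> Ps" using f[OF True] pair_Ps[OF True Pair] by auto
            then show ?thesis using w 2 p0 True Pair by (auto simp: left_def right_def FV)
          qed
        qed
      qed
    next
      case 3
      then show ?thesis using w by simp
    qed
  qed
  then show ?thesis unfolding ranked_def by blast
qed

text \<open>The variable \<open>Var p j\<close> evaluates to \<open>sg j v\<close>, where \<open>v\<close> is the value of \<open>p\<close>; rules for pairs
  are compatible with this since \<open>sg\<close> is a cocycle.\<close>

lemma evalto_query:
  fixes G :: "('g, 'r) monoid_scheme" and K :: "('k, 's) monoid_scheme"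
  assumes rs: "table gs' rs" and K: "group K" and G: "group G" and gsG: "set gs \<subseteq> carrier G"
    and sg: "\<And>j u. j < m \<Longrightarrow> u \<in> carrier G \<Longrightarrow> sg j u \<in> carrier K"
    and cocycle: "\<And>j u v. j < m \<Longrightarrow> u \<in> carrier G \<Longrightarrow> v \<in> carrier G \<Longrightarrow>
      sg j (u \<otimes>\<^bsub>G\<^esub> v) = sg j u \<otimes>\<^bsub>K\<^esub> sg (ac j u) v"
    and vl: "\<And>a j. a \<in> letters gs \<Longrightarrow> j < m \<Longrightarrow> evalto K gs' ((!) rs) (kl a j) (sg j (letter_val G gs a))"
    and ve: "evalto K gs' ((!) rs) ke \<one>\<^bsub>K\<^esub>"
    and ixe: "\<And>q j u. q \<in> Ps \<Longrightarrow> j < m \<Longrightarrow> evalto G gs R q u \<Longrightarrow> ix j q = ac j u"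
    and ev: "evalto G gs R p u"
  shows "p \<in> Ps \<Longrightarrow> j < m \<Longrightarrow> evalto K gs' (qrhs rs (left kl ke z) (right ix ke kz)) (Var p j) (sg j u)"
  using ev
proof (induction arbitrary: j rule: evalto.induct)
  case (1 p a)
  have a: "a \<in> letters gs" using closed_slpD(1)[OF closed 1(2)] 1(1) by blast
  have "p \<noteq> 0" using 1 Ps_bound by blast
  then have "qrhs rs (left kl ke z) (right ix ke kz) (Var p j) = Pair (Const (kl a j)) (Const ke)"
    using 1 by (simp add: left_def right_def)
  moreover have "evalto K gs' (qrhs rs (left kl ke z) (right ix ke kz)) (Const (kl a j)) (sg j (letter_val G gs a))"
    by (rule evalto_Const[OF rs vl[OF a 1(3)] kl[OF a 1(3)]])
  moreover have "evalto K gs' (qrhs rs (left kl ke z) (right ix ke kz)) (Const ke) \<one>\<^bsub>K\<^esub>"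
    by (rule evalto_Const[OF rs ve ke])
  ultimately have "evalto K gs' (qrhs rs (left kl ke z) (right ix ke kz)) (Var p j) (sg j (letter_val G gs a) \<otimes>\<^bsub>K\<^esub> \<one>\<^bsub>K\<^esub>)"
    by (rule evalto.intros(2))
  then show ?case
    using monoid.r_one[OF group.is_monoid[OF K] sg[OF 1(3) letter_val_closed[OF G gsG a]]] by simp
next
  case (2 p q r u v)
  have qr: "q \<in> Ps" "r \<in> Ps" using pair_Ps[OF 2(6,1)] by auto
  have "p \<noteq> 0" using 2 Ps_bound by blast
  then have "qrhs rs (left kl ke z) (right ix ke kz) (Var p j) = Pair (Var q j) (Var r (ix j q))"
    using 2 by (simp add: left_def right_def)
  moreover have "u \<in> carrier G" "v \<in> carrier G"
    using evalto_closed[OF G gsG closed] 2(2,3) qr by blast+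
  moreover have "ix j q = ac j u" using ixe[OF qr(1) 2(7) 2(2)] .
  ultimately show ?case
    using 2(4)[OF qr(1) 2(7)] 2(5)[OF qr(2) ix[OF 2(7) qr(1)]] cocycle[OF 2(7)]
    by (auto intro: evalto.intros(2))
qed

end

end

definition parsed_query :: "nat \<Rightarrow> nat \<Rightarrow> (nat, letter) rhs list \<Rightarrow> (letter \<Rightarrow> nat \<Rightarrow> nat) \<Rightarrow> nat \<Rightarrow> nat \<Rightarrow> letter set \<Rightarrow>
    (bool list \<Rightarrow> nat \<Rightarrow> bool) \<Rightarrow> (nat \<Rightarrow> nat \<Rightarrow> bool) \<Rightarrow> (nat \<Rightarrow> nat \<Rightarrow> nat \<Rightarrow> bool) \<Rightarrow> bool list \<Rightarrow> nat \<Rightarrow> bool list" where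
  "parsed_query K m rs kl ke kz L St zb act x q =
    query K m rs (length x) (St x) (ref_left m rs kl ke L zb x q) (ref_right m rs ke kz L act x)"

lemma definable_parsed_query:
  assumes L: "finite L" and t: "t < length Bs"
    and St: "\<And>v. definable Bs (\<lambda>K x s. St x (s v))" and zb: "\<And>i v. definable Bs (\<lambda>K x s. zb (s i) (s v))"
    and act: "\<And>j j' i. j < m \<Longrightarrow> j' < m \<Longrightarrow> definable Bs (\<lambda>K x s. act K x j (s i) j')"
  shows "definable Bs (\<lambda>K x s. parsed_query K m rs kl ke kz L St zb (act K x) x (s i) \<in> Bs ! t)"
  unfolding parsed_query_def
proof (rule definable_query[where St = "\<lambda>K x q. St x"])
  show "definable3 Bs (\<lambda>K x q p. St x)" unfolding definable3_def using St by blast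
  show "definable3 Bs (\<lambda>K x q. ref_left m rs kl ke L zb x q j)" for j
    by (rule definable_ref_left) (rule L zb)+
  show "definable3 Bs (\<lambda>K x q. ref_right m rs ke kz L (act K x) x j)" if "j < m" for j
    by (rule definable_ref_right) (rule L, rule act[OF that])
qed (rule t)

lemma (in parsed) parsed_query_CWP:
  assumes K: "group K" "generating_list K gs'" and rs: "table gs' rs" and n: "0 < length x"
    and kl: "\<And>a j. a \<in> letters gs \<Longrightarrow> j < m \<Longrightarrow> kl a j < length rs" and ke: "ke < length rs" and kz: "kz < length rs"
    and ix: "\<And>j q. j < m \<Longrightarrow> q \<in> Ps \<Longrightarrow> ix j q < m"
    and z: "(\<exists>k<length rs. z = Const k) \<or> (\<exists>q\<in>Ps. \<exists>j<m. z = Var q j)"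
    and st: "st \<in> proper m rs (length x)" and St: "\<And>y. St x y \<longleftrightarrow> y = number m rs st"
    and zb: "\<And>y. zb q y \<longleftrightarrow> y = number m rs z"
    and act: "\<And>j q j'. j < m \<Longrightarrow> q \<in> Ps \<Longrightarrow> j' < m \<Longrightarrow> act j q j' \<longleftrightarrow> j' = ix j q"
    and big: "\<And>St B C p. length (header m rs (length x) St) + length (body m rs (length x) B C p) + 8 +
      2 * (m * length x + length rs) + 2 * length x \<le> 2 ^ k"
  shows "parsed_query k m rs kl ke kz (letters gs) St zb act x q \<in> CWP K gs' \<longleftrightarrow>
    ranked (set (qvars m rs (length x))) (qrhs rs (left kl ke z) (right ix ke kz)) \<and>
    evalto K gs' (qrhs rs (left kl ke z) (right ix ke kz)) st \<one>\<^bsub>K\<^esub>"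
  unfolding parsed_query_def
  by (rule query_CWP[OF K n rs st])
    (use left_proper[OF kl ke kz ix z] right_proper[OF kl ke kz ix z] St big ref_right_iff act ix
      ref_left_iff[where zb = zb and z = z and q = q and m = m and rs = rs, OF zb] in auto)

section \<open>Finite extensions\<close>

text \<open>With \<open>m = 1\<close> the query contains a copy of every rule of the input,
  reachable from the start variable or not, and a rank of the query restricts to these
  copies.\<close>

lemma (in parsed) ranked_query_D:
  assumes "ranked (set (qvars 1 rs (length x))) (qrhs rs (left kl ke z) (right (\<lambda>_ _. 0) ke kz))" and n: "0 < length x"
  shows "ranked Ps R"
proof -
  obtain F :: "qvar \<Rightarrow> nat" where F: "\<And>v w. v \<in> set (qvars 1 rs (length x)) \<Longrightarrow>
      w \<in> rhs_vars (qrhs rs (left kl ke z) (right (\<lambda>_ _. 0) ke kz) v) \<Longrightarrow> F w < F v"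
    using assms(1) unfolding ranked_def by blast
  have "F (Var q 0) < F (Var p 0)" if p: "p \<in> Ps" and q: "q \<in> rhs_vars (R p)" for p q
  proof -
    have "p \<noteq> 0" "p < length x" using Ps_bound[OF p] by auto
    then have "Var p 0 \<in> set (qvars 1 rs (length x))" by (simp add: set_qvars[OF n] proper_def)
    moreover have "Var q 0 \<in> rhs_vars (qrhs rs (left kl ke z) (right (\<lambda>_ _. 0) ke kz) (Var p 0))"
      using p q \<open>p \<noteq> 0\<close> by (cases "R p") (auto simp: left_def right_def)
    ultimately show ?thesis by (rule F)
  qed
  then show ?thesis unfolding ranked_def by (intro exI[of _ "\<lambda>p. F (Var p 0)"]) blast
qed

section \<open>The coset action and its cocycle\<close>

locale finite_extension = normal H G for H and G (structure) +
  fixes gsG gsH :: "'a list" and gsQ :: "'a set list" and m :: nat and rep :: "nat \<Rightarrow> 'a" and idx :: "'a \<Rightarrow> nat"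
  assumes gsG: "generating_list G gsG" and gsH: "generating_list (G\<lparr>carrier := H\<rparr>) gsH"
    and gsQ: "generating_list (G Mod H) gsQ"
    and rep_0: "rep 0 = \<one>" and rep_closed: "c < m \<Longrightarrow> rep c \<in> carrier G"
    and rep_inj: "c < m \<Longrightarrow> c' < m \<Longrightarrow> H #> rep c = H #> rep c' \<Longrightarrow> c = c'"
    and idx: "u \<in> carrier G \<Longrightarrow> idx u < m \<and> H #> u = H #> rep (idx u)"
begin

abbreviation "HG \<equiv> G\<lparr>carrier := H\<rparr>"
abbreviation "QG \<equiv> G Mod H"

lemma m_pos: "0 < m"
  using idx[OF one_closed] by simp

lemma groups: "group HG" "group QG"
  using subgroup_is_group[OF is_group] factorgroup_is_group by auto

lemma gs_closed: "set gsG \<subseteq> carrier G"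
  using gsG by (simp add: generating_list_def)

lemma coset_eq_iff: "a \<in> carrier G \<Longrightarrow> b \<in> carrier G \<Longrightarrow> H #> a = H #> b \<longleftrightarrow> a \<otimes> inv b \<in> H"
  using rcos_module[OF is_group, of b a] repr_independence[of a H b] rcos_self[of a H] subgroup_axioms by metis

lemma coset_one_iff: "a \<in> carrier G \<Longrightarrow> H #> a = H \<longleftrightarrow> a \<in> H"
  using coset_join1[of H a] coset_join2[of a H] subgroup_axioms by blast

lemma idx_eq: "u \<in> carrier G \<Longrightarrow> c < m \<Longrightarrow> H #> u = H #> rep c \<Longrightarrow> idx u = c"
  using idx[of u] rep_inj by metis

text \<open>The right action of \<open>G\<close> on the cosets of \<open>H\<close>, transported to
  their indices.\<close>

definition act :: "nat \<Rightarrow> 'a \<Rightarrow> nat" where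
  "act j u = idx (rep j \<otimes> u)"

text \<open>For a generator \<open>u\<close> these are the Schreier generators of
  \<open>H\<close>.\<close>

definition cocycle :: "nat \<Rightarrow> 'a \<Rightarrow> 'a" where
  "cocycle j u = rep j \<otimes> u \<otimes> inv rep (act j u)"

lemma act_less: "j < m \<Longrightarrow> u \<in> carrier G \<Longrightarrow> act j u < m"
  unfolding act_def using idx rep_closed by blast

lemma act_coset: "j < m \<Longrightarrow> u \<in> carrier G \<Longrightarrow> H #> (rep j \<otimes> u) = H #> rep (act j u)"
  unfolding act_def using idx rep_closed by blast

text \<open>By normality the action factors through \<open>G Mod H\<close>; this is why the answers
  of the quotient queries determine it.\<close>

lemma act_cong:
  assumes "j < m" "u \<in> carrier G" "v \<in> carrier G" "H #> u = H #> v"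
  shows "act j u = act j v"
proof -
  have "H #> (rep j \<otimes> u) = H #> (rep j \<otimes> v)"
    using assms rep_closed rcos_sum[of "rep j" u] rcos_sum[of "rep j" v] by simp
  then show ?thesis unfolding act_def using idx idx_eq assms rep_closed by (metis m_closed)
qed

lemma act_mult:
  assumes "j < m" "u \<in> carrier G" "v \<in> carrier G"
  shows "act j (u \<otimes> v) = act (act j u) v"
proof -
  have a: "act j u < m" using act_less assms by blast
  have "H #> (rep j \<otimes> (u \<otimes> v)) = (H #> (rep j \<otimes> u)) <#> (H #> v)"
    using assms rep_closed by (simp add: rcos_sum m_assoc)
  also have "\<dots> = (H #> rep (act j u)) <#> (H #> v)" using act_coset[OF assms(1,2)] by simp
  also have "\<dots> = H #> (rep (act j u) \<otimes> v)" using assms rep_closed[OF a] by (simp add: rcos_sum)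
  also have "\<dots> = H #> rep (act (act j u) v)" using act_coset[OF a assms(3)] .
  finally show ?thesis
    unfolding act_def[of j "u \<otimes> v"]
    using idx_eq[OF _ act_less[OF a assms(3)]] assms rep_closed by simp
qed

lemma cocycle_closed: "j < m \<Longrightarrow> u \<in> carrier G \<Longrightarrow> cocycle j u \<in> H"
  unfolding cocycle_def using act_coset[of j u] coset_eq_iff[of "rep j \<otimes> u" "rep (act j u)"] act_less[of j u] rep_closed
  by simp

text \<open>The representative \<open>rep (act j u)\<close> cancels between the two factors.\<close>

lemma cocycle_mult:
  assumes "j < m" "u \<in> carrier G" "v \<in> carrier G"
  shows "cocycle j (u \<otimes> v) = cocycle j u \<otimes> cocycle (act j u) v"
proof -
  have r: "rep j \<in> carrier G" "rep (act j u) \<in> carrier G" "rep (act (act j u) v) \<in> carrier G"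
    using rep_closed act_less assms by auto
  have "inv rep (act j u) \<otimes> (rep (act j u) \<otimes> (v \<otimes> inv rep (act (act j u) v))) = v \<otimes> inv rep (act (act j u) v)"
    using r assms by (simp add: m_assoc[symmetric])
  then show ?thesis
    unfolding cocycle_def act_mult[OF assms] using r assms by (simp add: m_assoc)
qed

text \<open>Justifies index 0 for the start variable: since \<open>rep 0\<close> is the identity, an
  element of \<open>H\<close> is left unchanged.\<close>

lemma cocycle_0: "u \<in> carrier G \<Longrightarrow> H #> u = H \<Longrightarrow> cocycle 0 u = u"
proof -
  assume u: "u \<in> carrier G" "H #> u = H"
  have "H #> rep 0 = H" using coset_one_iff[of \<one>] rep_0 one_closed by simp
  then have "act 0 u = 0" unfolding act_def using idx_eq[of u 0] u m_pos rep_0 by simp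
  then show ?thesis using u by (simp add: cocycle_def rep_0)
qed

section \<open>The queries to the quotient and to the subgroup\<close>

lemma finite_letters: "finite (letters gsG)"
  by (simp add: letters_def)

text \<open>Besides the letters the inverses of the representatives are tabulated; one of them is
  the right factor of the additional rule at position 0.\<close>

lemma quotient_table:
  "\<exists>rs kl ke kz. table gsQ rs \<and> ke < length rs \<and> evalto QG gsQ ((!) rs) ke H \<and>
    (\<forall>a\<in>letters gsG. kl a < length rs \<and> evalto QG gsQ ((!) rs) (kl a) (H #> letter_val G gsG a)) \<and>
    (\<forall>c<m. kz c < length rs \<and> evalto QG gsQ ((!) rs) (kz c) (H #> inv rep c))"
proof -
  let ?Z = "insert H ((\<lambda>a. H #> letter_val G gsG a) ` letters gsG \<union> (\<lambda>c. H #> inv rep c) ` {..<m})"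
  have "H #> \<one> = H" using coset_one_iff[OF one_closed] by simp
  then have "H \<in> rcosets H" using rcosetsI[OF subset one_closed] by simp
  then have "?Z \<subseteq> carrier QG"
    using letter_val_closed[OF is_group gs_closed] rep_closed rcosetsI[OF subset]
    by (auto simp: FactGroup_def)
  from table_exists[OF groups(2) gsQ _ this] finite_letters obtain rs where
    rs: "table gsQ rs" "\<forall>z\<in>?Z. has_value QG gsQ rs z" by auto
  then have "\<exists>k<length rs. evalto QG gsQ ((!) rs) k H"
    "\<forall>a\<in>letters gsG. \<exists>k<length rs. evalto QG gsQ ((!) rs) k (H #> letter_val G gsG a)"
    "\<forall>c<m. \<exists>k<length rs. evalto QG gsQ ((!) rs) k (H #> inv rep c)"
    by (auto simp: has_value_def[OF groups(2) gsQ])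
  then show ?thesis using rs(1) by metis
qed

lemma subgroup_table:
  "\<exists>rs kl ke. table gsH rs \<and> ke < length rs \<and> evalto HG gsH ((!) rs) ke \<one> \<and>
    (\<forall>a\<in>letters gsG. \<forall>j<m. kl a j < length rs \<and> evalto HG gsH ((!) rs) (kl a j) (cocycle j (letter_val G gsG a)))"
proof -
  let ?Z = "insert \<one> ((\<lambda>(a, j). cocycle j (letter_val G gsG a)) ` (letters gsG \<times> {..<m}))"
  have "?Z \<subseteq> carrier HG"
    using letter_val_closed[OF is_group gs_closed] cocycle_closed by auto
  from table_exists[OF groups(1) gsH _ this] finite_letters obtain rs where
    rs: "table gsH rs" "\<forall>z\<in>?Z. has_value HG gsH rs z" by auto
  then have "\<exists>k<length rs. evalto HG gsH ((!) rs) k \<one>"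
    "\<forall>a\<in>letters gsG. \<forall>j<m. \<exists>k<length rs. evalto HG gsH ((!) rs) k (cocycle j (letter_val G gsG a))"
    by (auto simp: has_value_def[OF groups(1) gsH])
  then show ?thesis using rs(1) by metis
qed

text \<open>The start variable \<open>Var 0 0\<close> has number \<open>length rs\<close> and the
  factors \<open>Var q 0\<close> and \<open>Const kz\<close>, so its value is the coset of
  \<open>u \<otimes> inv rep c\<close>. With one variable per position the only index is 0, which
  permits the constant predicate \<open>True\<close> in place of an action.\<close>

lemma quotient_query:
  assumes parsed: "parsed gsG x Ps R" and n: "0 < length x" and q: "q \<in> Ps" and c: "c < m"
    and tab: "table gsQ rs" "ke < length rs" "evalto QG gsQ ((!) rs) ke H"
      "\<And>a. a \<in> letters gsG \<Longrightarrow> kl a < length rs \<and> evalto QG gsQ ((!) rs) (kl a) (H #> letter_val G gsG a)"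
      "kz < length rs" "evalto QG gsQ ((!) rs) kz (H #> inv rep c)"
    and big: "\<And>St B C p. length (header 1 rs (length x) St) + length (body 1 rs (length x) B C p) + 8 +
      2 * (1 * length x + length rs) + 2 * length x \<le> 2 ^ K"
  shows "parsed_query K 1 rs (\<lambda>a j. kl a) ke kz (letters gsG) (\<lambda>x y. y = length rs) (\<lambda>q y. y = length rs + q)
      (\<lambda>j p j'. True) x q \<in> CWP QG gsQ \<longleftrightarrow>
    ranked Ps R \<and> (\<exists>u. evalto G gsG R q u \<and> H #> u = H #> rep c)"
proof -
  interpret parsed gsG x Ps R by (rule parsed)
  let ?rhs = "qrhs rs (left (\<lambda>a j. kl a) ke (Var q 0)) (right (\<lambda>_ _. 0) ke kz)"
  have "parsed_query K 1 rs (\<lambda>a j. kl a) ke kz (letters gsG) (\<lambda>x y. y = length rs) (\<lambda>q y. y = length rs + q)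
      (\<lambda>j p j'. True) x q \<in> CWP QG gsQ \<longleftrightarrow>
    ranked (set (qvars 1 rs (length x))) ?rhs \<and> evalto QG gsQ ?rhs (Var 0 0) \<one>\<^bsub>QG\<^esub>"
    by (rule parsed_query_CWP[OF groups(2) gsQ tab(1) n])
      (use tab q n big in \<open>auto simp: proper_def\<close>)
  also have "\<dots> \<longleftrightarrow> ranked Ps R \<and> evalto QG gsQ ?rhs (Var 0 0) \<one>\<^bsub>QG\<^esub>"
    using ranked_query_D[OF _ n] ranked_query[OF _ tab(2,5) _ _ tab(1) _ n, of 1 "\<lambda>a j. kl a" "\<lambda>_ _. 0" "Var q 0"] tab(4) q
    by blast
  also have "\<dots> \<longleftrightarrow> ranked Ps R \<and> (\<exists>u. evalto G gsG R q u \<and> H #> u = H #> rep c)"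
  proof (rule conj_cong[OF refl])
    assume "ranked Ps R"
    then obtain u where u: "evalto G gsG R q u" using evalto_total[OF closed _ q] by blast
    have uc: "u \<in> carrier G" using evalto_closed[OF is_group gs_closed closed u q] .
    have "evalto QG gsQ ?rhs (Var q 0) (H #> u)"
    proof (rule evalto_query[where sg = "\<lambda>_ u. H #> u" and ac = "\<lambda>_ _. 0" and G = G and m = 1])
      show "H #> v \<in> carrier QG" if "v \<in> carrier G" for v
        using that rcosetsI[OF subset] by (simp add: FactGroup_def)
      show "H #> (v \<otimes> w) = (H #> v) \<otimes>\<^bsub>QG\<^esub> (H #> w)" if "v \<in> carrier G" "w \<in> carrier G" for v w
        using that by (simp add: FactGroup_def rcos_sum)
    qed (use tab q u groups gs_closed in \<open>auto simp: FactGroup_def\<close>)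
    moreover have "?rhs (Var 0 0) = Pair (Var q 0) (Const kz)" by (simp add: left_def right_def)
    ultimately have "evalto QG gsQ ?rhs (Var 0 0) ((H #> u) \<otimes>\<^bsub>QG\<^esub> (H #> inv rep c))"
      using evalto_Const[OF tab(1,6,5)] by (intro evalto.intros(2))
    also have "(H #> u) \<otimes>\<^bsub>QG\<^esub> (H #> inv rep c) = H #> (u \<otimes> inv rep c)"
      using uc rep_closed[OF c] by (simp add: FactGroup_def rcos_sum)
    finally have v: "evalto QG gsQ ?rhs (Var 0 0) (H #> (u \<otimes> inv rep c))" .
    have "H #> (u \<otimes> inv rep c) = H \<longleftrightarrow> H #> u = H #> rep c"
      using coset_one_iff[of "u \<otimes> inv rep c"] coset_eq_iff[of u "rep c"] uc rep_closed[OF c] by simp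
    moreover have "\<one>\<^bsub>QG\<^esub> = H" by (simp add: FactGroup_def)
    ultimately show "evalto QG gsQ ?rhs (Var 0 0) \<one>\<^bsub>QG\<^esub> \<longleftrightarrow> (\<exists>u. evalto G gsG R q u \<and> H #> u = H #> rep c)"
      using v u evalto_unique by metis
  qed
  finally show ?thesis .
qed

text \<open>Here the start is \<open>Var p0 0\<close>, and both factors at position 0 are the
  constant identity. Acyclicity is assumed because the quotient queries have settled it before; it
  provides a value, and with it an index, for every position.\<close>

lemma subgroup_query:
  assumes parsed: "parsed gsG x Ps R" and n: "0 < length x" and p0: "p0 \<in> Ps"
    and ranked: "ranked Ps R" and u0: "evalto G gsG R p0 u0" "H #> u0 = H"
    and tab: "table gsH rs" "ke < length rs" "evalto HG gsH ((!) rs) ke \<one>"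
      "\<And>a j. a \<in> letters gsG \<Longrightarrow> j < m \<Longrightarrow>
        kl a j < length rs \<and> evalto HG gsH ((!) rs) (kl a j) (cocycle j (letter_val G gsG a))"
    and St: "\<And>y. St x y \<longleftrightarrow> y = length rs + m * p0"
    and ax: "\<And>j q j' u. j < m \<Longrightarrow> j' < m \<Longrightarrow> q \<in> Ps \<Longrightarrow> evalto G gsG R q u \<Longrightarrow> ax j q j' \<longleftrightarrow> j' = act j u"
    and big: "\<And>St B C p. length (header m rs (length x) St) + length (body m rs (length x) B C p) + 8 +
      2 * (m * length x + length rs) + 2 * length x \<le> 2 ^ K"
  shows "parsed_query K m rs kl ke ke (letters gsG) St (\<lambda>q y. y = ke) ax x q \<in> CWP HG gsH \<longleftrightarrow> u0 = \<one>"
proof -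
  interpret parsed gsG x Ps R by (rule parsed)
  obtain val where val: "\<And>q. q \<in> Ps \<Longrightarrow> evalto G gsG R q (val q)"
    using evalto_total[OF closed ranked, of _ G] by metis
  have valc: "q \<in> Ps \<Longrightarrow> val q \<in> carrier G" for q
    using evalto_closed[OF is_group gs_closed closed val] by blast
  define ix where "ix = (\<lambda>j q. act j (val q))"
  have ix: "j < m \<Longrightarrow> q \<in> Ps \<Longrightarrow> ix j q < m" for j q unfolding ix_def using act_less valc by blast
  let ?rhs = "qrhs rs (left kl ke (Const ke)) (right ix ke ke)"
  have "parsed_query K m rs kl ke ke (letters gsG) St (\<lambda>q y. y = ke) ax x q \<in> CWP HG gsH \<longleftrightarrow>
    ranked (set (qvars m rs (length x))) ?rhs \<and> evalto HG gsH ?rhs (Var p0 0) \<one>\<^bsub>HG\<^esub>"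
  proof (rule parsed_query_CWP[OF groups(1) gsH tab(1) n])
    show "Var p0 0 \<in> proper m rs (length x)" using Ps_bound[OF p0] m_pos by (simp add: proper_def)
    show "ax j q j' \<longleftrightarrow> j' = ix j q" if "j < m" "q \<in> Ps" "j' < m" for j q j'
      using ax[OF that(1,3,2) val[OF that(2)]] by (simp add: ix_def)
  qed (use tab ix St big in auto)
  also have "\<dots> \<longleftrightarrow> evalto HG gsH ?rhs (Var p0 0) \<one>\<^bsub>HG\<^esub>"
  proof -
    have "ranked (set (qvars m rs (length x))) ?rhs"
      by (rule ranked_query[OF _ tab(2,2) _ _ tab(1) ranked n]) (use tab(2,4) ix in auto)
    then show ?thesis by blast
  qed
  also have "\<dots> \<longleftrightarrow> u0 = \<one>"
  proof -
    have "evalto HG gsH ?rhs (Var p0 0) (cocycle 0 u0)"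
    proof (rule evalto_query[where sg = cocycle and ac = act and G = G and m = m])
      show "ix j q = act j u" if "q \<in> Ps" "evalto G gsG R q u" for j q u
        unfolding ix_def using evalto_unique[OF val[OF that(1)] that(2)] by simp
    qed (use tab u0 p0 groups gs_closed ix m_pos cocycle_closed cocycle_mult in auto)
    moreover have "cocycle 0 u0 = u0"
      using cocycle_0 u0(2) evalto_closed[OF is_group gs_closed closed u0(1) p0] by blast
    ultimately have e: "evalto HG gsH ?rhs (Var p0 0) u0" by simp
    have one: "\<one>\<^bsub>HG\<^esub> = \<one>" by simp
    show ?thesis
    proof
      assume "evalto HG gsH ?rhs (Var p0 0) \<one>\<^bsub>HG\<^esub>"
      from evalto_unique[OF e this] show "u0 = \<one>" unfolding one .
    next
      assume "u0 = \<one>"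
      with e show "evalto HG gsH ?rhs (Var p0 0) \<one>\<^bsub>HG\<^esub>" unfolding one by simp
    qed
  qed
  finally show ?thesis .
qed

theorem CWP_reducible: "AC0_reducible (CWP G gsG) [CWP HG gsH, CWP QG gsQ]"
proof -
  let ?Bs = "[CWP HG gsH, CWP QG gsQ]"
  let ?L = "letters gsG"
  obtain rsQ klQ keQ kzQ where Q: "table gsQ rsQ" "keQ < length rsQ" "evalto QG gsQ ((!) rsQ) keQ H"
      "\<And>a. a \<in> ?L \<Longrightarrow> klQ a < length rsQ \<and> evalto QG gsQ ((!) rsQ) (klQ a) (H #> letter_val G gsG a)"
      "\<And>c. c < m \<Longrightarrow> kzQ c < length rsQ" "\<And>c. c < m \<Longrightarrow> evalto QG gsQ ((!) rsQ) (kzQ c) (H #> inv rep c)"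
    using quotient_table by blast
  obtain rsH klH keH where S: "table gsH rsH" "keH < length rsH" "evalto HG gsH ((!) rsH) keH \<one>"
      "\<And>a j. a \<in> ?L \<Longrightarrow> j < m \<Longrightarrow>
        klH a j < length rsH \<and> evalto HG gsH ((!) rsH) (klH a j) (cocycle j (letter_val G gsG a))"
    using subgroup_table by blast
  define QA where "QA c K x q \<longleftrightarrow> parsed_query K 1 rsQ (\<lambda>a j. klQ a) keQ (kzQ c) ?L (\<lambda>x y. y = length rsQ)
      (\<lambda>q y. y = length rsQ + q) (\<lambda>j p j'. True) x q \<in> ?Bs ! 1" for c K x q
  define St where "St x y \<longleftrightarrow> (\<exists>p\<le>length x. refers x 0 p \<and> y = length rsH + m * p)" for x y
  \<comment> \<open>Oracle use is nested here: bits of the query to \<open>CWP HG\<close> depend on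
    queries to \<open>CWP QG\<close>, through a disjunction over the finitely many cosets.\<close>
  define ax where "ax K x j q j' \<longleftrightarrow> (\<exists>c\<in>{..<m}. j' = act j (rep c) \<and> QA c K x q)" for K x j q j'
  define SA where "SA K x q \<longleftrightarrow> parsed_query K m rsH klH keH keH ?L St (\<lambda>q y. y = keH) (ax K x) x q \<in> ?Bs ! 0" for K x q
  have dQA: "definable ?Bs (\<lambda>K x s. QA c K x (s i))" for c i
    unfolding QA_def
    by (rule definable_parsed_query[OF finite_letters], simp, (intro definable_intros definable_const)+)
  have dSt: "definable ?Bs (\<lambda>K x s. St x (s v))" for v
    unfolding St_def
    by (rule definable_ex_le[where r = "v + 1"]) (intro definable_intros definable_refers_0, simp)
  have dax: "definable ?Bs (\<lambda>K x s. ax K x j (s i) j')" for i j j'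
    unfolding ax_def by (intro definable_bex definable_conj definable_const dQA) simp
  have dSA: "definable ?Bs (\<lambda>K x s. SA K x (s i))" for i
    unfolding SA_def
    by (rule definable_parsed_query[OF finite_letters], simp, (intro definable_intros dSt dax)+)
  \<comment> \<open>Index 0 stands for the coset \<open>H\<close>, since \<open>rep 0\<close> is the
    identity. This conjunct also rejects cyclic programs, about which \<open>SA\<close> says nothing
    reliable.\<close>
  have "definable ?Bs (\<lambda>K x s. \<exists>q\<le>length x. refers x 0 q \<and> QA 0 K x q)"
    by (rule definable_ex_le[where r = 0]) (intro definable_conj definable_refers_0 dQA, simp)
  then have "definable ?Bs (\<lambda>K x s. well_formed (code ` ?L) x \<and> (\<exists>q\<le>length x. refers x 0 q \<and> QA 0 K x q) \<and> SA K x (s 0))"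
    by (intro definable_conj definable_well_formed finite_imageI finite_letters dSA)
  moreover obtain kQ where kQ: "\<And>K x s St B C p. adm kQ K x s \<Longrightarrow> length (header 1 rsQ (length x) St) +
      length (body 1 rsQ (length x) B C p) + 8 + 2 * (1 * length x + length rsQ) + 2 * length x \<le> 2 ^ K"
    using query_large[of 1 rsQ] by blast
  moreover obtain kS where kS: "\<And>K x s St B C p. adm kS K x s \<Longrightarrow> length (header m rsH (length x) St) +
      length (body m rsH (length x) B C p) + 8 + 2 * (m * length x + length rsH) + 2 * length x \<le> 2 ^ K"
    using query_large[of m rsH] by blast
  have "well_formed (code ` ?L) x \<and> (\<exists>q\<le>length x. refers x 0 q \<and> QA 0 K x q) \<and> SA K x (s 0) \<longleftrightarrow> x \<in> CWP G gsG"
    if adm: "adm (max kQ kS) K x s" for K x s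
  proof (cases "well_formed (code ` ?L) x")
    case False
    then show ?thesis using CWP_well_formed by blast
  next
    case True
    obtain Ps p0 nm R where x: "x = slp_text nm Ps p0 R" "distinct Ps" "set Ps = {p. rule_at x p}"
      "inj_on nm (set Ps)" "p0 \<in> set Ps" "closed_slp gsG (set Ps) R" "\<And>q. refers x 0 q \<longleftrightarrow> q = p0"
      "\<forall>p\<in>set Ps. (\<forall>q r. pair_rule x p q r \<longleftrightarrow> R p = Pair q r) \<and> (\<forall>a. letter_at x p (code a) \<longleftrightarrow> R p = Letter a)"
      using well_formed_decode[OF True] by blast
    have parsed: "parsed gsG x (set Ps) R"
      by unfold_locales (use x in auto)
    have p0: "0 < p0" "p0 < length x" using parsed.Ps_bound[OF parsed x(5)] by auto
    then have n: "0 < length x" by linarith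
    have CWP: "x \<in> CWP G gsG \<longleftrightarrow> ranked (set Ps) R \<and> evalto G gsG R p0 \<one>"
      using slp_text_CWP[OF is_group gs_closed x(2,5,4,6)] x(1) by simp
    note aQ = adm_mono[OF adm, of kQ, simplified] and aS = adm_mono[OF adm, of kS, simplified]
    have QA: "QA c K x q \<longleftrightarrow> ranked (set Ps) R \<and> (\<exists>u. evalto G gsG R q u \<and> H #> u = H #> rep c)"
      if "q \<in> set Ps" "c < m" for q c
      using quotient_query[OF parsed n that Q(1-4) Q(5,6)[OF that(2)] kQ[OF aQ]] by (simp add: QA_def)
    have start: "(\<exists>q\<le>length x. refers x 0 q \<and> QA 0 K x q) \<longleftrightarrow> QA 0 K x p0"
      using x(7) p0 by auto
    have repH: "H #> rep 0 = H" using coset_one_iff[OF one_closed] one_closed rep_0 by simp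
    show ?thesis
    proof (cases "ranked (set Ps) R")
      case False
      then show ?thesis unfolding start CWP QA[OF x(5) m_pos] by blast
    next
      case ranked: True
      obtain u0 where u0: "evalto G gsG R p0 u0" using evalto_total[OF x(6) ranked x(5)] by blast
      have Q0: "QA 0 K x p0 \<longleftrightarrow> H #> u0 = H"
        unfolding QA[OF x(5) m_pos] repH using ranked u0 evalto_unique by metis
      have SA: "SA K x (s 0) \<longleftrightarrow> u0 = \<one>" if "H #> u0 = H"
      proof -
        have St: "St x y \<longleftrightarrow> y = length rsH + m * p0" for y
          unfolding St_def x(7) using p0 by auto
        have ax: "ax K x j q j' \<longleftrightarrow> j' = act j u" if "j < m" "j' < m" "q \<in> set Ps" "evalto G gsG R q u" for j q j' u
        proof -
          have u: "u \<in> carrier G" using evalto_closed[OF is_group gs_closed x(6) that(4,3)] .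
          have "QA c K x q \<longleftrightarrow> c = idx u" if "c < m" for c
            unfolding QA[OF \<open>q \<in> set Ps\<close> that]
            using ranked \<open>evalto G gsG R q u\<close> evalto_unique idx[OF u] idx_eq[OF u that] by metis
          then have "ax K x j q j' \<longleftrightarrow> j' = act j (rep (idx u))"
            unfolding ax_def using idx[OF u] by auto
          also have "act j (rep (idx u)) = act j u"
            using act_cong[OF \<open>j < m\<close> u rep_closed[of "idx u"]] idx[OF u] by simp
          finally show ?thesis .
        qed
        show ?thesis
          unfolding SA_def nth_Cons_0
          by (rule subgroup_query[OF parsed n x(5) ranked u0 that S(1-3)]) (fact S(4) St ax kS[OF aS])+
      qed
      have "evalto G gsG R p0 \<one> \<longleftrightarrow> u0 = \<one>" using u0 evalto_unique by metis
      moreover have "H #> \<one> = H" using coset_one_iff[OF one_closed] by simp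
      ultimately show ?thesis unfolding start Q0 CWP using True ranked SA by blast
    qed
  qed
  ultimately have "definable ?Bs (\<lambda>K x s. x \<in> CWP G gsG)"
    by (elim definable_cong)
  then show ?thesis by (rule definable_AC0)
qed

end

text \<open>\<open>H\<close> is put first in the list of cosets, so that index 0 belongs to it and
  the identity can be its representative.\<close>

lemma (in normal) finite_extension_exists:
  assumes "finite (rcosets H)"
  shows "\<exists>m rep idx. rep 0 = \<one> \<and> (\<forall>c<m. rep c \<in> carrier G) \<and>
    (\<forall>c<m. \<forall>c'<m. H #> rep c = H #> rep c' \<longrightarrow> c = (c'::nat)) \<and>
    (\<forall>u\<in>carrier G. idx u < m \<and> H #> u = H #> rep (idx u))"
proof -
  obtain cs where cs: "distinct cs" "set cs = rcosets H - {H}"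
    using finite_distinct_list[of "rcosets H - {H}"] assms by blast
  have H1: "H #> \<one> = H" using coset_mult_one[OF subset] .
  then have HH: "H \<in> rcosets H" using rcosetsI[OF subset one_closed] by simp
  define f where "f = H # cs"
  have f: "distinct f" "set f = rcosets H" using cs HH by (auto simp: f_def)
  define rep where "rep c = (if c = 0 then \<one> else SOME g. g \<in> carrier G \<and> H #> g = f ! c)" for c
  have rep: "rep c \<in> carrier G \<and> H #> rep c = f ! c" if "c < length f" for c
  proof (cases "c = 0")
    case True
    then show ?thesis using H1 by (simp add: rep_def f_def)
  next
    case False
    have "f ! c \<in> rcosets H" using f that nth_mem by blast
    then have "\<exists>g. g \<in> carrier G \<and> H #> g = f ! c" by (auto simp: RCOSETS_def)
    then show ?thesis unfolding rep_def using False someI_ex by simp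
  qed
  have "\<forall>u\<in>carrier G. \<exists>c<length f. f ! c = H #> u"
    using rcosetsI[OF subset] f(2) by (metis in_set_conv_nth)
  then obtain idx where idx: "\<And>u. u \<in> carrier G \<Longrightarrow> idx u < length f \<and> f ! idx u = H #> u" by metis
  show ?thesis
    using rep idx f(1) by (intro exI[of _ "length f"] exI[of _ rep] exI[of _ idx])
      (auto simp: nth_eq_iff_index_eq, simp add: rep_def)
qed

text \<open>The three generating lists are independent of each other: the letters of
  \<open>gsG\<close> reach the subgroup and the quotient only through tables of constants.\<close>

theorem theorem8:
  fixes G :: "('a, 'b) monoid_scheme" and H :: "'a set"
    and gsG gsH :: "'a list" and gsQ :: "'a set list"
  assumes "group G" and "generating_list G gsG"
    and "H \<lhd> G" and "finite (rcosets\<^bsub>G\<^esub> H)"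
    and "generating_list (G\<lparr>carrier := H\<rparr>) gsH"
    and "generating_list (G Mod H) gsQ"
  shows "AC0_reducible (CWP G gsG) [CWP (G\<lparr>carrier := H\<rparr>) gsH, CWP (G Mod H) gsQ]"
proof -
  interpret normal H G by (rule assms(3))
  obtain m rep idx where "rep 0 = \<one>\<^bsub>G\<^esub>" and rep: "\<forall>c<m. rep c \<in> carrier G"
    "\<forall>c<m. \<forall>c'<m. H #>\<^bsub>G\<^esub> rep c = H #>\<^bsub>G\<^esub> rep c' \<longrightarrow> c = (c'::nat)"
    "\<forall>u\<in>carrier G. idx u < m \<and> H #>\<^bsub>G\<^esub> u = H #>\<^bsub>G\<^esub> rep (idx u)"
    using finite_extension_exists[OF assms(4)] by blast
  then interpret finite_extension H G gsG gsH gsQ m rep idx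
    by (intro finite_extension.intro finite_extension_axioms.intro normal_axioms assms(2,5,6))
      (assumption | rule rep[rule_format] | (erule (2) rep(2)[rule_format]))+
  show ?thesis by (rule CWP_reducible)
qed

end
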